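(* Consider, for each $n\in\mathbb{N}$, independent observations $Y_{ni}=\mu_n(x_{ni})+\varepsilon_{ni}$, $1\le i\le n$, with fixed design points $x_{ni}\in\mathcal{X}_n$, regression function $\mu_n\in\mathcal{M}_n$, and independent random errors $\varepsilon_{n1},\ldots,\varepsilon_{nn}$ with mean zero and common distribution $Q_n\in\mathcal{Q}_o(1)\cap\mathcal{Q}^1(1)$. Suppose that: (A.1) $\mathcal{M}_n(\boldsymbol{x}_n)$ is a closed subset of $\mathbb{R}^n$ for every $n\in\mathbb{N}$; (A.2) $D_1(Q_n,Q)\to0$ for some distribution $Q\in\mathcal{Q}_o(1)\cap\mathcal{Q}^1(1)$; (A.3) for arbitrary fixed $c>0$, $$\sup_{m\in\mathcal{M}_n:\,\|(m-\mu_n)(\boldsymbol{x}_n)\|_n\le c}D_{\mathrm{BL}}(\hat Q_{n,m},Q_{n,m})\to_p0\qquad(n\to\infty).$$ Then, with $f_n:=\exp\circ\,\psi(\cdot\,|\,Q_n)$ and $\hat f_n:=\exp\circ\,\hat\psi_n$, the maximum likelihood estimator $(\hat f_n,\hat\mu_n)$ of $(f_n,\mu_n)$ exists with asymptotic probability one (i.e., with probability tending to one as $n\to\infty$) and satisfies $$\int|\hat f_n(x)-f_n(x)|\,dx\to_p0,\qquad \|(\hat\mu_n-\mu_n)(\boldsymbol{x}_n)\|_n\to_p0.$$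
   Context: For each $n$, $\mathcal{X}_n$ is a set and $\mathcal{M}_n$ is a given family of functions $m:\mathcal{X}_n\to\mathbb{R}$ with $m+c\in\mathcal{M}_n$ for all $m\in\mathcal{M}_n$, $c\in\mathbb{R}$. Notation: $\boldsymbol{x}_n=(x_{ni})_{i=1}^n$, $m(\boldsymbol{x}_n)=(m(x_{ni}))_{i=1}^n$, $\mathcal{M}_n(\boldsymbol{x}_n)=\{m(\boldsymbol{x}_n):m\in\mathcal{M}_n\}\subset\mathbb{R}^n$, and $\|\boldsymbol{v}\|_n:=\frac1n\sum_{i=1}^n|v_i|$ for $\boldsymbol{v}\in\mathbb{R}^n$. $\to_p$ denotes convergence in probability. $\mathcal{Q}^1(1)$: probability distributions on $\mathbb{R}$ with finite first moment. $\mathcal{Q}_o(1)$: probability distributions on $\mathbb{R}$ whose convex support (the intersection of all closed convex sets of probability one) has nonempty interior, i.e. which are not Dirac measures. $D_1(Q,Q'):=\inf\mathbb{E}|X-X'|$ over all couplings $X\sim Q$, $X'\sim Q'$ (Mallows/Wasserstein-1 distance). $D_{\mathrm{BL}}(Q,Q'):=\sup_{h\in\mathcal{H}_{\mathrm{BL}}}\left|\int h\,d(Q-Q')\right|$, where $\mathcal{H}_{\mathrm{BL}}$ is the family of all $h:\mathbb{R}\to[-1,1]$ with $|h(x)-h(y)|\le|x-y|$ for all $x,y\in\mathbb{R}$. $\hat Q_{n,m}:=\frac1n\sum_{i=1}^n\delta_{Y_{ni}-m(x_{ni})}$ is the empirical distribution of the residuals, and $Q_{n,m}:=\mathbb{E}\hat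 Q_{n,m}=Q_n\star\bigl(\frac1n\sum_{i=1}^n\delta_{\mu_n(x_{ni})-m(x_{ni})}\bigr)$ is its expectation measure ($\star$ = convolution). $\Phi=\Phi(1)$ is the family of concave, upper semicontinuous functions $\phi:\mathbb{R}\to[-\infty,\infty)$ with $\phi(x)\to-\infty$ as $|x|\to\infty$. $L(\phi,Q):=\int\phi\,dQ-\int e^{\phi(x)}\,dx+1$. For $Q\in\mathcal{Q}_o(1)\cap\mathcal{Q}^1(1)$, $\psi(\cdot\,|\,Q)$ is the unique maximizer of $L(\cdot,Q)$ over $\Phi$ (it exists, is unique, and $e^{\psi(\cdot|Q)}$ is a probability density). $(\hat\psi_n,\hat\mu_n)$ denotes a maximizer (not necessarily unique) of $L(\phi,\hat Q_{n,m})$ over all pairs $(\phi,m)\in\Phi\times\mathcal{M}_n$ such that $\int e^{\phi(x)}\,dx=1$ and $\int x\,e^{\phi(x)}\,dx=0$. *)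

theory Defs
  imports "HOL-Probability.Probability"
begin

text \<open>
  Vectors \<open>v \<in> \<real>\<^sup>n\<close> are functions \<open>v :: nat \<Rightarrow> real\<close> of which only the values on \<open>{1..n}\<close> matter.
\<close>

definition mean_abs :: "nat \<Rightarrow> (nat \<Rightarrow> real) \<Rightarrow> real" where
  "mean_abs n v = (1 / real n) * (\<Sum>i=1..n. \<bar>v i\<bar>)"

definition finite_mean_distributions :: "real measure set" where
  "finite_mean_distributions = {Q. real_distribution Q \<and> integrable Q (\<lambda>x. x)}"

definition convex_support :: "real measure \<Rightarrow> real set" where
  "convex_support Q = \<Inter>{C. closed C \<and> convex C \<and> measure Q C = 1}"

definition nondegenerate_distributions :: "real measure set" where
  "nondegenerate_distributions =
     {Q. real_distribution Q \<and> interior (convex_support Q) \<noteq> {}}"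

definition couplings :: "real measure \<Rightarrow> real measure \<Rightarrow> (real \<times> real) measure set" where
  "couplings Q Q' = {\<pi>. sets \<pi> = sets (borel \<Otimes>\<^sub>M borel) \<and>
     distr \<pi> borel fst = Q \<and> distr \<pi> borel snd = Q'}"

definition D1 :: "real measure \<Rightarrow> real measure \<Rightarrow> ennreal" where
  "D1 Q Q' = (INF \<pi>\<in>couplings Q Q'. \<integral>\<^sup>+ z. ennreal \<bar>fst z - snd z\<bar> \<partial>\<pi>)"

definition H_BL :: "(real \<Rightarrow> real) set" where
  "H_BL = {h. (\<forall>x. h x \<in> {-1..1}) \<and> (\<forall>x y. \<bar>h x - h y\<bar> \<le> \<bar>x - y\<bar>)}"

text \<open>For probability measures the set under the supremum is bounded by 2, so the real-valued
  supremum is the intended one.\<close>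

definition D_BL :: "real measure \<Rightarrow> real measure \<Rightarrow> real" where
  "D_BL Q Q' = (SUP h\<in>H_BL. \<bar>(\<integral>x. h x \<partial>Q) - (\<integral>x. h x \<partial>Q')\<bar>)"

text \<open>The empirical distribution \<open>(1/n) \<Sum>\<^sub>i \<delta>(v i)\<close>, written as the image under \<open>v\<close> of the uniform
  distribution on the indices.\<close>

definition empirical :: "nat \<Rightarrow> (nat \<Rightarrow> real) \<Rightarrow> real measure" where
  "empirical n v = distr (uniform_count_measure {1..n}) borel v"

lemma measure_empirical:
  assumes "A \<in> sets borel"
  shows "measure (empirical n v) A = (1 / real n) * (\<Sum>i=1..n. indicator A (v i))"
proof -
  have "measure (empirical n v) A = measure (uniform_count_measure {1..n}) (v -` A \<inter> {1..n})"
    unfolding empirical_def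
    by (subst measure_distr) (auto simp: assms space_uniform_count_measure
        measurable_def sets_uniform_count_measure)
  also have "\<dots> = real (card (v -` A \<inter> {1..n})) / real n"
    by (subst measure_uniform_count_measure) auto
  also have "real (card (v -` A \<inter> {1..n})) = (\<Sum>i=1..n. indicator A (v i))"
    by (simp add: indicator_def sum.If_cases Int_def vimage_def conj_commute)
  finally show ?thesis by simp
qed

text \<open>Hence \<open>Q \<star> empirical n v\<close> is the expectation measure of the empirical distribution of
  \<open>v i + \<epsilon> i\<close> when all \<open>\<epsilon> i\<close> have distribution \<open>Q\<close>.\<close>

lemma measure_convolution_empirical:
  assumes "prob_space P" "real_distribution Q" "n \<ge> 1" "A \<in> sets borel"
    and "\<And>i. i \<in> {1..n} \<Longrightarrow> \<epsilon> i \<in> borel_measurable P"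
    and "\<And>i. i \<in> {1..n} \<Longrightarrow> distr P borel (\<epsilon> i) = Q"
  shows "measure (Q \<star> empirical n v) A
    = (\<integral>\<omega>. measure (empirical n (\<lambda>i. v i + \<epsilon> i \<omega>)) A \<partial>P)"
proof -
  interpret P: prob_space P by fact
  interpret Q: real_distribution Q by fact
  define g where "g z = measure Q ((\<lambda>y. z + y) -` A)" for z
  interpret U: prob_space "uniform_count_measure {1..n}"
    using assms(3) by (intro prob_space_uniform_count_measure) auto
  have v: "v \<in> measurable (uniform_count_measure {1..n}) borel"
    by (auto simp: measurable_def sets_uniform_count_measure space_uniform_count_measure)
  interpret E: prob_space "empirical n v"
    unfolding empirical_def by (rule U.prob_space_distr[OF v])
  have setsE: "sets (empirical n v) = sets borel" by (simp add: empirical_def)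
  have shift: "(\<lambda>y. z + y) -` A \<in> sets borel" for z :: real
    using measurable_sets_borel[of "\<lambda>y. z + y" borel A] assms(4) by simp
  have "emeasure (Q \<star> empirical n v) A = emeasure (empirical n v \<star> Q) A"
    by (subst convolution_commutative) (auto simp: setsE E.finite_measure_axioms Q.finite_measure_axioms)
  also have "\<dots> = (\<integral>\<^sup>+z. ennreal (g z) \<partial>empirical n v)"
    by (subst convolution_emeasure)
       (auto simp: setsE sets_eq_imp_space_eq[OF setsE] E.finite_measure_axioms
         Q.finite_measure_axioms assms(4) g_def
         Q.emeasure_eq_measure vimage_def add.commute intro!: nn_integral_cong arg_cong[where f = "measure Q"])
  also have "\<dots> = (\<integral>\<^sup>+i. ennreal (g (v i)) \<partial>uniform_count_measure {1..n})"
  proof -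
    have "(\<lambda>(z, y). z + y) -` A \<inter> space (borel \<Otimes>\<^sub>M borel) \<in> sets (borel \<Otimes>\<^sub>M borel)"
      by (rule measurable_sets[OF _ assms(4)]) measurable
    then have "(\<lambda>z. emeasure Q (Pair z -` ((\<lambda>(z, y). z + y) -` A \<inter> space (borel \<Otimes>\<^sub>M borel))))
        \<in> borel_measurable borel"
      by (intro Q.measurable_emeasure_Pair) (simp cong: sets_pair_measure_cong)
    then have "(\<lambda>z. ennreal (g z)) \<in> borel_measurable borel"
      by (simp add: g_def Q.emeasure_eq_measure vimage_def space_pair_measure)
    then show ?thesis unfolding empirical_def by (subst nn_integral_distr[OF v]) auto
  qed
  also have "\<dots> = (\<Sum>i=1..n. ennreal (g (v i) / n))"
    unfolding uniform_count_measure_def using assms(3)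
    by (subst nn_integral_point_measure_finite)
       (auto simp: ennreal_mult[symmetric] g_def intro!: sum.cong)
  also have "\<dots> = ennreal (\<Sum>i=1..n. g (v i) / n)"
    by (rule sum_ennreal) (auto simp: g_def)
  finally have lhs: "measure (Q \<star> empirical n v) A = (\<Sum>i=1..n. g (v i) / n)"
    by (simp add: measure_def[of "Q \<star> empirical n v"] g_def sum_nonneg)
  have ev: "(\<integral>\<omega>. indicator A (v i + \<epsilon> i \<omega>) \<partial>P) = g (v i)"
    and int: "integrable P (\<lambda>\<omega>. indicator A (v i + \<epsilon> i \<omega>) :: real)" if i: "i \<in> {1..n}" for i
  proof -
    note [measurable] = assms(5)[OF i] assms(4)
    show "integrable P (\<lambda>\<omega>. indicator A (v i + \<epsilon> i \<omega>) :: real)"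
      by (rule P.integrable_const_bound[where B = 1]) (auto simp: indicator_def)
    have "g (v i) = measure (distr P borel (\<epsilon> i)) ((\<lambda>y. v i + y) -` A)"
      by (simp add: g_def assms(6)[OF i])
    also have "\<dots> = measure P {\<omega> \<in> space P. v i + \<epsilon> i \<omega> \<in> A}"
      by (subst measure_distr) (auto simp: shift assms(5)[OF i] intro!: arg_cong[where f = "measure P"])
    also have "\<dots> = (\<integral>\<omega>. indicator {\<omega> \<in> space P. v i + \<epsilon> i \<omega> \<in> A} \<omega> \<partial>P)"
      by (subst Bochner_Integration.integral_indicator) (auto intro!: arg_cong[where f = "measure P"])
    also have "\<dots> = (\<integral>\<omega>. indicator A (v i + \<epsilon> i \<omega>) \<partial>P)"
      by (rule Bochner_Integration.integral_cong) (auto simp: indicator_def)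
    finally show "(\<integral>\<omega>. indicator A (v i + \<epsilon> i \<omega>) \<partial>P) = g (v i)" by simp
  qed
  have "(\<integral>\<omega>. measure (empirical n (\<lambda>i. v i + \<epsilon> i \<omega>)) A \<partial>P)
      = (1 / real n) * (\<Sum>i=1..n. g (v i))"
    using int by (simp add: measure_empirical assms(4) ev Bochner_Integration.integral_sum)
  then show ?thesis by (simp add: lhs sum_divide_distrib)
qed

text \<open>The class \<open>\<Phi>\<close>. As the value \<open>\<infinity>\<close> is excluded, no undefined sum \<open>\<infinity> - \<infinity>\<close> occurs in the
  concavity condition; the two limits as \<open>\<bar>x\<bar> \<rightarrow> \<infinity>\<close> are expressed by \<open>at_infinity\<close>.\<close>

definition Phi :: "(real \<Rightarrow> ereal) set" where
  "Phi = {\<phi>. (\<forall>x. \<phi> x \<noteq> \<infinity>) \<and>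
     (\<forall>x y t. 0 < t \<and> t < 1 \<longrightarrow>
        ereal (1 - t) * \<phi> x + ereal t * \<phi> y \<le> \<phi> ((1 - t) * x + t * y)) \<and>
     (\<forall>x. Limsup (at x) \<phi> \<le> \<phi> x) \<and>
     (\<phi> \<longlongrightarrow> -\<infinity>) at_infinity}"

text \<open>\<open>exp \<circ> \<phi>\<close> with \<open>exp (-\<infinity>) = 0\<close>; only applied to \<open>\<phi>\<close> without the value \<open>\<infinity>\<close>.\<close>

definition exp_of :: "(real \<Rightarrow> ereal) \<Rightarrow> real \<Rightarrow> real" where
  "exp_of \<phi> x = (if \<phi> x = -\<infinity> then 0 else exp (real_of_ereal (\<phi> x)))"

text \<open>The integral of an extended real-valued function, as the difference of the integrals of
  its positive and negative parts (\<open>e2ennreal\<close> sends negative arguments to 0). For \<open>\<phi> \<in> Phi\<close>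
  the positive part is bounded, so the integral lies in \<open>[-\<infinity>, \<infinity>)\<close>.\<close>

definition ext_integral :: "real measure \<Rightarrow> (real \<Rightarrow> ereal) \<Rightarrow> ereal" where
  "ext_integral Q \<phi> =
     enn2ereal (\<integral>\<^sup>+x. e2ennreal (\<phi> x) \<partial>Q) - enn2ereal (\<integral>\<^sup>+x. e2ennreal (- \<phi> x) \<partial>Q)"

definition L :: "(real \<Rightarrow> ereal) \<Rightarrow> real measure \<Rightarrow> ereal" where
  "L \<phi> Q = ext_integral Q \<phi> - enn2ereal (\<integral>\<^sup>+x. ennreal (exp_of \<phi> x) \<partial>lborel) + 1"

text \<open>\<open>\<psi>(\<cdot> | Q)\<close>; for nondegenerate \<open>Q\<close> with finite mean the maximizer exists and is unique.\<close>

definition psi :: "real measure \<Rightarrow> real \<Rightarrow> ereal" where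
  "psi Q = arg_max (\<lambda>\<phi>. L \<phi> Q) (\<lambda>\<phi>. \<phi> \<in> Phi)"

text \<open>\<open>(\<phi>, m)\<close> is a maximum likelihood estimator for the design points \<open>x\<close>, the
  observations \<open>y\<close> and the family \<open>M\<close> of regression functions.\<close>

definition is_mle ::
  "nat \<Rightarrow> (nat \<Rightarrow> 'a) \<Rightarrow> ('a \<Rightarrow> real) set \<Rightarrow> (nat \<Rightarrow> real) \<Rightarrow> (real \<Rightarrow> ereal) \<times> ('a \<Rightarrow> real) \<Rightarrow> bool"
  where
  "is_mle n x M y = is_arg_max
     (\<lambda>(\<phi>, m). L \<phi> (empirical n (\<lambda>i. y i - m (x i))))
     (\<lambda>(\<phi>, m). \<phi> \<in> Phi \<and> m \<in> M \<and>
        (\<integral>\<^sup>+t. ennreal (exp_of \<phi> t) \<partial>lborel) = 1 \<and> (\<integral>t. t * exp_of \<phi> t \<partial>lborel) = 0)"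

text \<open>The events \<open>E n\<close> hold with probability tending to one. The events need not be measurable:
  inner probability is used, which is the probability itself for measurable \<open>E n\<close>.\<close>

definition asymptotic_probability_one :: "(nat \<Rightarrow> 'w measure) \<Rightarrow> (nat \<Rightarrow> 'w set) \<Rightarrow> bool" where
  "asymptotic_probability_one P E \<longleftrightarrow>
     (\<exists>A. (\<forall>n. A n \<in> sets (P n) \<and> A n \<subseteq> E n) \<and> (\<lambda>n. measure (P n) (A n)) \<longlonglongrightarrow> 1)"

text \<open>\<open>Z n \<rightarrow>\<^sub>p 0\<close>, where \<open>Z n\<close> lives on the probability space \<open>P n\<close>.\<close>

definition tends_in_probability_0 ::
  "(nat \<Rightarrow> 'w measure) \<Rightarrow> (nat \<Rightarrow> 'w \<Rightarrow> real) \<Rightarrow> bool" where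
  "tends_in_probability_0 P Z \<longleftrightarrow>
     (\<forall>\<delta>>0. asymptotic_probability_one P (\<lambda>n. {\<omega> \<in> space (P n). \<bar>Z n \<omega>\<bar> \<le> \<delta>}))"

end

theory Submission
  imports Defs
begin

text \<open>
  Write \<open>L(Q)\<close> for the maximum of \<open>L(\<cdot>, Q)\<close>. The proof compares the likelihood of the estimator with that
  of the truth, and rests on how \<open>L(Q)\<close> behaves under limits and under convolution.

  A log-density of mass one with a high mode is narrow and falls off quickly (\<open>Phi_mode_envelope\<close>),
  which costs likelihood as soon as \<open>Q\<close> is spread out. So likelihoods are bounded above by the spread
  of \<open>Q\<close>, and log-densities whose likelihoods stay bounded below share an exponential envelope
  (\<open>uniform_envelope\<close>). Under a common envelope they are compact for convergence of hypographs, and the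
  likelihood is upper semicontinuous even when the distributions converge only weakly
  (\<open>loglik_compactness\<close>). This gives existence of \<open>\<psi>(\<cdot>|Q)\<close> and, in a finite-dimensional version, of the
  estimator whenever the data cannot be fitted exactly (\<open>is_mle_exists\<close>). In the other direction,
  \<open>L(Q)\<close> is lower semicontinuous when the mean absolute values converge as well (\<open>maximum_lsc\<close>). Together
  with uniqueness of the maximiser (\<open>maximiser_unique\<close>) this makes \<open>\<psi>(\<cdot>|Q\<^sub>n)\<close> converge to \<open>\<psi>(\<cdot>|Q)\<close>.

  Write \<open>\<mu>'\<^sub>n\<close> for the estimated regression function. The residuals of the estimator are
  \<open>\<epsilon>\<^sub>i - (\<mu>'\<^sub>n - \<mu>\<^sub>n)(x\<^sub>i)\<close>, so by the third assumption their empirical law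
  is close to \<open>Q\<^sub>n \<star> R\<^sub>n\<close>, where \<open>R\<^sub>n\<close> is the empirical law of the values of \<open>\<mu>\<^sub>n - \<mu>'\<^sub>n\<close>. The estimator beats
  the true regression function, whose likelihood approaches \<open>L(Q)\<close>. Hence a limit \<open>R\<close> of the \<open>R\<^sub>n\<close> satisfies
  \<open>L(Q \<star> R) \<ge> L(Q)\<close>. But convolution averages the likelihoods of translated densities under \<open>Q\<close>, and can
  reach \<open>L(Q)\<close> only if one translate serves almost all shifts, so \<open>R\<close> is a point mass; the density of the
  estimator is centred, and so is \<open>exp \<psi>(\<cdot>|Q)\<close> by \<open>maximiser_mean\<close>, so this point is zero
  (\<open>convolution_maximum_degenerate\<close>). Weak convergence of \<open>R\<^sub>n\<close> to zero becomes convergence in mean because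
  a first moment that escaped to infinity would reduce the likelihood in the limit
  (\<open>mean_abs_difference_tendsto_0\<close>).

  All of this is an argument about sequences of numbers (\<open>consistency_deterministic\<close>). Probability enters
  only through the third assumption and through a law of large numbers for the absolute errors
  (\<open>mean_abs_error_concentrates\<close>), which follows from that assumption at \<open>m = \<mu>\<^sub>n\<close>
  and the convergence of \<open>Q\<^sub>n\<close> in \<open>D\<^sub>1\<close>.
\<close>

section \<open>Log-concave densities\<close>

lemma abs_convex_combination:
  "0 \<le> u \<Longrightarrow> u \<le> 1 \<Longrightarrow> \<bar>(1 - u) * x + u * y\<bar> \<le> (1 - u) * \<bar>x\<bar> + u * \<bar>y\<bar>" for u x y :: real
  by (metis abs_mult abs_of_nonneg abs_triangle_ineq diff_ge_0_iff_ge)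

text \<open>Membership in \<^term>\<open>Phi\<close> is tested against real numbers below and above the values. This avoids
  arithmetic with \<open>-\<infinity>\<close>, and a linear envelope replaces the limits at infinity.\<close>

lemma PhiI:
  assumes fin: "\<And>x. \<phi> x \<noteq> \<infinity>"
    and conc: "\<And>x y s t u. 0 < u \<Longrightarrow> u < 1 \<Longrightarrow> ereal s < \<phi> x \<Longrightarrow> ereal t < \<phi> y
      \<Longrightarrow> ereal ((1 - u) * s + u * t) \<le> \<phi> ((1 - u) * x + u * y)"
    and usc: "\<And>x c. \<phi> x < ereal c \<Longrightarrow> \<exists>d>0. \<forall>y. \<bar>y - x\<bar> < d \<longrightarrow> \<phi> y \<le> ereal c"
    and env: "\<And>x. \<phi> x \<le> ereal (a - b * \<bar>x\<bar>)" "b > 0"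
  shows "\<phi> \<in> Phi"
proof -
  have 1: "ereal (1 - u) * \<phi> x + ereal u * \<phi> y \<le> \<phi> ((1 - u) * x + u * y)"
    if u: "0 < u" "u < 1" for x y u
  proof (cases "\<phi> x = -\<infinity> \<or> \<phi> y = -\<infinity>")
    case True
    have "ereal v * e \<noteq> \<infinity>" if "v > 0" "e \<noteq> \<infinity>" for v e
      using that by (cases e) auto
    then have eq: "ereal (1 - u) * \<phi> x + ereal u * \<phi> y = -\<infinity>"
      using True u fin[of x] fin[of y] by (cases "\<phi> x"; cases "\<phi> y") auto
    show ?thesis unfolding eq by simp
  next
    case False
    then obtain s t where st: "\<phi> x = ereal s" "\<phi> y = ereal t"
      using fin[of x] fin[of y] by (metis ereal_cases)
    have "ereal ((1 - u) * s + u * t) \<le> \<phi> ((1 - u) * x + u * y) + ereal e" if "e > 0" for e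
    proof -
      have "ereal ((1 - u) * (s - e) + u * (t - e)) \<le> \<phi> ((1 - u) * x + u * y)"
        using conc[OF u, of "s - e" x "t - e" y] st that by simp
      moreover have "(1 - u) * (s - e) + u * (t - e) = (1 - u) * s + u * t - e"
        by (simp add: algebra_simps)
      ultimately show ?thesis
        by (cases "\<phi> ((1 - u) * x + u * y)") auto
    qed
    then have "ereal ((1 - u) * s + u * t) \<le> \<phi> ((1 - u) * x + u * y)"
      by (metis ereal_le_epsilon2)
    then show ?thesis using st by simp
  qed
  have 2: "Limsup (at x) \<phi> \<le> \<phi> x" for x
  proof (rule ccontr)
    assume "\<not> ?thesis"
    then obtain c where c: "\<phi> x < ereal c" "ereal c < Limsup (at x) \<phi>"
      by (meson ereal_dense2 not_le)
    obtain d where d: "d > 0" "\<And>y. \<bar>y - x\<bar> < d \<Longrightarrow> \<phi> y \<le> ereal c"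
      using usc[OF c(1)] by blast
    have "\<forall>\<^sub>F y in at x. \<phi> y \<le> ereal c"
      unfolding eventually_at using d by (intro exI[of _ d]) (auto simp: dist_real_def)
    then have "Limsup (at x) \<phi> \<le> ereal c" by (rule Limsup_bounded)
    then show False using c(2) by simp
  qed
  have 3: "(\<phi> \<longlongrightarrow> -\<infinity>) at_infinity"
    unfolding tendsto_MInfty
  proof
    fix r :: real
    show "\<forall>\<^sub>F x in at_infinity. \<phi> x < ereal r"
      unfolding eventually_at_infinity
    proof (intro exI allI impI)
      fix x :: real assume "(\<bar>a\<bar> + \<bar>r\<bar> + 1) / b \<le> norm x"
      then have "\<bar>a\<bar> + \<bar>r\<bar> + 1 \<le> b * \<bar>x\<bar>" using env(2) by (simp add: field_simps)
      then have "ereal (a - b * \<bar>x\<bar>) < ereal r" by simp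
      then show "\<phi> x < ereal r" using env(1) le_less_trans by blast
    qed
  qed
  show ?thesis using fin 1 2 3 unfolding Phi_def by blast
qed

lemma Phi_not_infinity: "\<phi> \<in> Phi \<Longrightarrow> \<phi> x \<noteq> \<infinity>"
  by (auto simp: Phi_def)

lemma Phi_concave:
  assumes \<phi>: "\<phi> \<in> Phi" and s: "ereal s \<le> \<phi> x" and t: "ereal t \<le> \<phi> y" and u: "0 \<le> u" "u \<le> 1"
  shows "ereal ((1 - u) * s + u * t) \<le> \<phi> ((1 - u) * x + u * y)"
proof -
  consider "u = 0" | "u = 1" | "0 < u" "u < 1" using u by linarith
  then show ?thesis
  proof cases
    case 3
    have "ereal ((1 - u) * s + u * t) = ereal (1 - u) * ereal s + ereal u * ereal t" by simp
    also have "\<dots> \<le> ereal (1 - u) * \<phi> x + ereal u * \<phi> y"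
      using s t 3 by (intro add_mono ereal_mult_left_mono) auto
    also have "\<dots> \<le> \<phi> ((1 - u) * x + u * y)" using \<phi> 3 by (auto simp: Phi_def)
    finally show ?thesis .
  qed (use s t in auto)
qed

lemma Phi_superlevel_convex:
  assumes \<phi>: "\<phi> \<in> Phi" and "ereal t \<le> \<phi> x" "ereal t \<le> \<phi> y" "x \<le> z" "z \<le> y"
  shows "ereal t \<le> \<phi> z"
proof (cases "x = y")
  case False
  define u where "u = (z - x) / (y - x)"
  have u: "0 \<le> u" "u \<le> 1" using assms False by (auto simp: u_def field_simps)
  have "u * (y - x) = z - x" using False by (simp add: u_def)
  then have z: "(1 - u) * x + u * y = z" by (simp add: algebra_simps)
  have "(1 - u) * t + u * t = t" by (simp add: algebra_simps)
  then show ?thesis using Phi_concave[OF \<phi> assms(2,3) u] z by simp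
qed (use assms in auto)

lemma Phi_usc:
  assumes \<phi>: "\<phi> \<in> Phi" and c: "\<phi> x < ereal c"
  shows "\<exists>d>0. \<forall>y. \<bar>y - x\<bar> < d \<longrightarrow> \<phi> y < ereal c"
proof -
  have "Limsup (at x) \<phi> \<le> \<phi> x" using \<phi> by (auto simp: Phi_def)
  then have "Limsup (at x) \<phi> < ereal c" using c by simp
  then have "\<forall>\<^sub>F y in at x. \<phi> y < ereal c" by (rule Limsup_lessD)
  then obtain d where "d > 0" "\<And>y. y \<noteq> x \<Longrightarrow> dist y x < d \<Longrightarrow> \<phi> y < ereal c"
    unfolding eventually_at by auto
  then show ?thesis using c by (metis dist_real_def)
qed

lemma Phi_bounded_on_interval:
  assumes \<phi>: "\<phi> \<in> Phi"
  shows "\<exists>A. \<forall>x\<in>{c..d}. \<phi> x \<le> ereal A"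
proof -
  have "\<exists>A r. r > 0 \<and> (\<forall>y. \<bar>y - x\<bar> < r \<longrightarrow> \<phi> y < ereal A)" for x
  proof -
    obtain A where "\<phi> x < ereal A"
      using Phi_not_infinity[OF \<phi>, of x] by (metis ereal_dense2 ereal_infty_less(1))
    then show ?thesis using Phi_usc[OF \<phi>] by blast
  qed
  then obtain A r where r: "\<And>x. r x > 0" and A: "\<And>x y. \<bar>y - x\<bar> < r x \<Longrightarrow> \<phi> y < ereal (A x)"
    by metis
  have "\<exists>C'\<subseteq>{c..d}. finite C' \<and> {c..d} \<subseteq> (\<Union>x\<in>C'. ball x (r x))"
    by (rule compactE_image[of "{c..d}" "{c..d}" "\<lambda>x. ball x (r x)"]) (use r in auto)
  then obtain C where C: "finite C" "{c..d} \<subseteq> (\<Union>x\<in>C. ball x (r x))" by blast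
  have "\<phi> y \<le> ereal (Max (insert 0 (A ` C)))" if y: "y \<in> {c..d}" for y
  proof -
    obtain x where "x \<in> C" "y \<in> ball x (r x)" using subsetD[OF C(2) y] by blast
    then have x: "x \<in> C" "\<bar>y - x\<bar> < r x" by (auto simp: dist_real_def)
    have "\<phi> y \<le> ereal (A x)" using A[OF x(2)] by simp
    also have "\<dots> \<le> ereal (Max (insert 0 (A ` C)))" using C x by auto
    finally show ?thesis .
  qed
  then show ?thesis by blast
qed

text \<open>By concavity a drop of one at distance \<open>w\<close> from \<open>x0\<close> continues with slope at least \<open>1/w\<close>.\<close>

lemma Phi_linear_decay:
  assumes \<phi>: "\<phi> \<in> Phi" and m: "ereal m \<le> \<phi> x0" and w: "w > 0"
    and drop: "\<And>z. \<bar>z - x0\<bar> = w \<Longrightarrow> \<phi> z \<le> ereal (m - 1)"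
    and x: "\<bar>x - x0\<bar> \<ge> w"
  shows "\<phi> x \<le> ereal (m - \<bar>x - x0\<bar> / w)"
proof (rule ccontr)
  assume "\<not> ?thesis"
  then obtain v where v: "ereal (m - \<bar>x - x0\<bar> / w) < ereal v" "ereal v < \<phi> x"
    by (meson ereal_dense2 not_le)
  define u where "u = w / \<bar>x - x0\<bar>"
  have pos: "\<bar>x - x0\<bar> > 0" using x w by linarith
  have u: "0 < u" "u \<le> 1" using x w pos by (auto simp: u_def)
  have "(1 - u) * x0 + u * x - x0 = u * (x - x0)" by (simp add: algebra_simps)
  then have "\<bar>(1 - u) * x0 + u * x - x0\<bar> = w"
    using u pos w by (simp add: abs_mult) (simp add: u_def)
  then have 1: "\<phi> ((1 - u) * x0 + u * x) \<le> ereal (m - 1)" by (rule drop)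
  have "ereal ((1 - u) * m + u * v) \<le> \<phi> ((1 - u) * x0 + u * x)"
    using Phi_concave[OF \<phi> m, of v x u] v u by simp
  with 1 have "(1 - u) * m + u * v \<le> m - 1" by (metis ereal_less_eq(3) order_trans)
  then have "u * (v - m) \<le> - 1" by (simp add: algebra_simps)
  moreover have "u * (v - m) > u * (- \<bar>x - x0\<bar> / w)"
    using v(1) u by (intro mult_strict_left_mono) auto
  moreover have "u * (- \<bar>x - x0\<bar> / w) = -1" using pos w by (simp add: u_def)
  ultimately show False by simp
qed

text \<open>Far out on either side the values lie one below some finite value, and concavity extends this drop
  linearly.\<close>

lemma Phi_envelope:
  assumes \<phi>: "\<phi> \<in> Phi"
  shows "\<exists>a b. b > 0 \<and> (\<forall>x. \<phi> x \<le> ereal (a - b * \<bar>x\<bar>))"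
proof (cases "\<forall>x. \<phi> x = -\<infinity>")
  case True
  then show ?thesis by (intro exI[of _ 0] exI[of _ 1]) auto
next
  case False
  then obtain x0 m where m: "\<phi> x0 = ereal m" using Phi_not_infinity[OF \<phi>] by (metis ereal_cases)
  have "(\<phi> \<longlongrightarrow> -\<infinity>) at_infinity" using \<phi> by (auto simp: Phi_def)
  then have "\<forall>\<^sub>F x in at_infinity. \<phi> x < ereal (m - 1)" unfolding tendsto_MInfty by blast
  then obtain T0 where T0: "\<And>x. \<bar>x\<bar> \<ge> T0 \<Longrightarrow> \<phi> x < ereal (m - 1)"
    unfolding eventually_at_infinity by auto
  define w where "w = \<bar>T0\<bar> + \<bar>x0\<bar> + 1"
  have w: "w > 0" by (simp add: w_def)
  have drop: "\<phi> z \<le> ereal (m - 1)" if "\<bar>z - x0\<bar> = w" for z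
  proof -
    have "\<bar>z\<bar> \<ge> T0" using that by (simp add: w_def)
    then show ?thesis using T0[of z] by simp
  qed
  obtain A where A: "\<And>x. x \<in> {x0 - w..x0 + w} \<Longrightarrow> \<phi> x \<le> ereal A"
    using Phi_bounded_on_interval[OF \<phi>] by blast
  define a where "a = max A m + 1 + \<bar>x0\<bar> / w"
  have "\<phi> x \<le> ereal (a - (1 / w) * \<bar>x\<bar>)" for x
  proof (cases "\<bar>x - x0\<bar> \<ge> w")
    case True
    have "\<phi> x \<le> ereal (m - \<bar>x - x0\<bar> / w)"
      by (rule Phi_linear_decay[OF \<phi> _ w drop True]) (use m in auto)
    also have "m - \<bar>x - x0\<bar> / w \<le> m - (\<bar>x\<bar> - \<bar>x0\<bar>) / w"
      using w by (intro diff_left_mono divide_right_mono) auto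
    also have "\<dots> \<le> a - (1 / w) * \<bar>x\<bar>" by (simp add: a_def diff_divide_distrib)
    finally show ?thesis by simp
  next
    case False
    then have "\<phi> x \<le> ereal A" by (intro A) auto
    also have "\<bar>x\<bar> \<le> w + \<bar>x0\<bar>" using False by linarith
    then have "\<bar>x\<bar> / w \<le> 1 + \<bar>x0\<bar> / w" using w by (simp add: field_simps)
    then have "A \<le> a - (1 / w) * \<bar>x\<bar>" by (simp add: a_def)
    finally show ?thesis by simp
  qed
  then show ?thesis using w by (intro exI[of _ a] exI[of _ "1 / w"]) auto
qed

lemma Phi_measurable:
  assumes \<phi>: "\<phi> \<in> Phi"
  shows "\<phi> \<in> borel_measurable borel"
proof (rule borel_measurableI_ge)
  fix e :: ereal
  have "closed {x. e \<le> \<phi> x}"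
  proof (cases e)
    case (real c)
    have "open {x. \<phi> x < ereal c}"
      unfolding open_dist using Phi_usc[OF \<phi>] by (auto simp: dist_real_def)
    moreover have "{x. e \<le> \<phi> x} = - {x. \<phi> x < ereal c}" using real by auto
    ultimately show ?thesis by (simp add: open_closed)
  next
    case PInf
    then have "{x. e \<le> \<phi> x} = {}" using Phi_not_infinity[OF \<phi>] by auto
    then show ?thesis by simp
  next
    case MInf
    then have "{x. e \<le> \<phi> x} = UNIV" by auto
    then show ?thesis by simp
  qed
  then show "{x \<in> space borel. e \<le> \<phi> x} \<in> sets borel" by simp
qed

lemma exp_of_measurable:
  assumes \<phi>: "\<phi> \<in> Phi" shows "exp_of \<phi> \<in> borel_measurable borel"
proof -
  note [measurable] = Phi_measurable[OF \<phi>]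
  show ?thesis unfolding exp_of_def[abs_def] by measurable
qed

lemma exp_of_nonneg [simp]: "0 \<le> exp_of \<phi> x"
  by (simp add: exp_of_def)

lemma exp_of_le: "\<phi> x \<le> ereal c \<Longrightarrow> exp_of \<phi> x \<le> exp c"
  by (cases "\<phi> x") (auto simp: exp_of_def)

lemma exp_of_ge: "ereal c \<le> \<phi> x \<Longrightarrow> \<phi> x \<noteq> \<infinity> \<Longrightarrow> exp c \<le> exp_of \<phi> x"
  by (cases "\<phi> x") (auto simp: exp_of_def)

text \<open>Comparison with real thresholds expresses convergence in \<open>[-\<infinity>, \<infinity>)\<close> and treats the value \<open>-\<infinity>\<close>,
  where the density vanishes, like any other.\<close>

lemma exp_of_tendsto:
  assumes up: "\<And>c. \<phi> x < ereal c \<Longrightarrow> \<forall>\<^sub>F k in sequentially. \<phi>s k x \<le> ereal c"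
    and low: "\<And>c. ereal c < \<phi> x \<Longrightarrow> \<forall>\<^sub>F k in sequentially. ereal c \<le> \<phi>s k x"
    and fin: "\<phi> x \<noteq> \<infinity>" "\<And>k. \<phi>s k x \<noteq> \<infinity>"
  shows "(\<lambda>k. exp_of (\<phi>s k) x) \<longlonglongrightarrow> exp_of \<phi> x"
proof (rule order_tendstoI)
  fix e assume e: "e < exp_of \<phi> x"
  show "\<forall>\<^sub>F k in sequentially. e < exp_of (\<phi>s k) x"
  proof (cases "e < 0")
    case True
    then show ?thesis by (intro always_eventually allI) (meson exp_of_nonneg less_le_trans)
  next
    case False
    then obtain v where v: "\<phi> x = ereal v" "e < exp v"
      using e fin(1) by (cases "\<phi> x") (auto simp: exp_of_def split: if_splits)
    obtain e' where e': "e < e'" "e' < exp v" using v dense by blast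
    then have e'': "e' > 0" using False by linarith
    have "ln e' < v" using e' e'' by (metis exp_less_cancel_iff exp_ln)
    then have "\<forall>\<^sub>F k in sequentially. ereal (ln e') \<le> \<phi>s k x" using v by (intro low) auto
    then show ?thesis
    proof eventually_elim
      case (elim k)
      have "e' \<le> exp_of (\<phi>s k) x" using exp_of_ge[of "ln e'" "\<phi>s k" x, OF elim fin(2)] e'' by simp
      then show ?case using e'(1) by linarith
    qed
  qed
next
  fix e assume e: "exp_of \<phi> x < e"
  then have "e > 0" by (meson exp_of_nonneg le_less_trans)
  obtain e' where e': "exp_of \<phi> x < e'" "e' < e" using e dense by blast
  then have e'': "e' > 0" by (meson exp_of_nonneg le_less_trans)
  have "\<phi> x < ereal (ln e')"
  proof (cases "\<phi> x")
    case (real v)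
    then have "exp v < e'" using e' by (simp add: exp_of_def)
    then show ?thesis using real e'' by (metis exp_less_cancel_iff exp_ln less_ereal.simps(1))
  qed (use fin in auto)
  then have "\<forall>\<^sub>F k in sequentially. \<phi>s k x \<le> ereal (ln e')" by (rule up)
  then show "\<forall>\<^sub>F k in sequentially. exp_of (\<phi>s k) x < e"
  proof eventually_elim
    case (elim k)
    have "exp_of (\<phi>s k) x \<le> e'" using exp_of_le[of "\<phi>s k" x "ln e'"] elim e'' by simp
    then show ?case using e'(2) by linarith
  qed
qed

section \<open>Exponential tails\<close>

lemma integrable_exp_abs:
  assumes b: "b > 0"
  shows "integrable lborel (\<lambda>x::real. exp (- (b * \<bar>x\<bar>)))"
proof -
  have 1: "integrable lborel (\<lambda>x::real. exp (- x) * indicator {0..} x)"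
  proof (rule integrableI_bounded)
    have "(\<integral>\<^sup>+x. norm (exp (- x) * indicator {0..} x :: real) \<partial>lborel)
        = (\<integral>\<^sup>+x. ennreal (x ^ 0 * exp (- x)) * indicator {0..} x \<partial>lborel)"
      by (intro nn_integral_cong) (auto simp: indicator_def)
    also have "\<dots> = ennreal (real (fact 0))" by (rule nn_intergal_power_times_exp_Ici)
    finally show "(\<integral>\<^sup>+x. norm (exp (- x) * indicator {0..} x :: real) \<partial>lborel) < \<infinity>" by simp
  qed simp
  have 2: "integrable lborel (\<lambda>x::real. exp (- (b * x)) * indicator {0..} (b * x))"
    using lborel_integrable_real_affine[OF 1, of b 0] b by simp
  have 3: "integrable lborel (\<lambda>x::real. exp (b * x) * indicator {0..} (- b * x))"
    using lborel_integrable_real_affine[OF 1, of "-b" 0] b by simp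
  show ?thesis
  proof (rule Bochner_Integration.integrable_bound[OF Bochner_Integration.integrable_add[OF 2 3]])
    show "AE x::real in lborel. norm (exp (- (b * \<bar>x\<bar>))) \<le>
        norm (exp (- (b * x)) * indicator {0..} (b * x) + exp (b * x) * indicator {0..} (- b * x))"
      using b by (intro AE_I2) (auto simp: indicator_def abs_if mult_less_0_iff zero_le_mult_iff not_le mult_le_0_iff)
  qed simp
qed

lemma integrable_abs_exp_abs:
  assumes b: "b > 0"
  shows "integrable lborel (\<lambda>x::real. \<bar>x\<bar> * exp (- (b * \<bar>x\<bar>)))"
proof -
  have i: "integrable lborel (\<lambda>x::real. (2 / b) * exp (- ((b / 2) * \<bar>x\<bar>)))"
    using integrable_exp_abs[of "b / 2"] b by auto
  show ?thesis
  proof (rule Bochner_Integration.integrable_bound[OF i])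
    have "\<bar>x\<bar> * exp (- (b * \<bar>x\<bar>)) \<le> (2 / b) * exp (- ((b / 2) * \<bar>x\<bar>))" for x :: real
    proof -
      have "(b / 2) * \<bar>x\<bar> \<le> exp ((b / 2) * \<bar>x\<bar>)" using exp_ge_add_one_self[of "(b / 2) * \<bar>x\<bar>"] by linarith
      then have "\<bar>x\<bar> \<le> (2 / b) * exp ((b / 2) * \<bar>x\<bar>)" using b by (simp add: field_simps)
      then have "\<bar>x\<bar> * exp (- (b * \<bar>x\<bar>)) \<le> (2 / b) * exp ((b / 2) * \<bar>x\<bar>) * exp (- (b * \<bar>x\<bar>))"
        by (intro mult_right_mono) auto
      also have "\<dots> = (2 / b) * exp ((b / 2) * \<bar>x\<bar> + - (b * \<bar>x\<bar>))" by (subst exp_add) (simp add: mult_ac)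
      also have "(b / 2) * \<bar>x\<bar> + - (b * \<bar>x\<bar>) = - ((b / 2) * \<bar>x\<bar>)" by simp
      finally show ?thesis .
    qed
    then show "AE x::real in lborel. norm (\<bar>x\<bar> * exp (- (b * \<bar>x\<bar>)))
        \<le> norm ((2 / b) * exp (- ((b / 2) * \<bar>x\<bar>)))"
      using b by (intro AE_I2) (auto simp: abs_mult)
  qed simp
qed

lemma exp_of_integrable:
  assumes \<phi>: "\<phi> \<in> Phi"
  shows "integrable lborel (exp_of \<phi>)" "integrable lborel (\<lambda>x. x * exp_of \<phi> x)"
proof -
  note [measurable] = exp_of_measurable[OF \<phi>]
  obtain a b where b: "b > 0" and env: "\<And>x. \<phi> x \<le> ereal (a - b * \<bar>x\<bar>)"
    using Phi_envelope[OF \<phi>] by blast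
  have le: "exp_of \<phi> x \<le> exp a * exp (- (b * \<bar>x\<bar>))" for x
    using exp_of_le[of \<phi> x "a - b * \<bar>x\<bar>"] env[of x] by (simp add: exp_diff exp_minus field_simps)
  have i1: "integrable lborel (\<lambda>x. exp a * exp (- (b * \<bar>x\<bar>)))"
    using integrable_exp_abs[OF b] by simp
  have i2: "integrable lborel (\<lambda>x. exp a * (\<bar>x\<bar> * exp (- (b * \<bar>x\<bar>))))"
    using integrable_abs_exp_abs[OF b] by simp
  show "integrable lborel (exp_of \<phi>)"
    by (rule Bochner_Integration.integrable_bound[OF i1]) (use le in auto)
  show "integrable lborel (\<lambda>x. x * exp_of \<phi> x)"
  proof (rule Bochner_Integration.integrable_bound[OF i2])
    have "\<bar>x\<bar> * exp_of \<phi> x \<le> exp a * (\<bar>x\<bar> * exp (- (b * \<bar>x\<bar>)))" for x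
      using mult_left_mono[OF le[of x], of "\<bar>x\<bar>"] by (simp add: mult_ac)
    then show "AE x in lborel. norm (x * exp_of \<phi> x) \<le> norm (exp a * (\<bar>x\<bar> * exp (- (b * \<bar>x\<bar>))))"
      by (auto simp: abs_mult)
  qed measurable
qed

section \<open>Likelihood and total mass\<close>

definition mass :: "(real \<Rightarrow> ereal) \<Rightarrow> real" where
  "mass \<phi> = (\<integral>x. exp_of \<phi> x \<partial>lborel)"

definition loglik :: "(real \<Rightarrow> ereal) \<Rightarrow> real measure \<Rightarrow> real" where
  "loglik \<phi> Q = (\<integral>x. real_of_ereal (\<phi> x) \<partial>Q)"

definition log_integrable :: "(real \<Rightarrow> ereal) \<Rightarrow> real measure \<Rightarrow> bool" where
  "log_integrable \<phi> Q \<longleftrightarrow> (AE x in Q. \<phi> x \<noteq> -\<infinity>) \<and> integrable Q (\<lambda>x. real_of_ereal (\<phi> x))"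

lemma nn_integral_exp_of:
  "\<phi> \<in> Phi \<Longrightarrow> (\<integral>\<^sup>+x. ennreal (exp_of \<phi> x) \<partial>lborel) = ennreal (mass \<phi>)"
  unfolding mass_def using exp_of_integrable(1) by (intro nn_integral_eq_integral) auto

lemma mass_nonneg: "0 \<le> mass \<phi>"
  unfolding mass_def by (rule integral_nonneg_AE) auto

lemma mass_eq_1_iff: "\<phi> \<in> Phi \<Longrightarrow> (\<integral>\<^sup>+x. ennreal (exp_of \<phi> x) \<partial>lborel) = 1 \<longleftrightarrow> mass \<phi> = 1"
  unfolding nn_integral_exp_of using mass_nonneg[of \<phi>] by (simp add: ennreal_eq_1)

text \<open>The positive part of a log-density is bounded, so integrability can only fail by an integral equal
  to \<open>-\<infinity>\<close>.\<close>

lemma L_log_integrable: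
  assumes \<phi>: "\<phi> \<in> Phi" and Q: "real_distribution Q" and fin: "log_integrable \<phi> Q"
  shows "L \<phi> Q = ereal (loglik \<phi> Q - mass \<phi> + 1)"
proof -
  interpret real_distribution Q by fact
  note [measurable] = Phi_measurable[OF \<phi>]
  define p where "p x = real_of_ereal (\<phi> x)" for x
  have ae: "AE x in Q. \<phi> x = ereal (p x)" and int: "integrable Q p"
  proof -
    have "AE x in Q. \<phi> x \<noteq> -\<infinity>" using fin by (simp add: log_integrable_def)
    then show "AE x in Q. \<phi> x = ereal (p x)"
    proof eventually_elim
      case (elim x)
      then show ?case using Phi_not_infinity[OF \<phi>, of x] by (cases "\<phi> x") (auto simp: p_def)
    qed
    show "integrable Q p" using fin by (simp add: log_integrable_def p_def[abs_def])
  qed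
  have P: "(\<integral>\<^sup>+x. e2ennreal (\<phi> x) \<partial>Q) = (\<integral>\<^sup>+x. ennreal (p x) \<partial>Q)"
    by (rule nn_integral_cong_AE, use ae in eventually_elim) simp
  have N: "(\<integral>\<^sup>+x. e2ennreal (- \<phi> x) \<partial>Q) = (\<integral>\<^sup>+x. ennreal (- p x) \<partial>Q)"
    by (rule nn_integral_cong_AE, use ae in eventually_elim) simp
  have fP: "(\<integral>\<^sup>+x. ennreal (p x) \<partial>Q) < \<infinity>" and fN: "(\<integral>\<^sup>+x. ennreal (- p x) \<partial>Q) < \<infinity>"
  proof -
    have "(\<integral>\<^sup>+x. ennreal (norm (p x)) \<partial>Q) < \<infinity>" using int by (simp add: integrable_iff_bounded)
    moreover have "(\<integral>\<^sup>+x. ennreal (p x) \<partial>Q) \<le> (\<integral>\<^sup>+x. ennreal (norm (p x)) \<partial>Q)"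
      "(\<integral>\<^sup>+x. ennreal (- p x) \<partial>Q) \<le> (\<integral>\<^sup>+x. ennreal (norm (p x)) \<partial>Q)"
      by (auto intro!: nn_integral_mono ennreal_leI)
    ultimately show "(\<integral>\<^sup>+x. ennreal (p x) \<partial>Q) < \<infinity>" "(\<integral>\<^sup>+x. ennreal (- p x) \<partial>Q) < \<infinity>"
      by (auto dest: le_less_trans)
  qed
  have "loglik \<phi> Q = enn2real (\<integral>\<^sup>+x. ennreal (p x) \<partial>Q) - enn2real (\<integral>\<^sup>+x. ennreal (- p x) \<partial>Q)"
    unfolding loglik_def using real_lebesgue_integral_def[OF int] by (simp add: p_def[abs_def])
  moreover have "enn2ereal z = ereal (enn2real z)" if "z < \<infinity>" for z
    using that by (cases z) auto
  ultimately have "ext_integral Q \<phi> = ereal (loglik \<phi> Q)"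
    unfolding ext_integral_def P N using fP fN by simp
  then show ?thesis
    unfolding L_def nn_integral_exp_of[OF \<phi>]
    by (metis enn2ereal_ennreal mass_nonneg ereal_minus(1) one_ereal_def plus_ereal.simps(1))
qed

lemma L_not_log_integrable:
  assumes \<phi>: "\<phi> \<in> Phi" and Q: "real_distribution Q" and fin: "\<not> log_integrable \<phi> Q"
  shows "L \<phi> Q = -\<infinity>"
proof -
  interpret real_distribution Q by fact
  note [measurable] = Phi_measurable[OF \<phi>]
  obtain a b where b: "b > 0" and env: "\<And>x. \<phi> x \<le> ereal (a - b * \<bar>x\<bar>)"
    using Phi_envelope[OF \<phi>] by blast
  have le: "\<phi> x \<le> ereal \<bar>a\<bar>" for x
  proof -
    have "b * \<bar>x\<bar> \<ge> 0" using b by simp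
    then have "a - b * \<bar>x\<bar> \<le> \<bar>a\<bar>" by linarith
    then show ?thesis using env[of x] by (meson ereal_less_eq(3) order_trans)
  qed
  have fP: "(\<integral>\<^sup>+x. e2ennreal (\<phi> x) \<partial>Q) < \<infinity>"
  proof -
    have "(\<integral>\<^sup>+x. e2ennreal (\<phi> x) \<partial>Q) \<le> (\<integral>\<^sup>+x. ennreal \<bar>a\<bar> \<partial>Q)"
    proof (rule nn_integral_mono)
      fix x
      have "e2ennreal (\<phi> x) \<le> e2ennreal (ereal \<bar>a\<bar>)" by (rule e2ennreal_mono[OF le])
      then show "e2ennreal (\<phi> x) \<le> ennreal \<bar>a\<bar>" by (simp only: e2ennreal_ereal)
    qed
    also have "\<dots> < \<infinity>" using emeasure_space_1 by (simp add: ennreal_mult_less_top)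
    finally show ?thesis .
  qed
  have "(\<integral>\<^sup>+x. e2ennreal (- \<phi> x) \<partial>Q) = \<infinity>"
  proof (rule ccontr)
    assume N: "(\<integral>\<^sup>+x. e2ennreal (- \<phi> x) \<partial>Q) \<noteq> \<infinity>"
    then have "AE x in Q. e2ennreal (- \<phi> x) \<noteq> \<infinity>"
      by (intro nn_integral_PInf_AE) auto
    then have ae: "AE x in Q. \<phi> x \<noteq> -\<infinity>"
    proof eventually_elim
      case (elim x)
      then show ?case by (auto simp: e2ennreal_infty)
    qed
    have "integrable Q (\<lambda>x. real_of_ereal (\<phi> x))"
    proof (rule integrableI_bounded)
      have "(\<integral>\<^sup>+x. ennreal (norm (real_of_ereal (\<phi> x))) \<partial>Q)
          = (\<integral>\<^sup>+x. e2ennreal (\<phi> x) + e2ennreal (- \<phi> x) \<partial>Q)"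
      proof (rule nn_integral_cong_AE, use ae in eventually_elim)
        case (elim x)
        then obtain v where "\<phi> x = ereal v" using Phi_not_infinity[OF \<phi>, of x] by (metis ereal_cases)
        then show ?case
          by (cases "v \<ge> 0") (auto simp: ennreal_neg)
      qed
      also have "\<dots> < \<infinity>" using fP N by (subst nn_integral_add) (auto simp: top.not_eq_extremum)
      finally show "(\<integral>\<^sup>+x. ennreal (norm (real_of_ereal (\<phi> x))) \<partial>Q) < \<infinity>" .
    qed measurable
    with ae fin show False by (simp add: log_integrable_def)
  qed
  then have "ext_integral Q \<phi> = -\<infinity>"
    unfolding ext_integral_def using fP by (cases "\<integral>\<^sup>+x. e2ennreal (\<phi> x) \<partial>Q") (auto simp: enn2ereal_ennreal)
  then show ?thesis unfolding L_def nn_integral_exp_of[OF \<phi>] by (simp add: enn2ereal_ennreal mass_nonneg)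
qed

section \<open>Operations on log-densities\<close>

lemma ereal_less_add_real: "ereal s < e + ereal r \<longleftrightarrow> ereal (s - r) < e"
  by (cases e) (auto simp: algebra_simps)

lemma ereal_le_add_real: "ereal s \<le> e + ereal r \<longleftrightarrow> ereal (s - r) \<le> e"
  by (cases e) (auto simp: algebra_simps)

lemma add_real_less_ereal: "e + ereal r < ereal s \<longleftrightarrow> e < ereal (s - r)"
  by (cases e) (auto simp: algebra_simps)

lemma add_real_le_ereal: "e + ereal r \<le> ereal s \<longleftrightarrow> e \<le> ereal (s - r)"
  by (cases e) (auto simp: algebra_simps)

lemma Phi_shift:
  assumes \<phi>: "\<phi> \<in> Phi" shows "(\<lambda>x. \<phi> (x + c)) \<in> Phi"
proof -
  obtain a b where b: "b > 0" and env: "\<And>x. \<phi> x \<le> ereal (a - b * \<bar>x\<bar>)"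
    using Phi_envelope[OF \<phi>] by blast
  show ?thesis
  proof (rule PhiI[where a = "a + b * \<bar>c\<bar>" and b = b])
    show "\<phi> (x + c) \<noteq> \<infinity>" for x by (rule Phi_not_infinity[OF \<phi>])
    show "ereal ((1 - u) * s + u * t) \<le> \<phi> ((1 - u) * x + u * y + c)"
      if "0 < u" "u < 1" "ereal s < \<phi> (x + c)" "ereal t < \<phi> (y + c)" for x y s t u
    proof -
      have "(1 - u) * (x + c) + u * (y + c) = (1 - u) * x + u * y + c" by (simp add: algebra_simps)
      then show ?thesis using Phi_concave[OF \<phi>, of s "x + c" t "y + c" u] that by simp
    qed
    show "\<exists>d>0. \<forall>y. \<bar>y - x\<bar> < d \<longrightarrow> \<phi> (y + c) \<le> ereal k" if k: "\<phi> (x + c) < ereal k" for x k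
    proof -
      obtain d where d: "d > 0" "\<And>y. \<bar>y - (x + c)\<bar> < d \<Longrightarrow> \<phi> y < ereal k"
        using Phi_usc[OF \<phi> k] by blast
      have "\<phi> (y + c) \<le> ereal k" if "\<bar>y - x\<bar> < d" for y
        using d(2)[of "y + c"] that by (simp add: less_imp_le)
      then show ?thesis using d(1) by blast
    qed
    show "\<phi> (x + c) \<le> ereal (a + b * \<bar>c\<bar> - b * \<bar>x\<bar>)" for x
    proof -
      have "b * \<bar>x\<bar> \<le> b * (\<bar>x + c\<bar> + \<bar>c\<bar>)" using b by (intro mult_left_mono) auto
      then have "a - b * \<bar>x + c\<bar> \<le> a + b * \<bar>c\<bar> - b * \<bar>x\<bar>" by (simp add: algebra_simps)
      then show ?thesis using env[of "x + c"] by (meson ereal_less_eq(3) order_trans)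
    qed
    show "b > 0" by fact
  qed
qed

lemma exp_of_shift: "exp_of (\<lambda>x. \<phi> (x + c)) x = exp_of \<phi> (x + c)"
  by (simp add: exp_of_def)

lemma mass_shift: "mass (\<lambda>x. \<phi> (x + c)) = mass \<phi>"
  unfolding mass_def exp_of_shift
  using lborel_integral_real_affine[of 1 "exp_of \<phi>" c] by (simp add: add.commute)

lemma mean_shift:
  assumes \<phi>: "\<phi> \<in> Phi"
  shows "(\<integral>x. x * exp_of (\<lambda>x. \<phi> (x + c)) x \<partial>lborel) = (\<integral>x. x * exp_of \<phi> x \<partial>lborel) - c * mass \<phi>"
proof -
  have "(\<integral>x. x * exp_of \<phi> x \<partial>lborel) = (\<integral>x. (x + c) * exp_of \<phi> (x + c) \<partial>lborel)"
    using lborel_integral_real_affine[of 1 "\<lambda>x. x * exp_of \<phi> x" c] by (simp add: add.commute)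
  also have "\<dots> = (\<integral>x. x * exp_of (\<lambda>x. \<phi> (x + c)) x + c * exp_of (\<lambda>x. \<phi> (x + c)) x \<partial>lborel)"
    by (simp add: exp_of_shift algebra_simps)
  also have "\<dots> = (\<integral>x. x * exp_of (\<lambda>x. \<phi> (x + c)) x \<partial>lborel) + c * mass (\<lambda>x. \<phi> (x + c))"
    unfolding mass_def using exp_of_integrable[OF Phi_shift[OF \<phi>]]
    by (subst Bochner_Integration.integral_add) auto
  finally show ?thesis by (simp add: mass_shift)
qed

text \<open>Constants \<open>c\<close> serve to normalise; slopes \<open>t\<close> give the derivative of the likelihood in the direction
  \<open>x\<close>. Slopes below the decay rate \<open>b\<close> leave some decay.\<close>

lemma Phi_tilt:
  assumes \<phi>: "\<phi> \<in> Phi" and env: "\<And>x. \<phi> x \<le> ereal (a - b * \<bar>x\<bar>)" and t: "\<bar>t\<bar> < b"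
  shows "(\<lambda>x. \<phi> x + ereal (c + t * x)) \<in> Phi"
proof (rule PhiI[where a = "a + c" and b = "b - \<bar>t\<bar>"])
  show "\<phi> x + ereal (c + t * x) \<noteq> \<infinity>" for x using Phi_not_infinity[OF \<phi>, of x] by (cases "\<phi> x") auto
  show "ereal ((1 - u) * s + u * r) \<le> \<phi> ((1 - u) * x + u * y) + ereal (c + t * ((1 - u) * x + u * y))"
    if "0 < u" "u < 1" "ereal s < \<phi> x + ereal (c + t * x)" "ereal r < \<phi> y + ereal (c + t * y)" for x y s r u
  proof -
    have "ereal ((1 - u) * (s - (c + t * x)) + u * (r - (c + t * y))) \<le> \<phi> ((1 - u) * x + u * y)"
      using that by (intro Phi_concave[OF \<phi>]) (auto simp: ereal_less_add_real less_imp_le)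
    also have "(1 - u) * (s - (c + t * x)) + u * (r - (c + t * y))
      = (1 - u) * s + u * r - (c + t * ((1 - u) * x + u * y))" by (simp add: algebra_simps)
    finally show ?thesis by (simp add: ereal_le_add_real)
  qed
  show "\<exists>d>0. \<forall>y. \<bar>y - x\<bar> < d \<longrightarrow> \<phi> y + ereal (c + t * y) \<le> ereal k"
    if k: "\<phi> x + ereal (c + t * x) < ereal k" for x k
  proof -
    have "\<phi> x < ereal (k - (c + t * x))" using k by (simp add: add_real_less_ereal)
    then obtain k' where k': "\<phi> x < ereal k'" "k' < k - (c + t * x)"
      by (metis ereal_dense2 less_ereal.simps(1))
    obtain d where d: "d > 0" "\<And>y. \<bar>y - x\<bar> < d \<Longrightarrow> \<phi> y < ereal k'"
      using Phi_usc[OF \<phi> k'(1)] by blast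
    define d' where "d' = min d ((k - (c + t * x) - k') / (\<bar>t\<bar> + 1))"
    have "\<phi> y + ereal (c + t * y) \<le> ereal k" if y: "\<bar>y - x\<bar> < d'" for y
    proof -
      have "\<bar>y - x\<bar> * (\<bar>t\<bar> + 1) \<le> k - (c + t * x) - k'"
        using y by (simp add: d'_def field_simps)
      moreover have "t * (y - x) \<le> \<bar>y - x\<bar> * (\<bar>t\<bar> + 1)"
      proof -
        have "t * (y - x) \<le> \<bar>t\<bar> * \<bar>y - x\<bar>" by (metis abs_ge_self abs_mult)
        also have "\<dots> \<le> \<bar>y - x\<bar> * (\<bar>t\<bar> + 1)" by (simp add: algebra_simps)
        finally show ?thesis .
      qed
      ultimately have "k' \<le> k - (c + t * y)" by (simp add: algebra_simps)
      moreover have "\<phi> y < ereal k'" using y d by (simp add: d'_def)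
      ultimately show ?thesis unfolding add_real_le_ereal by (meson ereal_less_eq(3) less_imp_le order_trans)
    qed
    moreover have "d' > 0" using d k' by (simp add: d'_def)
    ultimately show ?thesis by blast
  qed
  show "\<phi> x + ereal (c + t * x) \<le> ereal (a + c - (b - \<bar>t\<bar>) * \<bar>x\<bar>)" for x
  proof -
    have "t * x \<le> \<bar>t\<bar> * \<bar>x\<bar>" by (metis abs_ge_self abs_mult)
    then have "a - b * \<bar>x\<bar> \<le> a + c - (b - \<bar>t\<bar>) * \<bar>x\<bar> - (c + t * x)" by (simp add: algebra_simps)
    then show ?thesis unfolding add_real_le_ereal using env[of x] by (meson ereal_less_eq(3) order_trans)
  qed
  show "b - \<bar>t\<bar> > 0" using t by simp
qed

lemma exp_of_tilt:
  "\<phi> x \<noteq> \<infinity> \<Longrightarrow> exp_of (\<lambda>x. \<phi> x + ereal (g x)) x = exp_of \<phi> x * exp (g x)"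
  by (cases "\<phi> x") (auto simp: exp_of_def exp_add)

lemma log_integrable_tilt:
  assumes \<phi>: "\<phi> \<in> Phi" and Q: "real_distribution Q" and fin: "log_integrable \<phi> Q" and g: "integrable Q g"
  shows "log_integrable (\<lambda>x. \<phi> x + ereal (g x)) Q"
    and "loglik (\<lambda>x. \<phi> x + ereal (g x)) Q = loglik \<phi> Q + (\<integral>x. g x \<partial>Q)"
proof -
  interpret real_distribution Q by fact
  note [measurable] = Phi_measurable[OF \<phi>] borel_measurable_integrable[OF g]
  have ae: "AE x in Q. \<phi> x \<noteq> -\<infinity>" and int: "integrable Q (\<lambda>x. real_of_ereal (\<phi> x))"
    using fin by (auto simp: log_integrable_def)
  have eq: "\<phi> x \<noteq> -\<infinity> \<Longrightarrow> real_of_ereal (\<phi> x + ereal (g x)) = real_of_ereal (\<phi> x) + g x"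
    "\<phi> x \<noteq> -\<infinity> \<Longrightarrow> \<phi> x + ereal (g x) \<noteq> -\<infinity>" for x
    using Phi_not_infinity[OF \<phi>, of x] by (cases "\<phi> x"; simp)+
  have ae': "AE x in Q. real_of_ereal (\<phi> x) + g x = real_of_ereal (\<phi> x + ereal (g x))"
    using ae by eventually_elim (simp add: eq)
  have int': "integrable Q (\<lambda>x. real_of_ereal (\<phi> x) + g x)" using int g by simp
  show "log_integrable (\<lambda>x. \<phi> x + ereal (g x)) Q"
    unfolding log_integrable_def
  proof
    show "AE x in Q. \<phi> x + ereal (g x) \<noteq> - \<infinity>" using ae by eventually_elim (rule eq)
    show "integrable Q (\<lambda>x. real_of_ereal (\<phi> x + ereal (g x)))"
      by (rule integrable_cong_AE_imp[OF int' _ ae']) measurable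
  qed
  have "loglik (\<lambda>x. \<phi> x + ereal (g x)) Q = (\<integral>x. real_of_ereal (\<phi> x) + g x \<partial>Q)"
    unfolding loglik_def by (rule sym, rule integral_cong_AE) (use ae' in auto)
  also have "\<dots> = loglik \<phi> Q + (\<integral>x. g x \<partial>Q)"
    unfolding loglik_def using int g by simp
  finally show "loglik (\<lambda>x. \<phi> x + ereal (g x)) Q = loglik \<phi> Q + (\<integral>x. g x \<partial>Q)" .
qed

text \<open>Dividing a density by its total mass costs nothing in the functional, because
  \<open>J - 1 \<ge> ln J\<close>. So the maximisation may be restricted to probability densities.\<close>

lemma Phi_normalise:
  assumes \<phi>: "\<phi> \<in> Phi" and J: "mass \<phi> > 0" and Q: "real_distribution Q" and fin: "log_integrable \<phi> Q"
  defines "\<phi>' \<equiv> (\<lambda>x. \<phi> x + ereal (- ln (mass \<phi>)))"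
  shows "\<phi>' \<in> Phi" "mass \<phi>' = 1" "log_integrable \<phi>' Q" "loglik \<phi>' Q = loglik \<phi> Q - ln (mass \<phi>)"
proof -
  interpret real_distribution Q by fact
  obtain a b where b: "b > 0" and env: "\<And>x. \<phi> x \<le> ereal (a - b * \<bar>x\<bar>)"
    using Phi_envelope[OF \<phi>] by blast
  show "\<phi>' \<in> Phi"
    unfolding \<phi>'_def using Phi_tilt[OF \<phi> env, of 0 "- ln (mass \<phi>)"] b by simp
  show "log_integrable \<phi>' Q" unfolding \<phi>'_def by (rule log_integrable_tilt[OF \<phi> Q fin]) simp
  have "loglik \<phi>' Q = loglik \<phi> Q + (\<integral>x. - ln (mass \<phi>) \<partial>Q)"
    unfolding \<phi>'_def by (rule log_integrable_tilt[OF \<phi> Q fin]) simp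
  then show "loglik \<phi>' Q = loglik \<phi> Q - ln (mass \<phi>)" by (simp add: prob_space[simplified])
  have "exp_of \<phi>' x = exp_of \<phi> x / mass \<phi>" for x
    unfolding \<phi>'_def using exp_of_tilt[where \<phi> = \<phi> and x = x and g = "\<lambda>_. - ln (mass \<phi>)", OF Phi_not_infinity[OF \<phi>]] J
    by (simp add: exp_minus divide_inverse)
  then have "mass \<phi>' = (\<integral>x. exp_of \<phi> x / mass \<phi> \<partial>lborel)" by (simp add: mass_def)
  also have "\<dots> = mass \<phi> / mass \<phi>" by (simp add: mass_def)
  finally show "mass \<phi>' = 1" using J by simp
qed

text \<open>The logarithm of the geometric mean of two densities.\<close>

definition log_midpoint :: "(real \<Rightarrow> ereal) \<Rightarrow> (real \<Rightarrow> ereal) \<Rightarrow> real \<Rightarrow> ereal" where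
  "log_midpoint \<phi>1 \<phi>2 x = (if \<phi>1 x = -\<infinity> \<or> \<phi>2 x = -\<infinity> then -\<infinity>
     else ereal ((real_of_ereal (\<phi>1 x) + real_of_ereal (\<phi>2 x)) / 2))"

lemma less_log_midpointD:
  assumes "ereal s < log_midpoint \<phi>1 \<phi>2 x" and fin: "\<phi>1 x \<noteq> \<infinity>" "\<phi>2 x \<noteq> \<infinity>"
  shows "\<exists>s1 s2. ereal s1 \<le> \<phi>1 x \<and> ereal s2 \<le> \<phi>2 x \<and> s \<le> (s1 + s2) / 2"
proof -
  obtain v1 v2 where "\<phi>1 x = ereal v1" "\<phi>2 x = ereal v2" "s < (v1 + v2) / 2"
    using assms by (cases "\<phi>1 x"; cases "\<phi>2 x") (auto simp: log_midpoint_def)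
  then show ?thesis by (intro exI[of _ v1] exI[of _ v2]) auto
qed

lemma le_log_midpointI:
  assumes "ereal s1 \<le> \<phi>1 x" "ereal s2 \<le> \<phi>2 x" "s \<le> (s1 + s2) / 2" and fin: "\<phi>1 x \<noteq> \<infinity>" "\<phi>2 x \<noteq> \<infinity>"
  shows "ereal s \<le> log_midpoint \<phi>1 \<phi>2 x"
  using assms by (cases "\<phi>1 x"; cases "\<phi>2 x") (auto simp: log_midpoint_def)

lemma log_midpoint_leI:
  assumes "\<phi>1 x \<le> ereal c1" "\<phi>2 x \<le> ereal c2" "(c1 + c2) / 2 \<le> c"
  shows "log_midpoint \<phi>1 \<phi>2 x \<le> ereal c"
  using assms by (cases "\<phi>1 x"; cases "\<phi>2 x") (auto simp: log_midpoint_def)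

lemma log_midpoint_lessD:
  assumes "log_midpoint \<phi>1 \<phi>2 x < ereal c" and fin: "\<phi>1 x \<noteq> \<infinity>" "\<phi>2 x \<noteq> \<infinity>"
  shows "\<exists>c1 c2. \<phi>1 x < ereal c1 \<and> \<phi>2 x < ereal c2 \<and> (c1 + c2) / 2 \<le> c"
proof (cases "\<phi>1 x")
  case (real v1)
  show ?thesis
  proof (cases "\<phi>2 x")
    case v2: (real v2)
    have "v1 + v2 < 2 * c" using assms(1) real v2 by (auto simp: log_midpoint_def)
    then show ?thesis using real v2
      by (intro exI[of _ "v1 + (2 * c - v1 - v2) / 2"] exI[of _ "v2 + (2 * c - v1 - v2) / 2"])
        (auto simp: field_simps)
  next
    case MInf
    then show ?thesis using real by (intro exI[of _ "v1 + 1"] exI[of _ "2 * c - (v1 + 1)"]) auto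
  qed (use fin in auto)
next
  case MInf
  then obtain c2 where "\<phi>2 x < ereal c2" using fin(2) by (metis ereal_dense2 ereal_infty_less(1))
  then show ?thesis using MInf by (intro exI[of _ "2 * c - c2"] exI[of _ c2]) auto
qed (use fin in auto)

lemma Phi_log_midpoint:
  assumes \<phi>: "\<phi>1 \<in> Phi" "\<phi>2 \<in> Phi"
  shows "log_midpoint \<phi>1 \<phi>2 \<in> Phi"
proof -
  obtain a1 b1 where b1: "b1 > 0" and env1: "\<And>x. \<phi>1 x \<le> ereal (a1 - b1 * \<bar>x\<bar>)"
    using Phi_envelope[OF \<phi>(1)] by blast
  obtain a2 b2 where b2: "b2 > 0" and env2: "\<And>x. \<phi>2 x \<le> ereal (a2 - b2 * \<bar>x\<bar>)"
    using Phi_envelope[OF \<phi>(2)] by blast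
  note nf = Phi_not_infinity[OF \<phi>(1)] Phi_not_infinity[OF \<phi>(2)]
  show ?thesis
  proof (rule PhiI[where a = "(a1 + a2) / 2" and b = "(b1 + b2) / 2"])
    show "log_midpoint \<phi>1 \<phi>2 x \<noteq> \<infinity>" for x by (simp add: log_midpoint_def)
    show "ereal ((1 - u) * s + u * t) \<le> log_midpoint \<phi>1 \<phi>2 ((1 - u) * x + u * y)"
      if u: "0 < u" "u < 1" and st: "ereal s < log_midpoint \<phi>1 \<phi>2 x" "ereal t < log_midpoint \<phi>1 \<phi>2 y" for x y s t u
    proof -
      obtain s1 s2 where s: "ereal s1 \<le> \<phi>1 x" "ereal s2 \<le> \<phi>2 x" "s \<le> (s1 + s2) / 2"
        using less_log_midpointD[OF st(1) nf] by blast
      obtain t1 t2 where t: "ereal t1 \<le> \<phi>1 y" "ereal t2 \<le> \<phi>2 y" "t \<le> (t1 + t2) / 2"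
        using less_log_midpointD[OF st(2) nf] by blast
      have "(1 - u) * s + u * t \<le> (1 - u) * ((s1 + s2) / 2) + u * ((t1 + t2) / 2)"
        using s(3) t(3) u by (intro add_mono mult_left_mono) auto
      also have "\<dots> = (((1 - u) * s1 + u * t1) + ((1 - u) * s2 + u * t2)) / 2" by (simp add: field_simps)
      finally show ?thesis
        using Phi_concave[OF \<phi>(1) s(1) t(1), of u] Phi_concave[OF \<phi>(2) s(2) t(2), of u] u
        by (intro le_log_midpointI[OF _ _ _ nf]) auto
    qed
    show "\<exists>d>0. \<forall>y. \<bar>y - x\<bar> < d \<longrightarrow> log_midpoint \<phi>1 \<phi>2 y \<le> ereal k" if k: "log_midpoint \<phi>1 \<phi>2 x < ereal k" for x k
    proof -
      obtain c1 c2 where c: "\<phi>1 x < ereal c1" "\<phi>2 x < ereal c2" "(c1 + c2) / 2 \<le> k"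
        using log_midpoint_lessD[OF k nf] by blast
      obtain d1 where d1: "d1 > 0" "\<And>y. \<bar>y - x\<bar> < d1 \<Longrightarrow> \<phi>1 y < ereal c1"
        using Phi_usc[OF \<phi>(1) c(1)] by blast
      obtain d2 where d2: "d2 > 0" "\<And>y. \<bar>y - x\<bar> < d2 \<Longrightarrow> \<phi>2 y < ereal c2"
        using Phi_usc[OF \<phi>(2) c(2)] by blast
      have "log_midpoint \<phi>1 \<phi>2 y \<le> ereal k" if "\<bar>y - x\<bar> < min d1 d2" for y
        using that d1(2)[of y] d2(2)[of y] by (intro log_midpoint_leI[OF _ _ c(3)]) (auto intro: less_imp_le)
      then show ?thesis using d1 d2 by (intro exI[of _ "min d1 d2"]) auto
    qed
    show "log_midpoint \<phi>1 \<phi>2 x \<le> ereal ((a1 + a2) / 2 - (b1 + b2) / 2 * \<bar>x\<bar>)" for x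
      by (rule log_midpoint_leI[OF env1 env2]) (simp add: field_simps)
    show "(b1 + b2) / 2 > 0" using b1 b2 by simp
  qed
qed

lemma exp_of_log_midpoint:
  assumes "\<phi>1 x \<noteq> \<infinity>" "\<phi>2 x \<noteq> \<infinity>"
  shows "exp_of (log_midpoint \<phi>1 \<phi>2) x = sqrt (exp_of \<phi>1 x * exp_of \<phi>2 x)"
proof -
  have "sqrt (exp v * exp w) = exp ((v + w) / 2)" for v w :: real
  proof -
    have "exp v * exp w = (exp ((v + w) / 2))\<^sup>2"
      by (simp add: power2_eq_square flip: exp_add)
    then show ?thesis by simp
  qed
  then show ?thesis using assms by (cases "\<phi>1 x"; cases "\<phi>2 x") (auto simp: exp_of_def log_midpoint_def)
qed

lemma log_integrable_log_midpoint:
  assumes \<phi>: "\<phi>1 \<in> Phi" "\<phi>2 \<in> Phi" and Q: "real_distribution Q"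
    and fin: "log_integrable \<phi>1 Q" "log_integrable \<phi>2 Q"
  shows "log_integrable (log_midpoint \<phi>1 \<phi>2) Q"
    and "loglik (log_midpoint \<phi>1 \<phi>2) Q = (loglik \<phi>1 Q + loglik \<phi>2 Q) / 2"
proof -
  interpret real_distribution Q by fact
  note [measurable] = Phi_measurable[OF Phi_log_midpoint[OF \<phi>]] Phi_measurable[OF \<phi>(1)] Phi_measurable[OF \<phi>(2)]
  have ae: "AE x in Q. \<phi>1 x \<noteq> -\<infinity>" "AE x in Q. \<phi>2 x \<noteq> -\<infinity>"
    and int: "integrable Q (\<lambda>x. real_of_ereal (\<phi>1 x))" "integrable Q (\<lambda>x. real_of_ereal (\<phi>2 x))"
    using fin by (auto simp: log_integrable_def)
  have ae': "AE x in Q. (real_of_ereal (\<phi>1 x) + real_of_ereal (\<phi>2 x)) / 2 = real_of_ereal (log_midpoint \<phi>1 \<phi>2 x)"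
    using ae by eventually_elim (simp add: log_midpoint_def)
  have int': "integrable Q (\<lambda>x. (real_of_ereal (\<phi>1 x) + real_of_ereal (\<phi>2 x)) / 2)" using int by simp
  show "log_integrable (log_midpoint \<phi>1 \<phi>2) Q"
    unfolding log_integrable_def
  proof
    show "AE x in Q. log_midpoint \<phi>1 \<phi>2 x \<noteq> - \<infinity>" using ae by eventually_elim (simp add: log_midpoint_def)
    show "integrable Q (\<lambda>x. real_of_ereal (log_midpoint \<phi>1 \<phi>2 x))"
      by (rule integrable_cong_AE_imp[OF int' _ ae']) measurable
  qed
  have "loglik (log_midpoint \<phi>1 \<phi>2) Q = (\<integral>x. (real_of_ereal (\<phi>1 x) + real_of_ereal (\<phi>2 x)) / 2 \<partial>Q)"
    unfolding loglik_def by (rule sym, rule integral_cong_AE) (use ae' in auto)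
  also have "\<dots> = (loglik \<phi>1 Q + loglik \<phi>2 Q) / 2"
    unfolding loglik_def using int by simp
  finally show "loglik (log_midpoint \<phi>1 \<phi>2) Q = (loglik \<phi>1 Q + loglik \<phi>2 Q) / 2" .
qed

text \<open>The smallest \<open>\<kappa>\<close>-Lipschitz majorant of \<open>\<phi>\<close>. When \<open>\<kappa>\<close> is at least the decay rate \<open>b\<close> of an envelope of \<open>\<phi>\<close>, it is finite
  everywhere, unless \<open>\<phi>\<close> is nowhere finite, so a distribution may put mass outside the support of
  \<open>exp \<phi>\<close> without spoiling its likelihood.\<close>

definition lipschitz_majorant :: "real \<Rightarrow> (real \<Rightarrow> ereal) \<Rightarrow> real \<Rightarrow> ereal" where
  "lipschitz_majorant \<kappa> \<phi> x = (SUP y. \<phi> y - ereal (\<kappa> * \<bar>x - y\<bar>))"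

lemma lipschitz_majorant_ge: "\<phi> x \<le> lipschitz_majorant \<kappa> \<phi> x"
  unfolding lipschitz_majorant_def
  by (rule SUP_upper2[of x]) (auto simp flip: zero_ereal_def)

lemma lipschitz_majorant_le:
  assumes env: "\<And>x. \<phi> x \<le> ereal (a - b * \<bar>x\<bar>)" and b: "0 < b" "b \<le> \<kappa>"
  shows "lipschitz_majorant \<kappa> \<phi> x \<le> ereal (a - b * \<bar>x\<bar>)"
  unfolding lipschitz_majorant_def
proof (rule SUP_least)
  fix y
  have "b * \<bar>x\<bar> \<le> b * (\<bar>y\<bar> + \<bar>x - y\<bar>)" using b by (intro mult_left_mono) auto
  also have "\<dots> \<le> b * \<bar>y\<bar> + \<kappa> * \<bar>x - y\<bar>"
    using mult_right_mono[OF b(2), of "\<bar>x - y\<bar>"] by (simp add: algebra_simps)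
  finally have "a - b * \<bar>y\<bar> - \<kappa> * \<bar>x - y\<bar> \<le> a - b * \<bar>x\<bar>" by simp
  then show "\<phi> y - ereal (\<kappa> * \<bar>x - y\<bar>) \<le> ereal (a - b * \<bar>x\<bar>)"
    using env[of y] by (cases "\<phi> y") auto
qed

lemma lipschitz_majorant_lipschitz:
  assumes "0 \<le> \<kappa>"
  shows "lipschitz_majorant \<kappa> \<phi> x \<le> lipschitz_majorant \<kappa> \<phi> y + ereal (\<kappa> * \<bar>x - y\<bar>)"
  unfolding lipschitz_majorant_def[of _ _ x]
proof (rule SUP_least)
  fix z
  have "\<kappa> * \<bar>y - z\<bar> \<le> \<kappa> * (\<bar>x - y\<bar> + \<bar>x - z\<bar>)" using assms by (intro mult_left_mono) auto
  then have "- (\<kappa> * \<bar>x - z\<bar>) \<le> - (\<kappa> * \<bar>y - z\<bar>) + \<kappa> * \<bar>x - y\<bar>" by (simp add: algebra_simps)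
  then have "\<phi> z - ereal (\<kappa> * \<bar>x - z\<bar>) \<le> (\<phi> z - ereal (\<kappa> * \<bar>y - z\<bar>)) + ereal (\<kappa> * \<bar>x - y\<bar>)"
    by (cases "\<phi> z") auto
  also have "\<dots> \<le> lipschitz_majorant \<kappa> \<phi> y + ereal (\<kappa> * \<bar>x - y\<bar>)"
    unfolding lipschitz_majorant_def by (intro add_right_mono SUP_upper) auto
  finally show "\<phi> z - ereal (\<kappa> * \<bar>x - z\<bar>) \<le> lipschitz_majorant \<kappa> \<phi> y + ereal (\<kappa> * \<bar>x - y\<bar>)" .
qed

lemma Phi_lipschitz_majorant:
  assumes \<phi>: "\<phi> \<in> Phi" and env: "\<And>x. \<phi> x \<le> ereal (a - b * \<bar>x\<bar>)" and b: "0 < b" "b \<le> \<kappa>"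
  shows "lipschitz_majorant \<kappa> \<phi> \<in> Phi"
proof (rule PhiI[where a = a and b = b])
  show le: "lipschitz_majorant \<kappa> \<phi> x \<le> ereal (a - b * \<bar>x\<bar>)" for x
    by (rule lipschitz_majorant_le[OF env b])
  show "lipschitz_majorant \<kappa> \<phi> x \<noteq> \<infinity>" for x using le[of x] by auto
  show "b > 0" by fact
  show "ereal ((1 - u) * s + u * t) \<le> lipschitz_majorant \<kappa> \<phi> ((1 - u) * x + u * y)"
    if u: "0 < u" "u < 1" and st: "ereal s < lipschitz_majorant \<kappa> \<phi> x" "ereal t < lipschitz_majorant \<kappa> \<phi> y"
    for x y s t u
  proof -
    have D: "\<exists>z. ereal (s + \<kappa> * \<bar>x - z\<bar>) \<le> \<phi> z" if s: "ereal s < lipschitz_majorant \<kappa> \<phi> x" for s x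
    proof -
      obtain z where "ereal s < \<phi> z - ereal (\<kappa> * \<bar>x - z\<bar>)"
        using s unfolding lipschitz_majorant_def less_SUP_iff by blast
      then show ?thesis by (intro exI[of _ z], cases "\<phi> z") auto
    qed
    obtain x' where x': "ereal (s + \<kappa> * \<bar>x - x'\<bar>) \<le> \<phi> x'" using D[OF st(1)] by blast
    obtain y' where y': "ereal (t + \<kappa> * \<bar>y - y'\<bar>) \<le> \<phi> y'" using D[OF st(2)] by blast
    define z z' where "z = (1 - u) * x + u * y" and "z' = (1 - u) * x' + u * y'"
    have 1: "ereal ((1 - u) * (s + \<kappa> * \<bar>x - x'\<bar>) + u * (t + \<kappa> * \<bar>y - y'\<bar>)) \<le> \<phi> z'"
      unfolding z'_def by (rule Phi_concave[OF \<phi> x' y']) (use u in auto)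
    have "z - z' = (1 - u) * (x - x') + u * (y - y')" by (simp add: z_def z'_def algebra_simps)
    then have "\<bar>z - z'\<bar> \<le> (1 - u) * \<bar>x - x'\<bar> + u * \<bar>y - y'\<bar>"
      using u by (simp add: abs_convex_combination)
    then have "\<kappa> * \<bar>z - z'\<bar> \<le> \<kappa> * ((1 - u) * \<bar>x - x'\<bar> + u * \<bar>y - y'\<bar>)"
      using b by (intro mult_left_mono) auto
    then have "(1 - u) * s + u * t \<le> (1 - u) * (s + \<kappa> * \<bar>x - x'\<bar>) + u * (t + \<kappa> * \<bar>y - y'\<bar>) - \<kappa> * \<bar>z - z'\<bar>"
      by (simp add: algebra_simps)
    then have "ereal ((1 - u) * s + u * t) \<le> \<phi> z' - ereal (\<kappa> * \<bar>z - z'\<bar>)"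
      using 1 by (cases "\<phi> z'") auto
    also have "\<dots> \<le> lipschitz_majorant \<kappa> \<phi> z"
      unfolding lipschitz_majorant_def by (rule SUP_upper) simp
    finally show ?thesis by (simp add: z_def)
  qed
  show "\<exists>d>0. \<forall>y. \<bar>y - x\<bar> < d \<longrightarrow> lipschitz_majorant \<kappa> \<phi> y \<le> ereal k"
    if k: "lipschitz_majorant \<kappa> \<phi> x < ereal k" for x k
  proof -
    obtain k' where k': "lipschitz_majorant \<kappa> \<phi> x < ereal k'" "k' < k"
      using k by (metis ereal_dense2 less_ereal.simps(1))
    have "lipschitz_majorant \<kappa> \<phi> y \<le> ereal k" if y: "\<bar>y - x\<bar> < (k - k') / \<kappa>" for y
    proof -
      have "\<kappa> * \<bar>y - x\<bar> \<le> k - k'" using y b by (simp add: field_simps)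
      then have "lipschitz_majorant \<kappa> \<phi> x + ereal (\<kappa> * \<bar>y - x\<bar>) \<le> ereal k"
        unfolding add_real_le_ereal using k'(1)
        by (metis add.commute ereal_less_eq(3) le_diff_eq less_imp_le order_trans)
      then show ?thesis using lipschitz_majorant_lipschitz[of \<kappa> \<phi> y x] b by (meson order_trans less_imp_le less_le_trans)
    qed
    then show ?thesis using k' b by (intro exI[of _ "(k - k') / \<kappa>"]) auto
  qed
qed

lemma mass_lipschitz_majorant_tendsto:
  assumes \<phi>: "\<phi> \<in> Phi" and env: "\<And>x. \<phi> x \<le> ereal (a - b * \<bar>x\<bar>)" and b: "0 < b"
  shows "(\<lambda>j. mass (lipschitz_majorant (b + real j) \<phi>)) \<longlonglongrightarrow> mass \<phi>"
  unfolding mass_def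
proof (rule integral_dominated_convergence[where w = "\<lambda>x. exp a * exp (- (b * \<bar>x\<bar>))"])
  have in_Phi: "lipschitz_majorant (b + real j) \<phi> \<in> Phi" for j
    by (rule Phi_lipschitz_majorant[OF \<phi> env b]) auto
  show "exp_of \<phi> \<in> borel_measurable lborel" using exp_of_measurable[OF \<phi>] by simp
  show "exp_of (lipschitz_majorant (b + real j) \<phi>) \<in> borel_measurable lborel" for j
    using exp_of_measurable[OF in_Phi] by simp
  show "integrable lborel (\<lambda>x. exp a * exp (- (b * \<bar>x\<bar>)))" using integrable_exp_abs[OF b] by simp
  show "AE x in lborel. norm (exp_of (lipschitz_majorant (b + real j) \<phi>) x) \<le> exp a * exp (- (b * \<bar>x\<bar>))" for j
  proof (intro AE_I2)
    fix x
    have "exp_of (lipschitz_majorant (b + real j) \<phi>) x \<le> exp (a - b * \<bar>x\<bar>)"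
      by (rule exp_of_le, rule lipschitz_majorant_le[OF env b]) auto
    then show "norm (exp_of (lipschitz_majorant (b + real j) \<phi>) x) \<le> exp a * exp (- (b * \<bar>x\<bar>))"
      by (simp flip: exp_add)
  qed
  show "AE x in lborel. (\<lambda>j. exp_of (lipschitz_majorant (b + real j) \<phi>) x) \<longlonglongrightarrow> exp_of \<phi> x"
  proof (intro AE_I2 exp_of_tendsto)
    fix x c
    show "\<phi> x \<noteq> \<infinity>" by (rule Phi_not_infinity[OF \<phi>])
    show "lipschitz_majorant (b + real j) \<phi> x \<noteq> \<infinity>" for j by (rule Phi_not_infinity[OF in_Phi])
    show "\<forall>\<^sub>F j in sequentially. ereal c \<le> lipschitz_majorant (b + real j) \<phi> x" if "ereal c < \<phi> x"
      using that lipschitz_majorant_ge[of \<phi> x] by (intro always_eventually allI) (meson less_imp_le order_trans)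
    show "\<forall>\<^sub>F j in sequentially. lipschitz_majorant (b + real j) \<phi> x \<le> ereal c" if c: "\<phi> x < ereal c"
    proof -
      obtain d where d: "d > 0" "\<And>y. \<bar>y - x\<bar> < d \<Longrightarrow> \<phi> y < ereal c"
        using Phi_usc[OF \<phi> c] by blast
      obtain j0 where j0: "real j0 > (\<bar>a\<bar> + \<bar>c\<bar>) / d" using reals_Archimedean2 by blast
      have "lipschitz_majorant (b + real j) \<phi> x \<le> ereal c" if j: "j \<ge> j0" for j
        unfolding lipschitz_majorant_def
      proof (rule SUP_least)
        fix y
        show "\<phi> y - ereal ((b + real j) * \<bar>x - y\<bar>) \<le> ereal c"
        proof (cases "\<bar>y - x\<bar> < d")
          case True
          have "0 \<le> (b + real j) * \<bar>x - y\<bar>" using b by simp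
          then show ?thesis using d(2)[OF True] by (cases "\<phi> y") auto
        next
          case False
          \<comment> \<open>Points at distance at least \<open>d\<close> are ruled out by the steep slope alone.\<close>
          have "\<bar>a\<bar> + \<bar>c\<bar> \<le> real j0 * d" using j0 d by (simp add: field_simps)
          also have "\<dots> \<le> (b + real j) * \<bar>x - y\<bar>"
            using j b False d by (intro mult_mono) (auto simp: abs_minus_commute)
          finally have "a - b * \<bar>y\<bar> - (b + real j) * \<bar>x - y\<bar> \<le> c"
            using b by (smt (verit) mult_nonneg_nonneg abs_ge_zero)
          then show ?thesis using env[of y] by (cases "\<phi> y") auto
        qed
      qed
      then show ?thesis by (auto simp: eventually_sequentially)
    qed
  qed
qed

section \<open>Bounds on the likelihood\<close>

lemma mass_ge_interval:
  assumes \<phi>: "\<phi> \<in> Phi" and "p \<le> q" and c: "\<And>x. x \<in> {p..q} \<Longrightarrow> ereal c \<le> \<phi> x"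
  shows "(q - p) * exp c \<le> mass \<phi>"
proof -
  have "(\<integral>x. exp c * indicator {p..q} x \<partial>lborel) \<le> mass \<phi>"
    unfolding mass_def
  proof (rule integral_mono)
    show "integrable lborel (exp_of \<phi>)" by (rule exp_of_integrable[OF \<phi>])
    show "exp c * indicator {p..q} x \<le> exp_of \<phi> x" for x
      using exp_of_ge[of c \<phi> x] c[of x] Phi_not_infinity[OF \<phi>, of x] by (auto simp: indicator_def)
  qed (use assms in auto)
  then show ?thesis using assms(2) by (simp add: mult.commute)
qed

text \<open>A point within one of the supremum serves as well as a mode.\<close>

lemma Phi_near_max:
  assumes \<phi>: "\<phi> \<in> Phi" and ne: "\<phi> z \<noteq> -\<infinity>"
  shows "\<exists>x0 m. \<phi> x0 = ereal m \<and> (\<forall>x. \<phi> x \<le> ereal (m + 1))"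
proof -
  obtain a b where b: "b > 0" and env: "\<And>x. \<phi> x \<le> ereal (a - b * \<bar>x\<bar>)"
    using Phi_envelope[OF \<phi>] by blast
  have "\<phi> x \<le> ereal a" for x
  proof -
    have "a - b * \<bar>x\<bar> \<le> a" using b by simp
    then show ?thesis using env[of x] by (meson ereal_less_eq(3) order_trans)
  qed
  then have "(SUP x. \<phi> x) \<le> ereal a" by (intro SUP_least)
  moreover have "\<phi> z \<le> (SUP x. \<phi> x)" by (rule SUP_upper) simp
  ultimately obtain S where S: "(SUP x. \<phi> x) = ereal S" using ne by (cases "SUP x. \<phi> x") auto
  then have "ereal (S - 1) < (SUP x. \<phi> x)" by simp
  then obtain x0 where x0: "ereal (S - 1) < \<phi> x0" unfolding less_SUP_iff by blast
  have le: "\<phi> x \<le> ereal S" for x using SUP_upper[of x UNIV \<phi>] S by simp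
  obtain m where m: "\<phi> x0 = ereal m" using x0 le[of x0] by (cases "\<phi> x0") auto
  have "\<phi> x \<le> ereal (m + 1)" for x
    using le[of x] x0 m by (cases "\<phi> x") auto
  then show ?thesis using m by blast
qed

text \<open>A density of mass at most one that is as high as \<open>e\<^sup>m\<close> near its mode has width of order
  \<open>e\<^sup>-\<^sup>m\<close>: an interval of length \<open>2 e\<^sup>1\<^sup>-\<^sup>m\<close> on which \<open>\<phi> \<ge> m - 1\<close> would carry mass two. Concavity
  turns this into a linear decay at rate \<open>e\<^sup>m\<^sup>-\<^sup>1/2\<close>. So a high mode is paid for in the tails, and
  this trade-off bounds the likelihood.\<close>

lemma Phi_mode_envelope:
  assumes \<phi>: "\<phi> \<in> Phi" and mass: "mass \<phi> \<le> 1" and m: "\<phi> x0 = ereal m" and max: "\<And>x. \<phi> x \<le> ereal (m + 1)"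
  shows "\<phi> x \<le> ereal (m + 2 - exp (m - 1) / 2 * \<bar>x - x0\<bar>)"
proof -
  define w where "w = 2 * exp (1 - m)"
  have w: "w > 0" by (simp add: w_def)
  have we: "w * exp (m - 1) = 2" by (simp add: w_def flip: exp_add)
  have inv: "1 / w = exp (m - 1) / 2" using we w by (simp add: field_simps)
  have drop: "\<phi> z \<le> ereal (m - 1)" if z: "\<bar>z - x0\<bar> = w" for z
  proof (rule ccontr)
    assume "\<not> ?thesis"
    then have z1: "ereal (m - 1) \<le> \<phi> z" by simp
    have x1: "ereal (m - 1) \<le> \<phi> x0" using m by simp
    have "\<bar>z - x0\<bar> * exp (m - 1) \<le> mass \<phi>"
    proof (cases "x0 \<le> z")
      case True
      then show ?thesis
        using mass_ge_interval[OF \<phi> True, of "m - 1"] Phi_superlevel_convex[OF \<phi> x1 z1] by auto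
    next
      case False
      then have "z \<le> x0" by simp
      then show ?thesis
        using mass_ge_interval[OF \<phi>, of z x0 "m - 1"] Phi_superlevel_convex[OF \<phi> z1 x1] by auto
    qed
    then show False using z we mass by simp
  qed
  show ?thesis
  proof (cases "\<bar>x - x0\<bar> \<ge> w")
    case True
    have "\<phi> x \<le> ereal (m - \<bar>x - x0\<bar> / w)"
      by (rule Phi_linear_decay[OF \<phi> _ w drop True]) (use m in auto)
    also have "\<bar>x - x0\<bar> / w = exp (m - 1) / 2 * \<bar>x - x0\<bar>" by (simp add: inv[symmetric])
    also have "ereal (m - exp (m - 1) / 2 * \<bar>x - x0\<bar>) \<le> ereal (m + 2 - exp (m - 1) / 2 * \<bar>x - x0\<bar>)" by simp
    finally show ?thesis .
  next
    case False
    then have "\<bar>x - x0\<bar> / w \<le> 1" using w by simp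
    then have "m + 1 \<le> m + 2 - exp (m - 1) / 2 * \<bar>x - x0\<bar>" by (simp add: inv[symmetric])
    then show ?thesis using max[of x] by (meson ereal_less_eq(3) order_trans)
  qed
qed

lemma log_integrable_mode:
  assumes \<phi>: "\<phi> \<in> Phi" and mass: "mass \<phi> \<le> 1" and Q: "real_distribution Q" and fin: "log_integrable \<phi> Q"
  shows "\<exists>x0 m. \<forall>x. \<phi> x \<le> ereal (m + 2 - exp (m - 1) / 2 * \<bar>x - x0\<bar>)"
proof -
  interpret real_distribution Q by fact
  have "AE x in Q. \<phi> x \<noteq> -\<infinity>" using fin by (auto simp: log_integrable_def)
  then have "\<exists>z. \<phi> z \<noteq> -\<infinity>" using eventually_happens'[OF ae_filter_bot] by blast
  then show ?thesis using Phi_near_max[OF \<phi>] Phi_mode_envelope[OF \<phi> mass] by metis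
qed

lemma loglik_le_envelope:
  assumes Q: "real_distribution Q" and fin: "log_integrable \<phi> Q" and \<phi>: "\<phi> \<in> Phi"
    and env: "\<And>x. \<phi> x \<le> ereal (g x)" and g: "integrable Q g"
  shows "loglik \<phi> Q \<le> (\<integral>x. g x \<partial>Q)"
  unfolding loglik_def
proof (rule integral_mono_AE)
  have "AE x in Q. \<phi> x \<noteq> -\<infinity>" using fin by (auto simp: log_integrable_def)
  then show "AE x in Q. real_of_ereal (\<phi> x) \<le> g x"
  proof eventually_elim
    case (elim x)
    then show ?case using env[of x] by (cases "\<phi> x") auto
  qed
qed (use fin g in \<open>auto simp: log_integrable_def\<close>)

text \<open>With \<open>m\<close> the height of the mode, the envelope gives the bound \<open>m + 2 - s e\<^sup>m\<^sup>-\<^sup>1/2\<close>, whose maximum over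
  \<open>m\<close> is estimated by \<open>e\<^sup>z \<ge> 1 + z\<close>. The functions \<open>g x0\<close> allow for the distance to \<open>x0\<close> as well as for
  its truncation.\<close>

lemma loglik_le_spread:
  assumes \<phi>: "\<phi> \<in> Phi" and mass: "mass \<phi> \<le> 1" and Q: "real_distribution Q" and fin: "log_integrable \<phi> Q"
    and s: "s > 0" and g: "\<And>x0. integrable Q (g x0)" "\<And>x0 x. g x0 x \<le> \<bar>x - x0\<bar>"
      "\<And>x0. s \<le> (\<integral>x. g x0 x \<partial>Q)"
  shows "loglik \<phi> Q \<le> 2 - ln (s / 2)"
proof -
  interpret real_distribution Q by fact
  obtain x0 m where env: "\<And>x. \<phi> x \<le> ereal (m + 2 - exp (m - 1) / 2 * \<bar>x - x0\<bar>)"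
    using log_integrable_mode[OF \<phi> mass Q fin] by blast
  have "\<phi> x \<le> ereal (m + 2 - exp (m - 1) / 2 * g x0 x)" for x
  proof -
    have "exp (m - 1) / 2 * g x0 x \<le> exp (m - 1) / 2 * \<bar>x - x0\<bar>" using g(2) by (intro mult_left_mono) auto
    then show ?thesis using env[of x] by (meson ereal_less_eq(3) order_trans diff_left_mono)
  qed
  then have "loglik \<phi> Q \<le> (\<integral>x. m + 2 - exp (m - 1) / 2 * g x0 x \<partial>Q)"
    using g(1) by (intro loglik_le_envelope[OF Q fin \<phi>]) auto
  also have "\<dots> = m + 2 - exp (m - 1) / 2 * (\<integral>x. g x0 x \<partial>Q)" using g(1) by (simp add: prob_space[simplified])
  also have "\<dots> \<le> m + 2 - exp (m - 1) / 2 * s" using g(3) by (intro diff_left_mono mult_left_mono) auto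
  also have "exp (m - 1) / 2 * s = exp (m - 1 + ln (s / 2))" using s by (simp add: exp_add)
  also have "m + 2 - \<dots> \<le> 2 - ln (s / 2)"
    using exp_ge_add_one_self[of "m - 1 + ln (s / 2)"] by linarith
  finally show ?thesis .
qed

text \<open>For centred \<open>X\<close> one has \<open>E\<bar>X\<bar> \<le> 2 E\<bar>X - x0\<bar>\<close> for every \<open>x0\<close>, so a large mean absolute value means a
  large spread, which keeps the likelihood low.\<close>

lemma abs_mean_le_loglik:
  assumes \<phi>: "\<phi> \<in> Phi" and mass: "mass \<phi> \<le> 1" and Q: "real_distribution Q" and fin: "log_integrable \<phi> Q"
    and int: "integrable Q (\<lambda>x. x)" and centred: "(\<integral>x. x \<partial>Q) = 0"
  shows "(\<integral>x. \<bar>x\<bar> \<partial>Q) \<le> 4 * exp (2 - loglik \<phi> Q)"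
proof (cases "(\<integral>x. \<bar>x\<bar> \<partial>Q) > 0")
  case True
  interpret real_distribution Q by fact
  have "(\<integral>x. \<bar>x\<bar> \<partial>Q) / 2 \<le> (\<integral>x. \<bar>x - x0\<bar> \<partial>Q)" for x0
  proof -
    have "\<bar>\<integral>x. x - x0 \<partial>Q\<bar> \<le> (\<integral>x. \<bar>x - x0\<bar> \<partial>Q)" by (rule integral_abs_bound)
    then have 1: "\<bar>x0\<bar> \<le> (\<integral>x. \<bar>x - x0\<bar> \<partial>Q)" using int centred by (simp add: prob_space[simplified])
    have "(\<integral>x. \<bar>x\<bar> \<partial>Q) \<le> (\<integral>x. \<bar>x - x0\<bar> + \<bar>x0\<bar> \<partial>Q)" using int by (intro integral_mono) auto
    also have "\<dots> = (\<integral>x. \<bar>x - x0\<bar> \<partial>Q) + \<bar>x0\<bar>" using int by (simp add: prob_space[simplified])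
    finally show ?thesis using 1 by simp
  qed
  then have "loglik \<phi> Q \<le> 2 - ln ((\<integral>x. \<bar>x\<bar> \<partial>Q) / 2 / 2)"
    using True int by (intro loglik_le_spread[OF \<phi> mass Q fin, of _ "\<lambda>x0 x. \<bar>x - x0\<bar>"]) auto
  then have "ln ((\<integral>x. \<bar>x\<bar> \<partial>Q) / 4) \<le> 2 - loglik \<phi> Q" by simp
  then have "exp (ln ((\<integral>x. \<bar>x\<bar> \<partial>Q) / 4)) \<le> exp (2 - loglik \<phi> Q)" by simp
  then show ?thesis using True by simp
next
  case False
  then show ?thesis by (smt (verit) exp_gt_zero)
qed

text \<open>A distribution is nondegenerate exactly when its truncated mean distance to every point stays
  above a positive \<open>s\<close>. In this quantitative form nondegeneracy survives perturbations that are
  small in the bounded Lipschitz distance.\<close>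

definition spread_at_least :: "real \<Rightarrow> real measure \<Rightarrow> bool" where
  "spread_at_least s Q \<longleftrightarrow> (\<forall>x0. s \<le> (\<integral>x. min 1 \<bar>x - x0\<bar> \<partial>Q))"

lemma nondegenerate_spread:
  assumes "Q \<in> nondegenerate_distributions"
  shows "\<exists>s>0. spread_at_least s Q"
proof -
  interpret real_distribution Q using assms by (simp add: nondegenerate_distributions_def)
  have "interior (convex_support Q) \<noteq> {}" using assms by (simp add: nondegenerate_distributions_def)
  then obtain z where "z \<in> interior (convex_support Q)" by blast
  then obtain e where e: "e > 0" "ball z e \<subseteq> convex_support Q" by (auto simp: mem_interior)
  have "z - e / 2 \<in> convex_support Q" "z + e / 2 \<in> convex_support Q"
    using e by (auto intro!: subsetD[OF e(2)] simp: dist_real_def)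
  moreover have D: "u \<in> C" if "u \<in> convex_support Q" "closed C" "convex C" "measure Q C = 1" for u C
    using that by (auto simp: convex_support_def)
  ultimately have ne: "measure Q {z - e / 4..} \<noteq> 1" "measure Q {..z + e / 4} \<noteq> 1"
    using e(1) D[of "z - e / 2" "{z - e / 4..}"] D[of "z + e / 2" "{..z + e / 4}"] by auto
  have c: "UNIV - {z - e / 4..} = {..<z - e / 4}" "UNIV - {..z + e / 4} = {z + e / 4<..}" by auto
  have "measure Q {..<z - e / 4} = 1 - measure Q {z - e / 4..}"
    "measure Q {z + e / 4<..} = 1 - measure Q {..z + e / 4}"
    using prob_compl[of "{z - e / 4..}"] prob_compl[of "{..z + e / 4}"] by (simp_all add: c)
  moreover have "measure Q {z - e / 4..} < 1" "measure Q {..z + e / 4} < 1"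
    using ne prob_le_1[of "{z - e / 4..}"] prob_le_1[of "{..z + e / 4}"] by linarith+
  ultimately have pos: "measure Q {..<z - e / 4} > 0" "measure Q {z + e / 4<..} > 0" by linarith+
  define w where "w = min 1 (e / 4)"
  have w: "w > 0" using e by (simp add: w_def)
  have *: "w * measure Q A \<le> (\<integral>x. min 1 \<bar>x - x0\<bar> \<partial>Q)"
    if A: "A \<in> sets borel" "\<And>x. x \<in> A \<Longrightarrow> e / 4 \<le> \<bar>x - x0\<bar>" for A x0
  proof -
    have "(\<integral>x. w * indicator A x \<partial>Q) \<le> (\<integral>x. min 1 \<bar>x - x0\<bar> \<partial>Q)"
    proof (rule integral_mono)
      show "integrable Q (\<lambda>x. w * indicator A x)" using A by (simp add: integrable_real_indicator less_top[symmetric])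
      show "integrable Q (\<lambda>x. min 1 \<bar>x - x0\<bar>)"
        by (rule integrable_const_bound[where B = 1]) auto
      show "w * indicator A x \<le> min 1 \<bar>x - x0\<bar>" for x
        using A(2)[of x] by (auto simp: indicator_def w_def min_le_iff_disj)
    qed
    then show ?thesis using A by simp
  qed
  have "w * min (measure Q {..<z - e / 4}) (measure Q {z + e / 4<..}) \<le> (\<integral>x. min 1 \<bar>x - x0\<bar> \<partial>Q)" for x0
  proof (cases "x0 \<le> z")
    case True
    have "w * min (measure Q {..<z - e / 4}) (measure Q {z + e / 4<..}) \<le> w * measure Q {z + e / 4<..}"
      using w by (intro mult_left_mono) auto
    also have "\<dots> \<le> (\<integral>x. min 1 \<bar>x - x0\<bar> \<partial>Q)" by (rule *) (use True in \<open>auto simp: abs_if\<close>)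
    finally show ?thesis .
  next
    case False
    have "w * min (measure Q {..<z - e / 4}) (measure Q {z + e / 4<..}) \<le> w * measure Q {..<z - e / 4}"
      using w by (intro mult_left_mono) auto
    also have "\<dots> \<le> (\<integral>x. min 1 \<bar>x - x0\<bar> \<partial>Q)" by (rule *) (use False in \<open>auto simp: abs_if\<close>)
    finally show ?thesis .
  qed
  then show ?thesis unfolding spread_at_least_def using w pos
    by (intro exI[of _ "w * min (measure Q {..<z - e / 4}) (measure Q {z + e / 4<..})"]) auto
qed

lemma loglik_le_spread_at_least:
  assumes \<phi>: "\<phi> \<in> Phi" "mass \<phi> \<le> 1" and Q: "real_distribution Q" and fin: "log_integrable \<phi> Q"
    and s: "s > 0" "spread_at_least s Q"
  shows "loglik \<phi> Q \<le> 2 - ln (s / 2)"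
proof -
  interpret real_distribution Q by fact
  have "integrable Q (\<lambda>x. min 1 \<bar>x - x0\<bar>)" for x0
    by (rule integrable_const_bound[where B = 1]) auto
  then show ?thesis
    using s by (intro loglik_le_spread[OF \<phi> Q fin s(1), of "\<lambda>x0 x. min 1 \<bar>x - x0\<bar>"]) (auto simp: spread_at_least_def)
qed

text \<open>Where a log-density is almost surely finite under a nondegenerate law, it is finite at two points,
  hence on an interval.\<close>

lemma mass_pos:
  assumes \<phi>: "\<phi> \<in> Phi" and Q: "real_distribution Q" and fin: "log_integrable \<phi> Q"
    and s: "s > 0" "spread_at_least s Q"
  shows "mass \<phi> > 0"
proof -
  interpret real_distribution Q by fact
  have ae: "AE x in Q. \<phi> x \<noteq> -\<infinity>" using fin by (auto simp: log_integrable_def)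
  then obtain x where x: "\<phi> x \<noteq> -\<infinity>" using eventually_happens'[OF ae_filter_bot] by blast
  have "\<exists>y. y \<noteq> x \<and> \<phi> y \<noteq> -\<infinity>"
  proof (rule ccontr)
    assume n: "\<not> ?thesis"
    have "AE y in Q. min 1 \<bar>y - x\<bar> = 0" 
    proof (rule eventually_mono[OF ae])
      fix y assume "\<phi> y \<noteq> -\<infinity>"
      then have "y = x" using n by blast
      then show "min 1 \<bar>y - x\<bar> = 0" by simp
    qed
    then have "(\<integral>y. min 1 \<bar>y - x\<bar> \<partial>Q) = (\<integral>y. 0 \<partial>Q)" by (intro integral_cong_AE) auto
    moreover have "s \<le> (\<integral>y. min 1 \<bar>y - x\<bar> \<partial>Q)" using s(2) by (simp add: spread_at_least_def)
    ultimately show False using s(1) by simp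
  qed
  then obtain y where y: "y \<noteq> x" "\<phi> y \<noteq> -\<infinity>" by blast
  obtain v w where vw: "\<phi> x = ereal v" "\<phi> y = ereal w"
    using x y Phi_not_infinity[OF \<phi>] by (metis ereal_cases)
  define c where "c = min v w"
  have c: "ereal c \<le> \<phi> x" "ereal c \<le> \<phi> y" using vw by (auto simp: c_def)
  have "\<bar>y - x\<bar> * exp c \<le> mass \<phi>"
  proof (cases "x \<le> y")
    case True
    then show ?thesis using mass_ge_interval[OF \<phi> True, of c] Phi_superlevel_convex[OF \<phi> c] by auto
  next
    case False
    then show ?thesis
      using mass_ge_interval[OF \<phi>, of y x c] Phi_superlevel_convex[OF \<phi> c(2) c(1)] by auto
  qed
  moreover have "\<bar>y - x\<bar> * exp c > 0" using y(1) by simp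
  ultimately show ?thesis by linarith
qed

section \<open>Compactness of log-densities\<close>

text \<open>The diagonal argument in its simplest form: along a suitable subsequence each of countably many
  yes-no questions has an eventually constant answer.\<close>

lemma subseq_eventually_decided:
  fixes P :: "'a::countable \<Rightarrow> nat \<Rightarrow> bool"
  shows "\<exists>r. strict_mono (r :: nat \<Rightarrow> nat) \<and>
    (\<forall>j. (\<forall>\<^sub>F k in sequentially. P j (r k)) \<or> (\<forall>\<^sub>F k in sequentially. \<not> P j (r k)))"
proof -
  define D where "D n s \<longleftrightarrow> (\<forall>k. P (from_nat n) (s k)) \<or> (\<forall>k. \<not> P (from_nat n) (s k))"
    for n and s :: "nat \<Rightarrow> nat"
  interpret subseqs D
  proof
    fix n and s :: "nat \<Rightarrow> nat" assume "strict_mono s"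
    have "infinite ({k. P (from_nat n) (s k)} \<union> {k. \<not> P (from_nat n) (s k)})"
      by (simp add: Collect_disj_eq[symmetric])
    then consider "infinite {k. P (from_nat n) (s k)}" | "infinite {k. \<not> P (from_nat n) (s k)}" by blast
    then show "\<exists>r'. strict_mono r' \<and> D n (s \<circ> r')"
    proof cases
      case 1
      then show ?thesis using infinite_enumerate[OF 1] by (auto simp: D_def)
    next
      case 2
      then show ?thesis using infinite_enumerate[OF 2] by (auto simp: D_def)
    qed
  qed
  have "(\<forall>\<^sub>F k in sequentially. P j (diagseq k)) \<or> (\<forall>\<^sub>F k in sequentially. \<not> P j (diagseq k))" for j
  proof -
    have "D (to_nat j) (diagseq \<circ> ((+) (Suc (to_nat j))))"
      by (rule diagseq_holds) (auto simp: D_def)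
    then have "(\<forall>k. P j (diagseq (Suc (to_nat j) + k))) \<or> (\<forall>k. \<not> P j (diagseq (Suc (to_nat j) + k)))"
      by (simp add: D_def)
    then have "(\<forall>\<^sub>F k in sequentially. P j (diagseq (k + Suc (to_nat j)))) \<or>
        (\<forall>\<^sub>F k in sequentially. \<not> P j (diagseq (k + Suc (to_nat j))))"
      by (auto simp: add.commute)
    then show ?thesis
      using eventually_sequentially_seg[of "\<lambda>k. P j (diagseq k)" "Suc (to_nat j)"]
        eventually_sequentially_seg[of "\<lambda>k. \<not> P j (diagseq k)" "Suc (to_nat j)"] by blast
  qed
  then show ?thesis using subseq_diagseq by blast
qed

text \<open>Convergence of the hypographs in the sense of Painleve and Kuratowski. Pointwise convergence would be too strong at the ends of the
  supports, and would not control \<open>\<phi>\<^sub>k(y\<^sub>k)\<close> for moving points \<open>y\<^sub>k\<close>.\<close>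

definition hypo_converges :: "(nat \<Rightarrow> real \<Rightarrow> ereal) \<Rightarrow> (real \<Rightarrow> ereal) \<Rightarrow> bool" where
  "hypo_converges \<phi>s \<phi> \<longleftrightarrow>
    (\<forall>x c. \<phi> x < ereal c \<longrightarrow> (\<exists>d>0. \<forall>\<^sub>F k in sequentially. \<forall>y. \<bar>y - x\<bar> < d \<longrightarrow> \<phi>s k y \<le> ereal c)) \<and>
    (\<forall>x c d. ereal c < \<phi> x \<and> d > 0 \<longrightarrow> (\<forall>\<^sub>F k in sequentially. \<exists>y. \<bar>y - x\<bar> < d \<and> ereal c < \<phi>s k y))"

text \<open>The heights that the sequence eventually exceeds arbitrarily close to \<open>x\<close>; this is the lower limit of
  the hypographs.\<close>

definition hypo_limit :: "(nat \<Rightarrow> real \<Rightarrow> ereal) \<Rightarrow> real \<Rightarrow> ereal" where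
  "hypo_limit \<phi>s x = Sup (ereal ` {t. \<forall>d>0. \<forall>\<^sub>F k in sequentially. \<exists>y. \<bar>y - x\<bar> < d \<and> ereal t < \<phi>s k y})"

lemma hypo_limitI:
  "(\<And>d. d > 0 \<Longrightarrow> \<forall>\<^sub>F k in sequentially. \<exists>y. \<bar>y - x\<bar> < d \<and> ereal t < \<phi>s k y) \<Longrightarrow> ereal t \<le> hypo_limit \<phi>s x"
  unfolding hypo_limit_def by (rule Sup_upper) auto

lemma not_le_hypo_limitD:
  assumes "\<not> ereal t \<le> hypo_limit \<phi>s x"
  shows "\<exists>d>0. \<not> (\<forall>\<^sub>F k in sequentially. \<exists>y. \<bar>y - x\<bar> < d \<and> ereal t < \<phi>s k y)"
proof (rule ccontr)
  assume "\<not> ?thesis"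
  then have "\<forall>\<^sub>F k in sequentially. \<exists>y. \<bar>y - x\<bar> < d \<and> ereal t < \<phi>s k y" if "d > 0" for d using that by blast
  then have "ereal t \<le> hypo_limit \<phi>s x" by (rule hypo_limitI)
  with assms show False by blast
qed

lemma less_hypo_limitD:
  assumes "ereal t < hypo_limit \<phi>s x" "d > 0"
  shows "\<forall>\<^sub>F k in sequentially. \<exists>y. \<bar>y - x\<bar> < d \<and> ereal t < \<phi>s k y"
proof -
  obtain t' where t': "t < t'" "\<forall>d>0. \<forall>\<^sub>F k in sequentially. \<exists>y. \<bar>y - x\<bar> < d \<and> ereal t' < \<phi>s k y"
    using assms(1) unfolding hypo_limit_def less_Sup_iff by auto
  then have "\<forall>\<^sub>F k in sequentially. \<exists>y. \<bar>y - x\<bar> < d \<and> ereal t' < \<phi>s k y" using assms(2) by blast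
  then show ?thesis
    by eventually_elim (use t'(1) in \<open>meson ereal_less_eq(3) le_less_trans less_imp_le\<close>)
qed

lemma hypo_limit_le:
  assumes env: "\<And>k x. \<phi>s k x \<le> ereal (a - b * \<bar>x\<bar>)" and b: "b > 0"
  shows "hypo_limit \<phi>s x \<le> ereal (a - b * \<bar>x\<bar>)"
proof (rule ccontr)
  assume "\<not> ?thesis"
  then obtain t where t: "a - b * \<bar>x\<bar> < t" "ereal t < hypo_limit \<phi>s x"
    by (metis ereal_dense2 less_ereal.simps(1) not_le)
  define d where "d = (t - (a - b * \<bar>x\<bar>)) / b"
  have "d > 0" using t b by (simp add: d_def)
  then have "\<forall>\<^sub>F k in sequentially. \<exists>y. \<bar>y - x\<bar> < d \<and> ereal t < \<phi>s k y" by (rule less_hypo_limitD[OF t(2)])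
  then obtain k y where y: "\<bar>y - x\<bar> < d" "ereal t < \<phi>s k y"
    by (auto simp: eventually_sequentially)
  have "ereal t < ereal (a - b * \<bar>y\<bar>)" using y(2) env[of k y] by (rule less_le_trans)
  moreover have "b * \<bar>x\<bar> \<le> b * (\<bar>y\<bar> + d)" using y(1) b by (intro mult_left_mono) auto
  moreover have "b * d = t - (a - b * \<bar>x\<bar>)" using b by (simp add: d_def)
  ultimately show False by (simp add: algebra_simps)
qed

text \<open>Concavity passes to the limit pointwise in \<open>k\<close>: nearby points witnessing two heights yield, by
  concavity of \<open>\<phi>\<^sub>k\<close>, a nearby point witnessing their convex combination.\<close>

lemma Phi_hypo_limit:
  assumes \<phi>s: "\<And>k. \<phi>s k \<in> Phi" and env: "\<And>k x. \<phi>s k x \<le> ereal (a - b * \<bar>x\<bar>)" and b: "b > 0"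
  shows "hypo_limit \<phi>s \<in> Phi"
proof (rule PhiI[where a = a and b = b])
  show le: "hypo_limit \<phi>s x \<le> ereal (a - b * \<bar>x\<bar>)" for x by (rule hypo_limit_le[OF env b])
  show "hypo_limit \<phi>s x \<noteq> \<infinity>" for x using le[of x] by auto
  show "b > 0" by fact
  show "ereal ((1 - u) * s + u * t) \<le> hypo_limit \<phi>s ((1 - u) * x + u * y)"
    if u: "0 < u" "u < 1" and st: "ereal s < hypo_limit \<phi>s x" "ereal t < hypo_limit \<phi>s y" for x y s t u
  proof -
    have weak: "ereal ((1 - u) * s + u * t - e) \<le> hypo_limit \<phi>s ((1 - u) * x + u * y)" if e: "e > 0" for e
    proof (rule hypo_limitI)
      fix d :: real assume d: "d > 0"
      show "\<forall>\<^sub>F k in sequentially. \<exists>z. \<bar>z - ((1 - u) * x + u * y)\<bar> < d \<and> ereal ((1 - u) * s + u * t - e) < \<phi>s k z"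
        using less_hypo_limitD[OF st(1) d] less_hypo_limitD[OF st(2) d]
      proof eventually_elim
        case (elim k)
        obtain x' where x': "\<bar>x' - x\<bar> < d" "ereal s < \<phi>s k x'" using elim by blast
        obtain y' where y': "\<bar>y' - y\<bar> < d" "ereal t < \<phi>s k y'" using elim by blast
        have "ereal ((1 - u) * s + u * t) \<le> \<phi>s k ((1 - u) * x' + u * y')"
          using x' y' u by (intro Phi_concave[OF \<phi>s]) auto
        moreover have "ereal ((1 - u) * s + u * t - e) < ereal ((1 - u) * s + u * t)" using e by simp
        moreover have "\<bar>((1 - u) * x' + u * y') - ((1 - u) * x + u * y)\<bar> < d"
        proof -
          have "((1 - u) * x' + u * y') - ((1 - u) * x + u * y) = (1 - u) * (x' - x) + u * (y' - y)"
            by (simp add: algebra_simps)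
          also have "\<bar>\<dots>\<bar> \<le> (1 - u) * \<bar>x' - x\<bar> + u * \<bar>y' - y\<bar>"
            using u by (simp add: abs_convex_combination)
          also have "\<dots> < (1 - u) * d + u * d"
            using u x'(1) y'(1) by (intro add_strict_mono mult_strict_left_mono) auto
          also have "\<dots> = d" by (simp add: algebra_simps)
          finally show ?thesis .
        qed
        ultimately show ?case by (meson less_le_trans)
      qed
    qed
    show ?thesis
    proof (rule ereal_le_epsilon2)
      fix e :: real assume "0 < e"
      from weak[OF this] show "ereal ((1 - u) * s + u * t) \<le> hypo_limit \<phi>s ((1 - u) * x + u * y) + ereal e"
        by (simp add: ereal_le_add_real)
    qed
  qed
  show "\<exists>d>0. \<forall>y. \<bar>y - x\<bar> < d \<longrightarrow> hypo_limit \<phi>s y \<le> ereal c" if c: "hypo_limit \<phi>s x < ereal c" for x c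
  proof -
    obtain d where d: "d > 0" "\<not> (\<forall>\<^sub>F k in sequentially. \<exists>y. \<bar>y - x\<bar> < d \<and> ereal c < \<phi>s k y)"
      using not_le_hypo_limitD[of c \<phi>s x] c by (auto simp: not_le)
    have "hypo_limit \<phi>s y \<le> ereal c" if y: "\<bar>y - x\<bar> < d / 2" for y
    proof (rule ccontr)
      assume "\<not> ?thesis"
      then have "\<forall>\<^sub>F k in sequentially. \<exists>z. \<bar>z - y\<bar> < d / 2 \<and> ereal c < \<phi>s k z"
        using d(1) by (intro less_hypo_limitD) auto
      then have "\<forall>\<^sub>F k in sequentially. \<exists>y. \<bar>y - x\<bar> < d \<and> ereal c < \<phi>s k y"
      proof eventually_elim
        case (elim k)
        then obtain z where "\<bar>z - y\<bar> < d / 2" "ereal c < \<phi>s k z" by blast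
        moreover from this y have "\<bar>z - x\<bar> < d" by linarith
        ultimately show ?case by blast
      qed
      with d(2) show False by blast
    qed
    then show ?thesis using d(1) by (intro exI[of _ "d / 2"]) auto
  qed
qed

text \<open>The questions decided along the subsequence are whether the hypograph of \<open>\<phi>\<^sub>k\<close> meets a given
  rational box. Then a box met infinitely often is met eventually always, so the upper and the
  lower limit of the hypographs agree; the lower limit of convex sets is convex.\<close>

lemma hypo_convergent_subsequence:
  assumes \<phi>s: "\<And>k. \<phi>s k \<in> Phi" and env: "\<And>k x. \<phi>s k x \<le> ereal (a - b * \<bar>x\<bar>)" and b: "b > 0"
  shows "\<exists>r \<phi>. strict_mono (r :: nat \<Rightarrow> nat) \<and> \<phi> \<in> Phi \<and> (\<forall>x. \<phi> x \<le> ereal (a - b * \<bar>x\<bar>)) \<and>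
    hypo_converges (\<lambda>k. \<phi>s (r k)) \<phi>"
proof -
  define P where "P = (\<lambda>(p :: rat, q :: rat, t :: rat) k.
    \<exists>y. of_rat p < y \<and> y < of_rat q \<and> ereal (of_rat t) < \<phi>s k y)"
  obtain r where r: "strict_mono (r :: nat \<Rightarrow> nat)"
    "\<And>j. (\<forall>\<^sub>F k in sequentially. P j (r k)) \<or> (\<forall>\<^sub>F k in sequentially. \<not> P j (r k))"
    using subseq_eventually_decided[of P] by blast
  define \<phi> where "\<phi> = hypo_limit (\<lambda>k. \<phi>s (r k))"
  have "\<phi> \<in> Phi" unfolding \<phi>_def by (rule Phi_hypo_limit[OF \<phi>s env b])
  moreover have "\<phi> x \<le> ereal (a - b * \<bar>x\<bar>)" for x unfolding \<phi>_def by (rule hypo_limit_le[OF env b])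
  moreover have "hypo_converges (\<lambda>k. \<phi>s (r k)) \<phi>"
    unfolding hypo_converges_def
  proof (intro conjI allI impI)
    fix x c assume "\<phi> x < ereal c"
    then obtain c' where c': "\<phi> x < ereal c'" "c' < c" by (metis ereal_dense2 less_ereal.simps(1))
    obtain t where t: "c' < of_rat t" "of_rat t < c" using of_rat_dense[OF c'(2)] by blast
    have "\<not> ereal (of_rat t) \<le> \<phi> x" using c'(1) t(1)
      by (meson ereal_less_eq(3) less_imp_le not_le order_trans)
    then obtain d where d: "d > 0"
      "\<not> (\<forall>\<^sub>F k in sequentially. \<exists>y. \<bar>y - x\<bar> < d \<and> ereal (of_rat t) < \<phi>s (r k) y)"
      unfolding \<phi>_def using not_le_hypo_limitD by blast
    obtain p where p: "x - d < of_rat p" "of_rat p < x" using of_rat_dense[of "x - d" x] d(1) by auto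
    obtain q where q: "x < of_rat q" "of_rat q < x + d" using of_rat_dense[of x "x + d"] d(1) by auto
    have "\<not> (\<forall>\<^sub>F k in sequentially. P (p, q, t) (r k))"
    proof
      assume "\<forall>\<^sub>F k in sequentially. P (p, q, t) (r k)"
      then have "\<forall>\<^sub>F k in sequentially. \<exists>y. \<bar>y - x\<bar> < d \<and> ereal (of_rat t) < \<phi>s (r k) y"
      proof eventually_elim
        case (elim k)
        then obtain y where "of_rat p < y" "y < of_rat q" "ereal (of_rat t) < \<phi>s (r k) y" by (auto simp: P_def)
        moreover from this p q have "\<bar>y - x\<bar> < d" by (simp add: abs_less_iff)
        ultimately show ?case by blast
      qed
      with d(2) show False by blast
    qed
    then have ev: "\<forall>\<^sub>F k in sequentially. \<not> P (p, q, t) (r k)" using r(2) by blast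
    define d' where "d' = min (x - of_rat p) (of_rat q - x)"
    have "\<forall>\<^sub>F k in sequentially. \<forall>y. \<bar>y - x\<bar> < d' \<longrightarrow> \<phi>s (r k) y \<le> ereal c"
      using ev
    proof eventually_elim
      case (elim k)
      show ?case
      proof (intro allI impI)
        fix y assume "\<bar>y - x\<bar> < d'"
        then have "of_rat p < y" "y < of_rat q" by (auto simp: d'_def)
        moreover have "\<not> (of_rat p < y \<and> y < of_rat q \<and> ereal (of_rat t) < \<phi>s (r k) y)"
          using elim unfolding P_def by blast
        ultimately have "\<phi>s (r k) y \<le> ereal (of_rat t)" by (simp add: not_less)
        then show "\<phi>s (r k) y \<le> ereal c" using t(2) by (meson ereal_less_eq(3) less_imp_le order_trans)
      qed
    qed
    moreover have "d' > 0" using p q by (simp add: d'_def)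
    ultimately show "\<exists>d>0. \<forall>\<^sub>F k in sequentially. \<forall>y. \<bar>y - x\<bar> < d \<longrightarrow> \<phi>s (r k) y \<le> ereal c" by blast
  next
    fix x c and d :: real assume "ereal c < \<phi> x \<and> d > 0"
    then show "\<forall>\<^sub>F k in sequentially. \<exists>y. \<bar>y - x\<bar> < d \<and> ereal c < \<phi>s (r k) y"
      unfolding \<phi>_def using less_hypo_limitD[of c "\<lambda>k. \<phi>s (r k)" x d] by simp
  qed
  ultimately show ?thesis using r(1) by blast
qed

lemma hypo_converges_upper:
  assumes "hypo_converges \<phi>s \<phi>" "\<phi> x < ereal c" "(y \<longlonglongrightarrow> x)"
  shows "\<forall>\<^sub>F k in sequentially. \<phi>s k (y k) \<le> ereal c"
proof -
  obtain d where d: "d > 0" "\<forall>\<^sub>F k in sequentially. \<forall>y. \<bar>y - x\<bar> < d \<longrightarrow> \<phi>s k y \<le> ereal c"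
    using assms unfolding hypo_converges_def by blast
  have "\<forall>\<^sub>F k in sequentially. dist (y k) x < d" using assms(3) d(1) by (rule tendstoD)
  with d(2) show ?thesis by eventually_elim (simp add: dist_real_def)
qed

lemma hypo_converges_subseq:
  assumes "hypo_converges \<phi>s \<phi>" "strict_mono (r :: nat \<Rightarrow> nat)"
  shows "hypo_converges (\<lambda>k. \<phi>s (r k)) \<phi>"
  unfolding hypo_converges_def
proof (intro conjI allI impI)
  note ev = eventually_compose_filterlim[OF _ filterlim_subseq[OF assms(2)]]
  show "\<exists>d>0. \<forall>\<^sub>F k in sequentially. \<forall>y. \<bar>y - x\<bar> < d \<longrightarrow> \<phi>s (r k) y \<le> ereal c" if "\<phi> x < ereal c" for x c
    using assms(1) that ev unfolding hypo_converges_def by blast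
  show "\<forall>\<^sub>F k in sequentially. \<exists>y. \<bar>y - x\<bar> < d \<and> ereal c < \<phi>s (r k) y" if "ereal c < \<phi> x \<and> d > 0" for x c d
    using assms(1) that ev[of "\<lambda>k. \<exists>y. \<bar>y - x\<bar> < d \<and> ereal c < \<phi>s k y"] unfolding hypo_converges_def by blast
qed

text \<open>Away from the two ends of the support the densities converge pointwise: inside, nearby values
  of \<open>\<phi>\<^sub>k\<close> on both sides bound \<open>\<phi>\<^sub>k(x)\<close> from below by quasi-concavity.\<close>

lemma hypo_converges_exp_of:
  assumes \<phi>s: "\<And>k. \<phi>s k \<in> Phi" and \<phi>: "\<phi> \<in> Phi" and conv: "hypo_converges \<phi>s \<phi>"
  shows "AE x in lborel. (\<lambda>k. exp_of (\<phi>s k) x) \<longlonglongrightarrow> exp_of \<phi> x"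
proof -
  define N1 where "N1 = {x. \<phi> x \<noteq> -\<infinity> \<and> (\<forall>y<x. \<phi> y = -\<infinity>)}"
  define N2 where "N2 = {x. \<phi> x \<noteq> -\<infinity> \<and> (\<forall>y>x. \<phi> y = -\<infinity>)}"
  have one: "countable A" if "\<And>x y. x \<in> A \<Longrightarrow> y \<in> A \<Longrightarrow> x = y" for A :: "real set"
  proof (cases "A = {}")
    case False
    then obtain x where "x \<in> A" by blast
    then have "A \<subseteq> {x}" using that by blast
    then show ?thesis by (rule countable_subset) simp
  qed simp
  have "countable N1"
  proof (rule one)
    fix x y assume "x \<in> N1" "y \<in> N1"
    then show "x = y" by (cases x y rule: linorder_cases) (auto simp: N1_def)
  qed
  moreover have "countable N2"
  proof (rule one)
    fix x y assume "x \<in> N2" "y \<in> N2"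
    then show "x = y" by (cases x y rule: linorder_cases) (auto simp: N2_def)
  qed
  ultimately have "N1 \<union> N2 \<in> null_sets lborel" by (intro countable_imp_null_set_lborel) auto
  moreover have "{x \<in> space lborel. \<not> (\<lambda>k. exp_of (\<phi>s k) x) \<longlonglongrightarrow> exp_of \<phi> x} \<subseteq> N1 \<union> N2"
  proof (rule ccontr)
    assume "\<not> ?thesis"
    then obtain x where x: "x \<notin> N1" "x \<notin> N2" "\<not> (\<lambda>k. exp_of (\<phi>s k) x) \<longlonglongrightarrow> exp_of \<phi> x" by blast
    have "(\<lambda>k. exp_of (\<phi>s k) x) \<longlonglongrightarrow> exp_of \<phi> x"
    proof (rule exp_of_tendsto)
      show "\<phi> x \<noteq> \<infinity>" "\<phi>s k x \<noteq> \<infinity>" for k using Phi_not_infinity \<phi> \<phi>s by blast+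
      show "\<forall>\<^sub>F k in sequentially. \<phi>s k x \<le> ereal c" if "\<phi> x < ereal c" for c
        by (rule hypo_converges_upper[OF conv that]) simp
      show "\<forall>\<^sub>F k in sequentially. ereal c \<le> \<phi>s k x" if c: "ereal c < \<phi> x" for c
      proof -
        have "\<phi> x \<noteq> -\<infinity>" using c by auto
        then obtain v where v: "\<phi> x = ereal v" using Phi_not_infinity[OF \<phi>, of x] by (metis ereal_cases)
        have cv: "c < v" using c v by simp
        have near: "\<exists>u. 0 < u \<and> u < 1 \<and> ereal c < \<phi> ((1 - u) * x + u * y)" if y: "\<phi> y \<noteq> -\<infinity>" for y
        proof -
          obtain w where w: "\<phi> y = ereal w" using y Phi_not_infinity[OF \<phi>, of y] by (metis ereal_cases)
          define D where "D = \<bar>v - w\<bar> + 1"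
          have D: "D > 0" "v - w \<le> D" unfolding D_def by linarith+
          define u where "u = min (1 / 2) ((v - c) / (2 * D))"
          have "0 < (v - c) / (2 * D)" using cv D by simp
          then have u: "0 < u" "u < 1" by (auto simp: u_def)
          have "u * (v - w) \<le> u * D" using u D by (intro mult_left_mono) auto
          also have "\<dots> \<le> (v - c) / (2 * D) * D"
            using D by (intro mult_right_mono) (auto simp: u_def)
          also have "\<dots> = (v - c) / 2" using D by simp
          also have "\<dots> < v - c" using cv by simp
          finally have "c < (1 - u) * v + u * w" by (simp add: algebra_simps)
          moreover have "ereal ((1 - u) * v + u * w) \<le> \<phi> ((1 - u) * x + u * y)"
            using u v w by (intro Phi_concave[OF \<phi>]) auto
          ultimately show ?thesis using u by (meson less_ereal.simps(1) less_le_trans)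
        qed
        \<comment> \<open>As \<open>x\<close> is not an end of the support, heights above \<open>c\<close> occur on both sides of it.\<close>
        obtain y1 where y1: "y1 < x" "\<phi> y1 \<noteq> -\<infinity>" using x(1) \<open>\<phi> x \<noteq> -\<infinity>\<close> by (auto simp: N1_def)
        obtain y2 where y2: "y2 > x" "\<phi> y2 \<noteq> -\<infinity>" using x(2) \<open>\<phi> x \<noteq> -\<infinity>\<close> by (auto simp: N2_def)
        obtain u1 where u1: "0 < u1" "u1 < 1" "ereal c < \<phi> ((1 - u1) * x + u1 * y1)" using near[OF y1(2)] by blast
        obtain u2 where u2: "0 < u2" "u2 < 1" "ereal c < \<phi> ((1 - u2) * x + u2 * y2)" using near[OF y2(2)] by blast
        have d1: "u1 * (x - y1) > 0" and d2: "u2 * (y2 - x) > 0" using u1 u2 y1 y2 by auto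
        have "\<forall>\<^sub>F k in sequentially. \<exists>y. \<bar>y - ((1 - u1) * x + u1 * y1)\<bar> < u1 * (x - y1) \<and> ereal c < \<phi>s k y"
          using conv u1(3) d1 unfolding hypo_converges_def by blast
        moreover have "\<forall>\<^sub>F k in sequentially. \<exists>y. \<bar>y - ((1 - u2) * x + u2 * y2)\<bar> < u2 * (y2 - x) \<and> ereal c < \<phi>s k y"
          using conv u2(3) d2 unfolding hypo_converges_def by blast
        ultimately show ?thesis
        proof eventually_elim
          case (elim k)
          obtain z1 where z1: "\<bar>z1 - ((1 - u1) * x + u1 * y1)\<bar> < u1 * (x - y1)" "ereal c < \<phi>s k z1" using elim by blast
          obtain z2 where z2: "\<bar>z2 - ((1 - u2) * x + u2 * y2)\<bar> < u2 * (y2 - x)" "ereal c < \<phi>s k z2" using elim by blast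
          have "z1 \<le> x" using z1(1) by (simp add: algebra_simps abs_less_iff)
          moreover have "x \<le> z2" using z2(1) by (simp add: algebra_simps abs_less_iff)
          ultimately show ?case using Phi_superlevel_convex[OF \<phi>s] z1(2) z2(2) by (meson less_imp_le)
        qed
      qed
    qed
    with x(3) show False by blast
  qed
  ultimately show ?thesis by (rule AE_I')
qed

lemma hypo_converges_integrals:
  assumes \<phi>s: "\<And>k. \<phi>s k \<in> Phi" and \<phi>: "\<phi> \<in> Phi" and conv: "hypo_converges \<phi>s \<phi>"
    and env: "\<And>k x. \<phi>s k x \<le> ereal (a - b * \<bar>x\<bar>)" "\<And>x. \<phi> x \<le> ereal (a - b * \<bar>x\<bar>)" and b: "b > 0"
  shows "(\<lambda>k. mass (\<phi>s k)) \<longlonglongrightarrow> mass \<phi>"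
    and "(\<lambda>k. \<integral>x. x * exp_of (\<phi>s k) x \<partial>lborel) \<longlonglongrightarrow> (\<integral>x. x * exp_of \<phi> x \<partial>lborel)"
    and "(\<lambda>k. \<integral>x. \<bar>exp_of (\<phi>s k) x - exp_of \<phi> x\<bar> \<partial>lborel) \<longlonglongrightarrow> 0"
proof -
  note [measurable] = exp_of_measurable[OF \<phi>s] exp_of_measurable[OF \<phi>]
  note ae = hypo_converges_exp_of[OF \<phi>s \<phi> conv]
  have le: "exp_of (\<phi>s k) x \<le> exp a * exp (- (b * \<bar>x\<bar>))" for k x
    using exp_of_le[of "\<phi>s k" x "a - b * \<bar>x\<bar>"] env(1)[of k x] by (simp add: exp_diff exp_minus field_simps)
  have le': "exp_of \<phi> x \<le> exp a * exp (- (b * \<bar>x\<bar>))" for x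
    using exp_of_le[of "\<phi>" x "a - b * \<bar>x\<bar>"] env(2)[of x] by (simp add: exp_diff exp_minus field_simps)
  have i1: "integrable lborel (\<lambda>x. exp a * exp (- (b * \<bar>x\<bar>)))"
    using integrable_exp_abs[OF b] by simp
  have i2: "integrable lborel (\<lambda>x. exp a * (\<bar>x\<bar> * exp (- (b * \<bar>x\<bar>))))"
    using integrable_abs_exp_abs[OF b] by simp
  show "(\<lambda>k. mass (\<phi>s k)) \<longlonglongrightarrow> mass \<phi>"
    unfolding mass_def
    by (rule integral_dominated_convergence[OF _ _ i1 ae]) (use le in auto)
  show "(\<lambda>k. \<integral>x. x * exp_of (\<phi>s k) x \<partial>lborel) \<longlonglongrightarrow> (\<integral>x. x * exp_of \<phi> x \<partial>lborel)"
  proof (rule integral_dominated_convergence[OF _ _ i2])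
    show "AE x in lborel. (\<lambda>k. x * exp_of (\<phi>s k) x) \<longlonglongrightarrow> x * exp_of \<phi> x"
      using ae by eventually_elim (intro tendsto_intros)
    have "\<bar>x\<bar> * exp_of (\<phi>s k) x \<le> exp a * (\<bar>x\<bar> * exp (- (b * \<bar>x\<bar>)))" for x k
      using mult_left_mono[OF le[of k x], of "\<bar>x\<bar>"] by (simp add: mult_ac)
    then show "AE x in lborel. norm (x * exp_of (\<phi>s k) x) \<le> exp a * (\<bar>x\<bar> * exp (- (b * \<bar>x\<bar>)))" for k
      by (auto simp: abs_mult)
  qed measurable
  have "(\<lambda>k. \<integral>x. \<bar>exp_of (\<phi>s k) x - exp_of \<phi> x\<bar> \<partial>lborel) \<longlonglongrightarrow> (\<integral>x. 0 \<partial>(lborel :: real measure))"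
  proof (rule integral_dominated_convergence[OF _ _ i1])
    show "AE x in lborel. (\<lambda>k. \<bar>exp_of (\<phi>s k) x - exp_of \<phi> x\<bar>) \<longlonglongrightarrow> 0"
      using ae by eventually_elim (simp add: tendsto_rabs_zero_iff LIM_zero_iff)
    show "AE x in lborel. norm \<bar>exp_of (\<phi>s k) x - exp_of \<phi> x\<bar> \<le> exp a * exp (- (b * \<bar>x\<bar>))" for k
    proof (intro AE_I2)
      fix x
      have "\<bar>exp_of (\<phi>s k) x - exp_of \<phi> x\<bar> \<le> exp a * exp (- (b * \<bar>x\<bar>))"
        using le[of k x] le'[of x] exp_of_nonneg[of "\<phi>s k" x] exp_of_nonneg[of \<phi> x] by linarith
      then show "norm \<bar>exp_of (\<phi>s k) x - exp_of \<phi> x\<bar> \<le> exp a * exp (- (b * \<bar>x\<bar>))" by simp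
    qed
  qed auto
  then show "(\<lambda>k. \<integral>x. \<bar>exp_of (\<phi>s k) x - exp_of \<phi> x\<bar> \<partial>lborel) \<longlonglongrightarrow> 0" by simp
qed

section \<open>Upper semicontinuity of the likelihood\<close>

text \<open>A reverse Fatou lemma: integrands bounded above whose pointwise upper limits lie below \<open>h\<close>. The
  bound on the integrals from below makes \<open>h\<close> almost surely finite.\<close>

lemma fatou_upper:
  fixes g :: "nat \<Rightarrow> 'a \<Rightarrow> real" and h :: "'a \<Rightarrow> ereal"
  assumes "prob_space \<Omega>"
    and h: "h \<in> borel_measurable \<Omega>" "\<And>\<omega>. h \<omega> \<le> ereal A"
    and g: "\<And>k. integrable \<Omega> (g k)" "\<And>k. AE \<omega> in \<Omega>. g k \<omega> \<le> A"
    and lim: "AE \<omega> in \<Omega>. \<forall>c. h \<omega> < ereal c \<longrightarrow> (\<forall>\<^sub>F k in sequentially. g k \<omega> \<le> c)"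
    and v: "\<forall>e>0. \<forall>\<^sub>F k in sequentially. v - e \<le> (\<integral>\<omega>. g k \<omega> \<partial>\<Omega>)"
  shows "AE \<omega> in \<Omega>. h \<omega> \<noteq> -\<infinity>" "integrable \<Omega> (\<lambda>\<omega>. real_of_ereal (h \<omega>))"
    "v \<le> (\<integral>\<omega>. real_of_ereal (h \<omega>) \<partial>\<Omega>)"
proof -
  interpret prob_space \<Omega> by fact
  note [measurable] = h(1) borel_measurable_integrable[OF g(1)]
  note v = v[rule_format]
  define H where "H \<omega> = e2ennreal (ereal A - h \<omega>)" for \<omega>
  have [measurable]: "H \<in> borel_measurable \<Omega>" unfolding H_def by measurable
  have "AE \<omega> in \<Omega>. H \<omega> \<le> liminf (\<lambda>k. ennreal (A - g k \<omega>))"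
    using lim
  proof eventually_elim
    case (elim \<omega>)
    show ?case
      unfolding le_Liminf_iff
    proof (intro allI impI)
      fix y assume y: "y < H \<omega>"
      then obtain y' where y': "y = ennreal y'" "y' \<ge> 0" by (cases y) auto
      have "ereal y' < ereal A - h \<omega>"
      proof (rule ccontr)
        assume "\<not> ?thesis"
        then have "e2ennreal (ereal A - h \<omega>) \<le> e2ennreal (ereal y')" by (intro e2ennreal_mono) simp
        then show False using y y' by (simp add: H_def)
      qed
      then have "h \<omega> < ereal (A - y')" by (cases "h \<omega>") auto
      then obtain c where c: "h \<omega> < ereal c" "c < A - y'" by (metis ereal_dense2 less_ereal.simps(1))
      have "\<forall>\<^sub>F k in sequentially. g k \<omega> \<le> c" using elim c(1) by blast
      then show "\<forall>\<^sub>F k in sequentially. y < ennreal (A - g k \<omega>)"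
        by eventually_elim (use c(2) y' in \<open>auto intro!: ennreal_lessI\<close>)
    qed
  qed
  then have "(\<integral>\<^sup>+\<omega>. H \<omega> \<partial>\<Omega>) \<le> (\<integral>\<^sup>+\<omega>. liminf (\<lambda>k. ennreal (A - g k \<omega>)) \<partial>\<Omega>)"
    by (rule nn_integral_mono_AE)
  also have "\<dots> \<le> liminf (\<lambda>k. \<integral>\<^sup>+\<omega>. ennreal (A - g k \<omega>) \<partial>\<Omega>)"
    by (rule nn_integral_liminf) measurable
  also have "(\<lambda>k. \<integral>\<^sup>+\<omega>. ennreal (A - g k \<omega>) \<partial>\<Omega>) = (\<lambda>k. ennreal (A - (\<integral>\<omega>. g k \<omega> \<partial>\<Omega>)))"
  proof
    fix k
    have "(\<integral>\<^sup>+\<omega>. ennreal (A - g k \<omega>) \<partial>\<Omega>) = ennreal (\<integral>\<omega>. A - g k \<omega> \<partial>\<Omega>)"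
      by (rule nn_integral_eq_integral) (use g in \<open>auto elim: eventually_mono\<close>)
    then show "(\<integral>\<^sup>+\<omega>. ennreal (A - g k \<omega>) \<partial>\<Omega>) = ennreal (A - (\<integral>\<omega>. g k \<omega> \<partial>\<Omega>))"
      using g(1) by (simp add: prob_space)
  qed
  finally have le: "(\<integral>\<^sup>+\<omega>. H \<omega> \<partial>\<Omega>) \<le> liminf (\<lambda>k. ennreal (A - (\<integral>\<omega>. g k \<omega> \<partial>\<Omega>)))" .
  have bound: "(\<integral>\<^sup>+\<omega>. H \<omega> \<partial>\<Omega>) \<le> ennreal (A - v + e)" if "e > 0" for e
  proof -
    have "\<forall>\<^sub>F k in sequentially. ennreal (A - (\<integral>\<omega>. g k \<omega> \<partial>\<Omega>)) \<le> ennreal (A - v + e)"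
      using v[OF that] by eventually_elim (auto intro!: ennreal_leI)
    then have "limsup (\<lambda>k. ennreal (A - (\<integral>\<omega>. g k \<omega> \<partial>\<Omega>))) \<le> ennreal (A - v + e)" by (rule Limsup_bounded)
    then show ?thesis using le Liminf_le_Limsup[OF sequentially_bot] by (meson order_trans)
  qed
  have fin: "(\<integral>\<^sup>+\<omega>. H \<omega> \<partial>\<Omega>) < \<infinity>"
    using le_less_trans[OF bound[of 1]] by simp
  then have "AE \<omega> in \<Omega>. H \<omega> \<noteq> \<infinity>" by (intro nn_integral_PInf_AE) auto
  then show ae: "AE \<omega> in \<Omega>. h \<omega> \<noteq> -\<infinity>"
    by eventually_elim (auto simp: H_def)
  define q where "q \<omega> = A - real_of_ereal (h \<omega>)" for \<omega>
  have [measurable]: "q \<in> borel_measurable \<Omega>" unfolding q_def by measurable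
  have Hq: "AE \<omega> in \<Omega>. H \<omega> = ennreal (q \<omega>) \<and> 0 \<le> q \<omega>"
    using ae
  proof eventually_elim
    case (elim \<omega>)
    then obtain w where "h \<omega> = ereal w" "w \<le> A" using h(2)[of \<omega>] by (cases "h \<omega>") auto
    then show ?case by (simp add: H_def q_def)
  qed
  have qi: "integrable \<Omega> q"
  proof (rule integrableI_bounded)
    have "(\<integral>\<^sup>+\<omega>. ennreal (norm (q \<omega>)) \<partial>\<Omega>) = (\<integral>\<^sup>+\<omega>. H \<omega> \<partial>\<Omega>)"
      by (rule nn_integral_cong_AE, use Hq in eventually_elim) auto
    then show "(\<integral>\<^sup>+\<omega>. ennreal (norm (q \<omega>)) \<partial>\<Omega>) < \<infinity>" using fin by simp
  qed measurable
  have hq: "(\<lambda>\<omega>. real_of_ereal (h \<omega>)) = (\<lambda>\<omega>. A - q \<omega>)" by (simp add: q_def)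
  show "integrable \<Omega> (\<lambda>\<omega>. real_of_ereal (h \<omega>))" unfolding hq using qi by simp
  have qn: "(\<integral>\<^sup>+\<omega>. H \<omega> \<partial>\<Omega>) = ennreal (\<integral>\<omega>. q \<omega> \<partial>\<Omega>)"
  proof -
    have "(\<integral>\<^sup>+\<omega>. H \<omega> \<partial>\<Omega>) = (\<integral>\<^sup>+\<omega>. ennreal (q \<omega>) \<partial>\<Omega>)"
      by (rule nn_integral_cong_AE, use Hq in eventually_elim) auto
    also have "\<dots> = ennreal (\<integral>\<omega>. q \<omega> \<partial>\<Omega>)"
      by (rule nn_integral_eq_integral[OF qi]) (use Hq in \<open>auto elim: eventually_mono\<close>)
    finally show ?thesis .
  qed
  \<comment> \<open>The comparison of extended nonnegative integrals with \<open>A - v\<close> needs its sign.\<close>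
  have vA: "v \<le> A"
  proof (rule field_le_epsilon)
    fix e :: real assume e: "e > 0"
    obtain k where "v - e \<le> (\<integral>\<omega>. g k \<omega> \<partial>\<Omega>)" using v[OF e] by (auto simp: eventually_sequentially)
    also have "\<dots> \<le> (\<integral>\<omega>. A \<partial>\<Omega>)" using g by (intro integral_mono_AE) auto
    finally show "v \<le> A + e" by (simp add: prob_space)
  qed
  have "(\<integral>\<omega>. q \<omega> \<partial>\<Omega>) \<le> A - v"
  proof (rule field_le_epsilon)
    fix e :: real assume e: "e > 0"
    then show "(\<integral>\<omega>. q \<omega> \<partial>\<Omega>) \<le> A - v + e" using bound[OF e] vA unfolding qn by (subst (asm) ennreal_le_iff) auto
  qed
  then show "v \<le> (\<integral>\<omega>. real_of_ereal (h \<omega>) \<partial>\<Omega>)" unfolding hq using qi by (simp add: prob_space)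
qed

lemma log_integrable_distr:
  assumes \<phi>: "\<phi> \<in> Phi" and Y: "Y \<in> borel_measurable \<Omega>"
  shows "log_integrable \<phi> (distr \<Omega> borel Y) \<longleftrightarrow>
      (AE \<omega> in \<Omega>. \<phi> (Y \<omega>) \<noteq> -\<infinity>) \<and> integrable \<Omega> (\<lambda>\<omega>. real_of_ereal (\<phi> (Y \<omega>)))"
    and "loglik \<phi> (distr \<Omega> borel Y) = (\<integral>\<omega>. real_of_ereal (\<phi> (Y \<omega>)) \<partial>\<Omega>)"
proof -
  note [measurable] = Phi_measurable[OF \<phi>] Y
  show "log_integrable \<phi> (distr \<Omega> borel Y) \<longleftrightarrow>
      (AE \<omega> in \<Omega>. \<phi> (Y \<omega>) \<noteq> -\<infinity>) \<and> integrable \<Omega> (\<lambda>\<omega>. real_of_ereal (\<phi> (Y \<omega>)))"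
    unfolding log_integrable_def by (subst AE_distr_iff) (auto simp: integrable_distr_eq)
  show "loglik \<phi> (distr \<Omega> borel Y) = (\<integral>\<omega>. real_of_ereal (\<phi> (Y \<omega>)) \<partial>\<Omega>)"
    unfolding loglik_def by (rule integral_distr) measurable
qed

text \<open>A weight \<open>w \<le> b\<close> keeps \<open>\<phi>\<^sub>k + w\<bar>x\<bar>\<close> bounded above, so the weighted mean absolute value may be added
  to the likelihood without losing upper semicontinuity. With \<open>w > 0\<close> this shows that sequences of
  asymptotically maximal likelihood cannot lose first moment in the limit.\<close>

lemma loglik_usc:
  assumes \<Omega>: "prob_space \<Omega>" and Y: "\<And>k. Y k \<in> borel_measurable \<Omega>" "Y0 \<in> borel_measurable \<Omega>"
    and lim: "AE \<omega> in \<Omega>. (\<lambda>k. Y k \<omega>) \<longlonglongrightarrow> Y0 \<omega>"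
    and \<phi>s: "\<And>k. \<phi>s k \<in> Phi" and \<phi>: "\<phi> \<in> Phi" and conv: "hypo_converges \<phi>s \<phi>"
    and env: "\<And>k x. \<phi>s k x \<le> ereal (a - b * \<bar>x\<bar>)" "\<And>x. \<phi> x \<le> ereal (a - b * \<bar>x\<bar>)"
    and w: "0 \<le> w" "w \<le> b"
    and fin: "\<And>k. log_integrable (\<phi>s k) (distr \<Omega> borel (Y k))"
    and int: "w > 0 \<Longrightarrow> (\<forall>k. integrable \<Omega> (Y k)) \<and> integrable \<Omega> Y0"
    and v: "\<forall>e>0. \<forall>\<^sub>F k in sequentially.
      v - e \<le> loglik (\<phi>s k) (distr \<Omega> borel (Y k)) + w * (\<integral>\<omega>. \<bar>Y k \<omega>\<bar> \<partial>\<Omega>)"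
  shows "log_integrable \<phi> (distr \<Omega> borel Y0)"
    "v \<le> loglik \<phi> (distr \<Omega> borel Y0) + w * (\<integral>\<omega>. \<bar>Y0 \<omega>\<bar> \<partial>\<Omega>)"
proof -
  interpret prob_space \<Omega> by fact
  note [measurable] = Phi_measurable[OF \<phi>s] Phi_measurable[OF \<phi>] Y
  define p where "p k \<omega> = real_of_ereal (\<phi>s k (Y k \<omega>))" for k \<omega>
  have pae: "AE \<omega> in \<Omega>. \<phi>s k (Y k \<omega>) = ereal (p k \<omega>)" and pint: "integrable \<Omega> (p k)" for k
  proof -
    have "AE \<omega> in \<Omega>. \<phi>s k (Y k \<omega>) \<noteq> -\<infinity>" "integrable \<Omega> (p k)"
      using fin[of k] unfolding log_integrable_distr(1)[OF \<phi>s Y(1)] p_def[abs_def] by auto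
    then show "integrable \<Omega> (p k)" by blast
    from \<open>AE \<omega> in \<Omega>. \<phi>s k (Y k \<omega>) \<noteq> -\<infinity>\<close> show "AE \<omega> in \<Omega>. \<phi>s k (Y k \<omega>) = ereal (p k \<omega>)"
    proof eventually_elim
      case (elim \<omega>)
      then show ?case using Phi_not_infinity[OF \<phi>s, of k "Y k \<omega>"] by (cases "\<phi>s k (Y k \<omega>)") (auto simp: p_def)
    qed
  qed
  have pall: "AE \<omega> in \<Omega>. \<forall>k. \<phi>s k (Y k \<omega>) = ereal (p k \<omega>)" using pae by (simp add: AE_all_countable)
  have wi: "integrable \<Omega> (\<lambda>\<omega>. w * \<bar>Y k \<omega>\<bar>)" "integrable \<Omega> (\<lambda>\<omega>. w * \<bar>Y0 \<omega>\<bar>)" for k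
    using int w by (cases "w = 0"; force)+
  define g where "g k \<omega> = p k \<omega> + w * \<bar>Y k \<omega>\<bar>" for k \<omega>
  define h where "h \<omega> = \<phi> (Y0 \<omega>) + ereal (w * \<bar>Y0 \<omega>\<bar>)" for \<omega>
  have wb: "a - b * \<bar>y\<bar> + w * \<bar>y\<bar> \<le> a" for y :: real
    using mult_right_mono[OF w(2), of "\<bar>y\<bar>"] by simp
  have 1: "h \<in> borel_measurable \<Omega>" unfolding h_def by measurable
  have 2: "h \<omega> \<le> ereal a" for \<omega>
    unfolding h_def add_real_le_ereal using env(2)[of "Y0 \<omega>"] wb[of "Y0 \<omega>"]
    by (metis add_le_imp_le_diff ereal_less_eq(3) order_trans)
  have 3: "integrable \<Omega> (g k)" for k unfolding g_def using pint wi by simp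
  have 4: "AE \<omega> in \<Omega>. g k \<omega> \<le> a" for k
    using pae[of k]
  proof eventually_elim
    case (elim \<omega>)
    then have "p k \<omega> \<le> a - b * \<bar>Y k \<omega>\<bar>" using env(1)[of k "Y k \<omega>"] by simp
    then show ?case using wb[of "Y k \<omega>"] by (simp add: g_def)
  qed
  have 5: "AE \<omega> in \<Omega>. \<forall>c. h \<omega> < ereal c \<longrightarrow> (\<forall>\<^sub>F k in sequentially. g k \<omega> \<le> c)"
    using lim pall
  proof eventually_elim
    case (elim \<omega>)
    show ?case
    proof (intro allI impI)
      fix c assume "h \<omega> < ereal c"
      then have "\<phi> (Y0 \<omega>) < ereal (c - w * \<bar>Y0 \<omega>\<bar>)" by (simp add: h_def add_real_less_ereal)
      then obtain c' where c': "\<phi> (Y0 \<omega>) < ereal c'" "c' < c - w * \<bar>Y0 \<omega>\<bar>"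
        by (metis ereal_dense2 less_ereal.simps(1))
      have "\<forall>\<^sub>F k in sequentially. \<phi>s k (Y k \<omega>) \<le> ereal c'"
        by (rule hypo_converges_upper[OF conv c'(1) elim(1)])
      moreover have "(\<lambda>k. w * \<bar>Y k \<omega>\<bar>) \<longlonglongrightarrow> w * \<bar>Y0 \<omega>\<bar>" using elim(1) by (intro tendsto_intros)
      then have "\<forall>\<^sub>F k in sequentially. w * \<bar>Y k \<omega>\<bar> < c - c'"
        by (rule order_tendstoD(2)) (use c'(2) in simp)
      ultimately show "\<forall>\<^sub>F k in sequentially. g k \<omega> \<le> c"
        by eventually_elim (use elim(2) in \<open>simp add: g_def\<close>)
    qed
  qed
  have 6: "\<forall>\<^sub>F k in sequentially. v - e \<le> (\<integral>\<omega>. g k \<omega> \<partial>\<Omega>)" if "e > 0" for e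
  proof -
    note v = v[rule_format]
    have "(\<integral>\<omega>. g k \<omega> \<partial>\<Omega>) = loglik (\<phi>s k) (distr \<Omega> borel (Y k)) + w * (\<integral>\<omega>. \<bar>Y k \<omega>\<bar> \<partial>\<Omega>)" for k
      unfolding g_def using pint wi log_integrable_distr(2)[OF \<phi>s Y(1), of k k]
      by (subst Bochner_Integration.integral_add) (auto simp: p_def[abs_def])
    then show ?thesis using v[OF that] by simp
  qed
  then have 6: "\<forall>e>0. \<forall>\<^sub>F k in sequentially. v - e \<le> (\<integral>\<omega>. g k \<omega> \<partial>\<Omega>)" by blast
  note F = fatou_upper[OF \<Omega> 1 2 3 4 5 6]
  have ae: "AE \<omega> in \<Omega>. \<phi> (Y0 \<omega>) \<noteq> -\<infinity>"
    using F(1) by eventually_elim (auto simp: h_def)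
  have eq: "AE \<omega> in \<Omega>. real_of_ereal (h \<omega>) = real_of_ereal (\<phi> (Y0 \<omega>)) + w * \<bar>Y0 \<omega>\<bar>"
    using ae
  proof eventually_elim
    case (elim \<omega>)
    then show ?case using Phi_not_infinity[OF \<phi>, of "Y0 \<omega>"] by (cases "\<phi> (Y0 \<omega>)") (auto simp: h_def)
  qed
  have hi: "integrable \<Omega> (\<lambda>\<omega>. real_of_ereal (h \<omega>) - w * \<bar>Y0 \<omega>\<bar>)" using F(2) wi by simp
  have pi: "integrable \<Omega> (\<lambda>\<omega>. real_of_ereal (\<phi> (Y0 \<omega>)))"
    by (rule integrable_cong_AE_imp[OF hi]) (use eq in \<open>auto elim: eventually_mono\<close>)
  show "log_integrable \<phi> (distr \<Omega> borel Y0)"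
    unfolding log_integrable_distr(1)[OF \<phi> Y(2)] using ae pi by blast
  have "v \<le> (\<integral>\<omega>. real_of_ereal (h \<omega>) \<partial>\<Omega>)" by (rule F(3))
  also have "\<dots> = (\<integral>\<omega>. real_of_ereal (\<phi> (Y0 \<omega>)) + w * \<bar>Y0 \<omega>\<bar> \<partial>\<Omega>)"
    by (rule integral_cong_AE) (use eq 1 in auto)
  also have "\<dots> = loglik \<phi> (distr \<Omega> borel Y0) + w * (\<integral>\<omega>. \<bar>Y0 \<omega>\<bar> \<partial>\<Omega>)"
    using pi wi unfolding log_integrable_distr(2)[OF \<phi> Y(2)] by simp
  finally show "v \<le> loglik \<phi> (distr \<Omega> borel Y0) + w * (\<integral>\<omega>. \<bar>Y0 \<omega>\<bar> \<partial>\<Omega>)" .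
qed

lemma truncated_distance_tendsto:
  assumes \<Omega>: "prob_space \<Omega>" and Y: "\<And>k. Y k \<in> borel_measurable \<Omega>" "Y0 \<in> borel_measurable \<Omega>"
    and lim: "AE \<omega> in \<Omega>. (\<lambda>k. Y k \<omega>) \<longlonglongrightarrow> (Y0 \<omega> :: real)"
  shows "(\<lambda>k. \<integral>\<omega>. min 1 \<bar>Y k \<omega> - Y0 \<omega>\<bar> \<partial>\<Omega>) \<longlonglongrightarrow> 0"
proof -
  interpret prob_space \<Omega> by fact
  note [measurable] = Y
  have "(\<lambda>k. \<integral>\<omega>. min 1 \<bar>Y k \<omega> - Y0 \<omega>\<bar> \<partial>\<Omega>) \<longlonglongrightarrow> (\<integral>\<omega>. 0 \<partial>\<Omega>)"
  proof (rule integral_dominated_convergence[where w = "\<lambda>_. 1"])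
    show "AE \<omega> in \<Omega>. (\<lambda>k. min 1 \<bar>Y k \<omega> - Y0 \<omega>\<bar>) \<longlonglongrightarrow> 0"
      using lim
    proof eventually_elim
      case (elim \<omega>)
      have "(\<lambda>k. min 1 \<bar>Y k \<omega> - Y0 \<omega>\<bar>) \<longlonglongrightarrow> min 1 \<bar>Y0 \<omega> - Y0 \<omega>\<bar>"
        by (intro tendsto_intros elim)
      then show ?case by simp
    qed
  qed auto
  then show ?thesis by simp
qed

lemma integral_min_ge:
  assumes "prob_space \<Omega>" "Y \<in> borel_measurable \<Omega>" "Y' \<in> borel_measurable \<Omega>"
  shows "(\<integral>\<omega>. min 1 \<bar>Y' \<omega> - x0\<bar> \<partial>\<Omega>) - (\<integral>\<omega>. min 1 \<bar>Y \<omega> - Y' \<omega>\<bar> \<partial>\<Omega>) \<le> (\<integral>\<omega>. min 1 \<bar>Y \<omega> - (x0::real)\<bar> \<partial>\<Omega>)"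
proof -
  interpret prob_space \<Omega> by fact
  note [measurable] = assms(2,3)
  have i: "integrable \<Omega> (\<lambda>\<omega>. min 1 \<bar>Y \<omega> - x0\<bar>)" "integrable \<Omega> (\<lambda>\<omega>. min 1 \<bar>Y' \<omega> - x0\<bar>)"
    "integrable \<Omega> (\<lambda>\<omega>. min 1 \<bar>Y \<omega> - Y' \<omega>\<bar>)"
    by (rule integrable_const_bound[where B = 1]; auto)+
  have "(\<integral>\<omega>. min 1 \<bar>Y' \<omega> - x0\<bar> \<partial>\<Omega>) \<le> (\<integral>\<omega>. min 1 \<bar>Y \<omega> - x0\<bar> + min 1 \<bar>Y \<omega> - Y' \<omega>\<bar> \<partial>\<Omega>)"
    using i by (intro integral_mono) auto
  then show ?thesis using i by simp
qed

text \<open>Likelihoods bounded from below confine the log-densities: their modes can neither grow (the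
  limit is spread out) nor vanish, and cannot run away (the laws are tight). So there is a common
  envelope.\<close>

lemma uniform_envelope:
  assumes \<Omega>: "prob_space \<Omega>" and Y: "\<And>k. Y k \<in> borel_measurable \<Omega>" "Y0 \<in> borel_measurable \<Omega>"
    and lim: "AE \<omega> in \<Omega>. (\<lambda>k. Y k \<omega>) \<longlonglongrightarrow> Y0 \<omega>"
    and s: "s > 0" "spread_at_least s (distr \<Omega> borel Y0)"
    and \<phi>s: "\<And>k. \<phi>s k \<in> Phi" "\<And>k. mass (\<phi>s k) \<le> 1"
    and fin: "\<And>k. log_integrable (\<phi>s k) (distr \<Omega> borel (Y k))"
    and v: "\<forall>\<^sub>F k in sequentially. v \<le> loglik (\<phi>s k) (distr \<Omega> borel (Y k))"
  shows "\<exists>a b. b > 0 \<and> (\<forall>\<^sub>F k in sequentially. \<forall>x. \<phi>s k x \<le> ereal (a - b * \<bar>x\<bar>))"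
proof -
  interpret prob_space \<Omega> by fact
  note [measurable] = Y
  define W where "W k = (\<integral>\<omega>. min 1 \<bar>Y k \<omega> - Y0 \<omega>\<bar> \<partial>\<Omega>)" for k
  have W0: "W \<longlonglongrightarrow> 0" unfolding W_def by (rule truncated_distance_tendsto[OF \<Omega> Y lim])
  have "(\<lambda>j. \<integral>\<omega>. min 1 (\<bar>Y0 \<omega>\<bar> / real j) \<partial>\<Omega>) \<longlonglongrightarrow> (\<integral>\<omega>. 0 \<partial>\<Omega>)"
  proof (rule integral_dominated_convergence[where w = "\<lambda>_. 1"])
    have "(\<lambda>j. min 1 (\<bar>Y0 \<omega>\<bar> / real j)) \<longlonglongrightarrow> min 1 0" for \<omega>
      by (intro tendsto_intros lim_const_over_n)
    then show "AE \<omega> in \<Omega>. (\<lambda>j. min 1 (\<bar>Y0 \<omega>\<bar> / real j)) \<longlonglongrightarrow> 0" by simp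
  qed auto
  then have "\<forall>\<^sub>F j in sequentially. (\<integral>\<omega>. min 1 (\<bar>Y0 \<omega>\<bar> / real j) \<partial>\<Omega>) < 1 / 4"
    by (intro order_tendstoD(2)) auto
  then have "\<forall>\<^sub>F j in sequentially. (\<integral>\<omega>. min 1 (\<bar>Y0 \<omega>\<bar> / real j) \<partial>\<Omega>) < 1 / 4 \<and> j > 0"
    using eventually_gt_at_top[of 0] by eventually_elim simp
  then obtain T where T: "(\<integral>\<omega>. min 1 (\<bar>Y0 \<omega>\<bar> / real T) \<partial>\<Omega>) < 1 / 4" "T > 0"
    by (auto simp: eventually_sequentially)
  \<comment> \<open>\<open>B\<close> bounds the height of the mode, \<open>b\<close> the rate of decay from below, and \<open>X\<close> the location of the mode.
    The likelihood enters only through truncated distances, which are integrable for every law.\<close>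
  define B where "B = 2 - v - 2 * ln (s / 8)"
  define b where "b = exp (v - 3) / 2"
  define K where "K = (B + 2 - v) / b"
  define X where "X = 2 * K + real T + 1"
  have b: "b > 0" by (simp add: b_def)
  have ev: "\<forall>\<^sub>F k in sequentially. W k < s / 2" "\<forall>\<^sub>F k in sequentially. W k < 1 / 4"
    by (rule order_tendstoD(2)[OF W0], use s(1) in simp)+
  have "\<forall>\<^sub>F k in sequentially. \<forall>x. \<phi>s k x \<le> ereal ((B + 2 + b * X) - b * \<bar>x\<bar>)"
    using ev v
  proof eventually_elim
    case (elim k)
    define Qk where "Qk = distr \<Omega> borel (Y k)"
    have Qk: "real_distribution Qk" unfolding Qk_def by (rule real_distribution_distr[OF Y(1)])
    interpret Qk: real_distribution Qk by fact
    have fink: "log_integrable (\<phi>s k) Qk" using fin by (simp add: Qk_def)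
    obtain x0 m where env: "\<And>x. \<phi>s k x \<le> ereal (m + 2 - exp (m - 1) / 2 * \<bar>x - x0\<bar>)"
      using log_integrable_mode[OF \<phi>s Qk fink] by blast
    have trunc: "v \<le> m + 2 - exp (m - 1) / 2 * (\<integral>\<omega>. min R \<bar>Y k \<omega> - x0\<bar> \<partial>\<Omega>)" if R: "R \<ge> 0" for R
    proof -
      have i: "integrable Qk (\<lambda>x. min R \<bar>x - x0\<bar>)"
        by (rule Qk.integrable_const_bound[where B = R]) (use R in \<open>auto simp: abs_if\<close>)
      have "\<phi>s k x \<le> ereal (m + 2 - exp (m - 1) / 2 * min R \<bar>x - x0\<bar>)" for x
      proof -
        have "exp (m - 1) / 2 * min R \<bar>x - x0\<bar> \<le> exp (m - 1) / 2 * \<bar>x - x0\<bar>" by (intro mult_left_mono) auto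
        then show ?thesis using env[of x] by (meson ereal_less_eq(3) order_trans diff_left_mono)
      qed
      then have "loglik (\<phi>s k) Qk \<le> (\<integral>x. m + 2 - exp (m - 1) / 2 * min R \<bar>x - x0\<bar> \<partial>Qk)"
        using i by (intro loglik_le_envelope[OF Qk fink \<phi>s(1)]) auto
      also have "\<dots> = m + 2 - exp (m - 1) / 2 * (\<integral>x. min R \<bar>x - x0\<bar> \<partial>Qk)"
        using i by (simp add: Qk.prob_space[simplified])
      also have "(\<integral>x. min R \<bar>x - x0\<bar> \<partial>Qk) = (\<integral>\<omega>. min R \<bar>Y k \<omega> - x0\<bar> \<partial>\<Omega>)"
        unfolding Qk_def by (rule integral_distr) measurable
      finally show ?thesis using elim(3) by (simp add: Qk_def)
    qed
    have m_ge: "v - 2 \<le> m"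
    proof -
      have "(\<integral>\<omega>. min 0 \<bar>Y k \<omega> - x0\<bar> \<partial>\<Omega>) = 0" by (simp add: min_def)
      then show ?thesis using trunc[of 0] by simp
    qed
    have m_le: "m \<le> B"
    proof -
      have "s \<le> (\<integral>x. min 1 \<bar>x - x0\<bar> \<partial>distr \<Omega> borel Y0)" using s(2) by (simp add: spread_at_least_def)
      also have "\<dots> = (\<integral>\<omega>. min 1 \<bar>Y0 \<omega> - x0\<bar> \<partial>\<Omega>)" by (rule integral_distr) measurable
      finally have "s / 2 \<le> (\<integral>\<omega>. min 1 \<bar>Y k \<omega> - x0\<bar> \<partial>\<Omega>)"
        using integral_min_ge[OF \<Omega> Y(1)[of k] Y(2), of x0] elim(1) by (simp add: W_def)
      then have "exp (m - 1) / 2 * (s / 2) \<le> exp (m - 1) / 2 * (\<integral>\<omega>. min 1 \<bar>Y k \<omega> - x0\<bar> \<partial>\<Omega>)"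
        by (intro mult_left_mono) auto
      moreover have "exp (m - 1) / 2 * (s / 2) = 2 * exp (m - 1 + ln (s / 8))" using s(1) by (simp add: exp_add)
      ultimately have "v \<le> m + 2 - 2 * exp (m - 1 + ln (s / 8))" using trunc[of 1] by linarith
      then show ?thesis using exp_ge_add_one_self[of "m - 1 + ln (s / 8)"] unfolding B_def by linarith
    qed
    have bm: "b \<le> exp (m - 1) / 2" using m_ge by (simp add: b_def)
    have B2: "B + 2 - v \<ge> 0" using m_ge m_le by linarith
    have x0: "\<bar>x0\<bar> \<le> X"
    proof (cases "\<bar>x0\<bar> \<le> real T + 1")
      case True
      moreover have "K \<ge> 0" using B2 b by (simp add: K_def)
      ultimately show ?thesis by (simp add: X_def)
    next
      case False
      define D where "D = \<bar>x0\<bar> - (real T + 1)"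
      have D: "D > 0" using False by (simp add: D_def)
      \<comment> \<open>Where \<open>V < 1\<close>, the value of \<open>Y k\<close> lies within \<open>T + 1\<close> of zero, hence at distance at least \<open>D\<close> from \<open>x0\<close>.\<close>
      define V where "V \<omega> = min 1 \<bar>Y k \<omega> - Y0 \<omega>\<bar> + min 1 (\<bar>Y0 \<omega>\<bar> / real T)" for \<omega>
      have i: "integrable \<Omega> (\<lambda>\<omega>. min 1 \<bar>Y k \<omega> - Y0 \<omega>\<bar>)" "integrable \<Omega> (\<lambda>\<omega>. min 1 (\<bar>Y0 \<omega>\<bar> / real T))"
        by (rule integrable_const_bound[where B = 1]; auto)+
      have "(\<integral>\<omega>. V \<omega> \<partial>\<Omega>) \<le> 1 / 2" unfolding V_def using i T(1) elim(2) by (simp add: W_def)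
      then have "D * (1 / 2) \<le> D * (1 - (\<integral>\<omega>. V \<omega> \<partial>\<Omega>))" using D by (intro mult_left_mono) auto
      also have "\<dots> = (\<integral>\<omega>. D * (1 - V \<omega>) \<partial>\<Omega>)" using i by (simp add: V_def prob_space)
      also have "\<dots> \<le> (\<integral>\<omega>. min \<bar>x0\<bar> \<bar>Y k \<omega> - x0\<bar> \<partial>\<Omega>)"
      proof (rule integral_mono)
        show "integrable \<Omega> (\<lambda>\<omega>. D * (1 - V \<omega>))" using i by (simp add: V_def)
        show "integrable \<Omega> (\<lambda>\<omega>. min \<bar>x0\<bar> \<bar>Y k \<omega> - x0\<bar>)"
          by (rule integrable_const_bound[where B = "\<bar>x0\<bar>"]) auto
        fix \<omega>
        show "D * (1 - V \<omega>) \<le> min \<bar>x0\<bar> \<bar>Y k \<omega> - x0\<bar>"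
        proof (cases "V \<omega> \<ge> 1")
          case True
          then have "D * (1 - V \<omega>) \<le> 0" using D by (simp add: mult_le_0_iff)
          moreover have "0 \<le> min \<bar>x0\<bar> \<bar>Y k \<omega> - x0\<bar>" by simp
          ultimately show ?thesis by linarith
        next
          case False
          have nn: "0 \<le> min 1 \<bar>Y k \<omega> - Y0 \<omega>\<bar>" "0 \<le> min 1 (\<bar>Y0 \<omega>\<bar> / real T)" by auto
          have "min 1 \<bar>Y k \<omega> - Y0 \<omega>\<bar> < 1" "min 1 (\<bar>Y0 \<omega>\<bar> / real T) < 1"
            using False nn unfolding V_def by linarith+
          then have "\<bar>Y k \<omega> - Y0 \<omega>\<bar> < 1" "\<bar>Y0 \<omega>\<bar> / real T < 1" by (auto simp: min_def split: if_splits)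
          then have "\<bar>Y k \<omega> - Y0 \<omega>\<bar> < 1" "\<bar>Y0 \<omega>\<bar> < real T" using T(2) by (auto simp: field_simps)
          then have "D \<le> \<bar>Y k \<omega> - x0\<bar>" "D \<le> \<bar>x0\<bar>" unfolding D_def by linarith+
          moreover have "V \<omega> \<ge> 0" using nn unfolding V_def by linarith
          then have "D * (1 - V \<omega>) \<le> D * 1" using D by (intro mult_left_mono) auto
          ultimately show ?thesis by simp
        qed
      qed
      finally have "b * (D / 2) \<le> exp (m - 1) / 2 * (\<integral>\<omega>. min \<bar>x0\<bar> \<bar>Y k \<omega> - x0\<bar> \<partial>\<Omega>)"
        using bm b D by (intro mult_mono) auto
      moreover have "0 \<le> \<bar>x0\<bar>" by simp
      ultimately have "b * (D / 2) \<le> B + 2 - v" using trunc[of "\<bar>x0\<bar>"] m_le by linarith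
      then have "D \<le> 2 * K" using b by (simp add: K_def field_simps)
      then show ?thesis by (simp add: D_def X_def)
    qed
    show ?case
    proof
      fix x
      have "b * (\<bar>x\<bar> - X) \<le> b * \<bar>x - x0\<bar>" using x0 b by (intro mult_left_mono) auto
      also have "\<dots> \<le> exp (m - 1) / 2 * \<bar>x - x0\<bar>" using bm by (intro mult_right_mono) auto
      finally have "m + 2 - exp (m - 1) / 2 * \<bar>x - x0\<bar> \<le> (B + 2 + b * X) - b * \<bar>x\<bar>"
        using m_le by (simp add: algebra_simps)
      then show "\<phi>s k x \<le> ereal ((B + 2 + b * X) - b * \<bar>x\<bar>)"
        using env[of x] by (meson ereal_less_eq(3) order_trans)
    qed
  qed
  then show ?thesis using b by blast
qed

text \<open>The common envelope yields a convergent subsequence, and semicontinuity carries the likelihood to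
  the limit; the densities converge in mean by domination. The laws are represented by random
  variables that converge almost surely, so that the same statement covers a single law, empirical
  laws with a fixed number of atoms, and weakly convergent laws.\<close>

lemma loglik_compactness:
  assumes \<Omega>: "prob_space \<Omega>" and Y: "\<And>k. Y k \<in> borel_measurable \<Omega>" "Y0 \<in> borel_measurable \<Omega>"
    and lim: "AE \<omega> in \<Omega>. (\<lambda>k. Y k \<omega>) \<longlonglongrightarrow> Y0 \<omega>"
    and s: "s > 0" "spread_at_least s (distr \<Omega> borel Y0)"
    and \<phi>s: "\<And>k. \<phi>s k \<in> Phi" "\<And>k. mass (\<phi>s k) = 1"
    and fin: "\<And>k. log_integrable (\<phi>s k) (distr \<Omega> borel (Y k))"
    and v: "\<forall>e>0. \<forall>\<^sub>F k in sequentially. v - e \<le> loglik (\<phi>s k) (distr \<Omega> borel (Y k))"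
  obtains r \<phi> where "strict_mono (r :: nat \<Rightarrow> nat)" "\<phi> \<in> Phi" "mass \<phi> = 1"
    "log_integrable \<phi> (distr \<Omega> borel Y0)" "v \<le> loglik \<phi> (distr \<Omega> borel Y0)"
    "(\<lambda>k. \<integral>x. x * exp_of (\<phi>s (r k)) x \<partial>lborel) \<longlonglongrightarrow> (\<integral>x. x * exp_of \<phi> x \<partial>lborel)"
    "(\<lambda>k. \<integral>x. \<bar>exp_of (\<phi>s (r k)) x - exp_of \<phi> x\<bar> \<partial>lborel) \<longlonglongrightarrow> 0"
    "\<And>e. (\<And>k. integrable \<Omega> (Y k)) \<Longrightarrow> integrable \<Omega> Y0 \<Longrightarrow> loglik \<phi> (distr \<Omega> borel Y0) \<le> v \<Longrightarrow> e > 0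
      \<Longrightarrow> \<forall>\<^sub>F k in sequentially. (\<integral>\<omega>. \<bar>Y (r k) \<omega>\<bar> \<partial>\<Omega>) \<le> (\<integral>\<omega>. \<bar>Y0 \<omega>\<bar> \<partial>\<Omega>) + e"
proof -
  note v = v[rule_format]
  have "\<And>k. mass (\<phi>s k) \<le> 1" using \<phi>s(2) by simp
  from uniform_envelope[OF \<Omega> Y lim s \<phi>s(1) this fin v[of 1]]
  obtain a b where b: "b > 0" and "\<forall>\<^sub>F k in sequentially. \<forall>x. \<phi>s k x \<le> ereal (a - b * \<bar>x\<bar>)" by auto
  then obtain k0 where k0: "\<And>k x. k \<ge> k0 \<Longrightarrow> \<phi>s k x \<le> ereal (a - b * \<bar>x\<bar>)"
    by (auto simp: eventually_sequentially)
  have "\<exists>r \<phi>. strict_mono (r :: nat \<Rightarrow> nat) \<and> \<phi> \<in> Phi \<and> (\<forall>x. \<phi> x \<le> ereal (a - b * \<bar>x\<bar>)) \<and>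
    hypo_converges (\<lambda>k. \<phi>s (k0 + r k)) \<phi>"
    using hypo_convergent_subsequence[of "\<lambda>k. \<phi>s (k0 + k)" a b] \<phi>s(1) k0 b by simp
  then obtain r0 \<phi> where r0: "strict_mono (r0 :: nat \<Rightarrow> nat)" and \<phi>: "\<phi> \<in> Phi"
    and env: "\<And>x. \<phi> x \<le> ereal (a - b * \<bar>x\<bar>)" and conv0: "hypo_converges (\<lambda>k. \<phi>s (k0 + r0 k)) \<phi>" by blast
  define r where "r k = k0 + r0 k" for k
  have r: "strict_mono r" using r0 by (simp add: r_def strict_mono_def)
  have conv: "hypo_converges (\<lambda>k. \<phi>s (r k)) \<phi>" using conv0 by (simp add: r_def)
  have envr: "\<phi>s (r k) x \<le> ereal (a - b * \<bar>x\<bar>)" for k x by (rule k0) (simp add: r_def)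
  note ev_sub = eventually_compose_filterlim[OF _ filterlim_subseq]
  have limr: "AE \<omega> in \<Omega>. (\<lambda>k. Y (r' k) \<omega>) \<longlonglongrightarrow> Y0 \<omega>" if "strict_mono r'" for r'
    using lim by eventually_elim (use LIMSEQ_subseq_LIMSEQ[OF _ that] in \<open>auto simp: o_def\<close>)
  note I = hypo_converges_integrals[OF \<phi>s(1) \<phi> conv envr env b]
  have mass1: "mass \<phi> = 1" using I(1) \<phi>s(2) by (simp add: LIMSEQ_const_iff)
  have vr: "\<forall>e>0. \<forall>\<^sub>F k in sequentially.
      v - e \<le> loglik (\<phi>s (r k)) (distr \<Omega> borel (Y (r k))) + 0 * (\<integral>\<omega>. \<bar>Y (r k) \<omega>\<bar> \<partial>\<Omega>)"
    using ev_sub[OF v r] by simp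
  note U = loglik_usc[OF \<Omega> Y(1) Y(2) limr[OF r] \<phi>s(1) \<phi> conv envr env, of 0 v, OF _ _ fin _ vr]
  have U1: "log_integrable \<phi> (distr \<Omega> borel Y0)" by (rule U(1)) (use b in auto)
  have U2: "v \<le> loglik \<phi> (distr \<Omega> borel Y0)" using U(2) b by simp
  have moment: "\<forall>\<^sub>F k in sequentially. (\<integral>\<omega>. \<bar>Y (r k) \<omega>\<bar> \<partial>\<Omega>) \<le> (\<integral>\<omega>. \<bar>Y0 \<omega>\<bar> \<partial>\<Omega>) + e"
    if int: "\<And>k. integrable \<Omega> (Y k)" "integrable \<Omega> Y0" and le: "loglik \<phi> (distr \<Omega> borel Y0) \<le> v" and e: "e > 0" for e
  proof (rule ccontr)
    assume "\<not> ?thesis"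
    then have "\<exists>\<^sub>F k in sequentially. \<not> (\<integral>\<omega>. \<bar>Y (r k) \<omega>\<bar> \<partial>\<Omega>) \<le> (\<integral>\<omega>. \<bar>Y0 \<omega>\<bar> \<partial>\<Omega>) + e"
      by (simp add: frequently_def)
    then have "infinite {k. \<not> (\<integral>\<omega>. \<bar>Y (r k) \<omega>\<bar> \<partial>\<Omega>) \<le> (\<integral>\<omega>. \<bar>Y0 \<omega>\<bar> \<partial>\<Omega>) + e}"
      by (simp add: frequently_cofinite flip: cofinite_eq_sequentially)
    from infinite_enumerate[OF this] obtain q where q: "strict_mono (q :: nat \<Rightarrow> nat)"
      and big: "\<And>k. \<not> (\<integral>\<omega>. \<bar>Y (r (q k)) \<omega>\<bar> \<partial>\<Omega>) \<le> (\<integral>\<omega>. \<bar>Y0 \<omega>\<bar> \<partial>\<Omega>) + e" by auto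
    have rq: "strict_mono (\<lambda>k. r (q k))" using strict_mono_o[OF r q] by (simp add: o_def)
    \<comment> \<open>An excess \<open>e\<close> of first moment would survive in the weighted likelihood of the limit.\<close>
    define v' where "v' = v + (b / 2) * ((\<integral>\<omega>. \<bar>Y0 \<omega>\<bar> \<partial>\<Omega>) + e)"
    have vq: "\<forall>e'>0. \<forall>\<^sub>F k in sequentially. v' - e' \<le> loglik (\<phi>s (r (q k))) (distr \<Omega> borel (Y (r (q k))))
        + b / 2 * (\<integral>\<omega>. \<bar>Y (r (q k)) \<omega>\<bar> \<partial>\<Omega>)"
    proof (intro allI impI)
      fix e' :: real assume "e' > 0"
      show "\<forall>\<^sub>F k in sequentially. v' - e' \<le> loglik (\<phi>s (r (q k))) (distr \<Omega> borel (Y (r (q k))))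
        + b / 2 * (\<integral>\<omega>. \<bar>Y (r (q k)) \<omega>\<bar> \<partial>\<Omega>)"
        using ev_sub[OF v[OF \<open>e' > 0\<close>] rq]
      proof eventually_elim
        case (elim k)
        have "b / 2 * ((\<integral>\<omega>. \<bar>Y0 \<omega>\<bar> \<partial>\<Omega>) + e) \<le> b / 2 * (\<integral>\<omega>. \<bar>Y (r (q k)) \<omega>\<bar> \<partial>\<Omega>)"
          using big[of k] b by (intro mult_left_mono) auto
        then show ?case using elim by (simp add: v'_def)
      qed
    qed
    have "v' \<le> loglik \<phi> (distr \<Omega> borel Y0) + b / 2 * (\<integral>\<omega>. \<bar>Y0 \<omega>\<bar> \<partial>\<Omega>)"
      by (rule loglik_usc(2)[OF \<Omega> Y(1) Y(2) limr[OF rq] \<phi>s(1) \<phi> hypo_converges_subseq[OF conv q] envr env _ _ fin _ vq])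
        (use b int in auto)
    then have "b / 2 * e \<le> 0" using le by (simp add: v'_def algebra_simps)
    then show False using b e by (simp add: mult_le_0_iff)
  qed
  show thesis by (rule that[OF r \<phi> mass1 U1 U2 I(2) I(3) moment])
qed

section \<open>Maximum likelihood for a single distribution\<close>

definition maximises_loglik :: "(real \<Rightarrow> ereal) \<Rightarrow> real measure \<Rightarrow> bool" where
  "maximises_loglik \<phi> Q \<longleftrightarrow> \<phi> \<in> Phi \<and> mass \<phi> = 1 \<and> log_integrable \<phi> Q \<and>
    (\<forall>\<theta>\<in>Phi. mass \<theta> = 1 \<and> log_integrable \<theta> Q \<longrightarrow> loglik \<theta> Q \<le> loglik \<phi> Q)"

lemma eventually_inverse_Suc_close:
  assumes "\<And>k. V - 1 / real (Suc k) \<le> f k" "e > 0"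
  shows "\<forall>\<^sub>F k in sequentially. V - e \<le> f k"
proof -
  have "\<forall>\<^sub>F k in sequentially. 1 / real (Suc k) < e"
    using order_tendstoD(2)[OF LIMSEQ_inverse_real_of_nat assms(2)] by (simp add: inverse_eq_divide)
  then show ?thesis
  proof eventually_elim
    case (elim k)
    then show ?case using assms(1)[of k] by linarith
  qed
qed

text \<open>The Laplace density competes for every distribution with finite mean.\<close>

lemma log_integrable_exists:
  assumes Q: "real_distribution Q" and int: "integrable Q (\<lambda>x. x)"
  shows "\<exists>\<phi>\<in>Phi. mass \<phi> = 1 \<and> log_integrable \<phi> Q"
proof -
  define \<phi> :: "real \<Rightarrow> ereal" where "\<phi> x = ereal (- \<bar>x\<bar>)" for x
  have \<phi>: "\<phi> \<in> Phi"
  proof (rule PhiI[where a = 0 and b = 1])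
    show "\<exists>d>0. \<forall>y. \<bar>y - x\<bar> < d \<longrightarrow> \<phi> y \<le> ereal c" if "\<phi> x < ereal c" for x c
      using that by (intro exI[of _ "c + \<bar>x\<bar>"]) (auto simp: \<phi>_def)
    show "ereal ((1 - u) * s + u * t) \<le> \<phi> ((1 - u) * x + u * y)"
      if u: "0 < u" "u < 1" and st: "ereal s < \<phi> x" "ereal t < \<phi> y" for x y s t u
    proof -
      have "\<bar>(1 - u) * x + u * y\<bar> \<le> (1 - u) * \<bar>x\<bar> + u * \<bar>y\<bar>"
        using u by (simp add: abs_convex_combination)
      moreover have "(1 - u) * s \<le> (1 - u) * (- \<bar>x\<bar>)" "u * t \<le> u * (- \<bar>y\<bar>)"
        using u st mult_left_mono[of s "- \<bar>x\<bar>" "1 - u"] mult_left_mono[of t "- \<bar>y\<bar>" u] by (auto simp: \<phi>_def)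
      ultimately show ?thesis by (simp add: \<phi>_def)
    qed
  qed (auto simp: \<phi>_def)
  have "(1 - 0) * exp (-1) \<le> mass \<phi>" by (rule mass_ge_interval[OF \<phi>]) (auto simp: \<phi>_def)
  moreover have "(1 - 0) * exp (-1) > (0::real)" by simp
  ultimately have J: "mass \<phi> > 0" by linarith
  have fin: "log_integrable \<phi> Q" using int by (simp add: log_integrable_def \<phi>_def)
  show ?thesis using Phi_normalise[OF \<phi> J Q fin] by blast
qed

text \<open>Compactness is applied to a maximising sequence and the constant sequence of distributions.\<close>

lemma maximises_loglik_exists:
  assumes Q: "real_distribution Q" and int: "integrable Q (\<lambda>x. x)" and s: "s > 0" "spread_at_least s Q"
  shows "\<exists>\<phi>. maximises_loglik \<phi> Q"
proof -
  interpret real_distribution Q by fact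
  define S where "S = {loglik \<phi> Q | \<phi>. \<phi> \<in> Phi \<and> mass \<phi> = 1 \<and> log_integrable \<phi> Q}"
  have ne: "S \<noteq> {}" using log_integrable_exists[OF Q int] by (auto simp: S_def)
  have bdd: "bdd_above S"
    by (rule bdd_aboveI[of _ "2 - ln (s / 2)"]) (use loglik_le_spread_at_least[OF _ _ Q _ s] in \<open>auto simp: S_def\<close>)
  have "\<exists>\<phi>\<in>Phi. mass \<phi> = 1 \<and> log_integrable \<phi> Q \<and> Sup S - 1 / real (Suc k) \<le> loglik \<phi> Q" for k
  proof -
    have "Sup S - 1 / real (Suc k) < Sup S" by simp
    then obtain y where "y \<in> S" "Sup S - 1 / real (Suc k) < y" using less_cSup_iff[OF ne bdd] by blast
    then show ?thesis by (auto simp: S_def intro: less_imp_le)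
  qed
  then obtain \<phi>s where \<phi>s: "\<And>k. \<phi>s k \<in> Phi" "\<And>k. mass (\<phi>s k) = 1" "\<And>k. log_integrable (\<phi>s k) Q"
    "\<And>k. Sup S - 1 / real (Suc k) \<le> loglik (\<phi>s k) Q" by metis
  have id: "distr Q borel (\<lambda>x. x) = Q" by (rule distr_id2) simp
  have v: "\<forall>e>0. \<forall>\<^sub>F k in sequentially. Sup S - e \<le> loglik (\<phi>s k) Q"
    using eventually_inverse_Suc_close[OF \<phi>s(4)] by blast
  obtain \<phi> where "\<phi> \<in> Phi" "mass \<phi> = 1" "log_integrable \<phi> Q" "Sup S \<le> loglik \<phi> Q"
    by (rule loglik_compactness[of Q "\<lambda>_ x. x" "\<lambda>x. x" s \<phi>s "Sup S"])
      (use \<phi>s v s in \<open>auto simp: id prob_space_axioms\<close>)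
  moreover have "loglik \<theta> Q \<le> Sup S" if "\<theta> \<in> Phi" "mass \<theta> = 1" "log_integrable \<theta> Q" for \<theta>
    by (rule cSup_upper[OF _ bdd]) (use that in \<open>auto simp: S_def\<close>)
  ultimately show ?thesis unfolding maximises_loglik_def by (meson order_trans)
qed

lemma L_le_maximum:
  assumes \<phi>: "maximises_loglik \<phi> Q" and Q: "real_distribution Q" and s: "s > 0" "spread_at_least s Q"
    and \<theta>: "\<theta> \<in> Phi"
  shows "L \<theta> Q \<le> ereal (loglik \<phi> Q)"
proof (cases "log_integrable \<theta> Q")
  case True
  have J: "mass \<theta> > 0" by (rule mass_pos[OF \<theta> Q True s])
  note N = Phi_normalise[OF \<theta> J Q True]
  have "loglik \<theta> Q - ln (mass \<theta>) \<le> loglik \<phi> Q"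
    using \<phi> N unfolding maximises_loglik_def by metis
  then have "loglik \<theta> Q - mass \<theta> + 1 \<le> loglik \<phi> Q" using ln_le_minus_one[OF J] by linarith
  then show ?thesis using L_log_integrable[OF \<theta> Q True] by simp
qed (use L_not_log_integrable[OF \<theta> Q] in simp)

lemma psi_maximises:
  assumes Q: "real_distribution Q" and int: "integrable Q (\<lambda>x. x)" and s: "s > 0" "spread_at_least s Q"
  shows "maximises_loglik (psi Q) Q"
proof -
  obtain \<phi> where \<phi>: "maximises_loglik \<phi> Q" using maximises_loglik_exists[OF Q int s] by blast
  then have \<phi>': "\<phi> \<in> Phi" "mass \<phi> = 1" "log_integrable \<phi> Q" by (auto simp: maximises_loglik_def)
  have L\<phi>: "L \<phi> Q = ereal (loglik \<phi> Q)" using L_log_integrable[OF \<phi>'(1) Q \<phi>'(3)] \<phi>'(2) by simp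
  have "is_arg_max (\<lambda>\<phi>. L \<phi> Q) (\<lambda>\<phi>. \<phi> \<in> Phi) \<phi>"
    unfolding is_arg_max_def using \<phi>'(1) L_le_maximum[OF \<phi> Q s] L\<phi> by (auto simp: not_less)
  then have "is_arg_max (\<lambda>\<phi>. L \<phi> Q) (\<lambda>\<phi>. \<phi> \<in> Phi) (psi Q)"
    unfolding psi_def arg_max_def
    using someI[of "is_arg_max (\<lambda>\<phi>. L \<phi> Q) (\<lambda>\<phi>. \<phi> \<in> Phi)" \<phi>] by blast
  then have \<psi>: "psi Q \<in> Phi" and max: "\<And>\<theta>. \<theta> \<in> Phi \<Longrightarrow> L \<theta> Q \<le> L (psi Q) Q"
    unfolding is_arg_max_def by (auto simp: not_less)
  have fin: "log_integrable (psi Q) Q"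
    using max[OF \<phi>'(1)] L\<phi> L_not_log_integrable[OF \<psi> Q] by force
  have J: "mass (psi Q) > 0" by (rule mass_pos[OF \<psi> Q fin s])
  note N = Phi_normalise[OF \<psi> J Q fin]
  have "loglik (psi Q) Q - ln (mass (psi Q)) \<le> loglik (psi Q) Q - mass (psi Q) + 1"
    using max[OF N(1)] N L_log_integrable[OF N(1) Q N(3)] L_log_integrable[OF \<psi> Q fin] by simp
  then have "mass (psi Q) = 1"
    using ln_le_minus_one[OF J] ln_eq_minus_one[OF J] by linarith
  moreover have "loglik \<theta> Q \<le> loglik (psi Q) Q" if "\<theta> \<in> Phi" "mass \<theta> = 1" "log_integrable \<theta> Q" for \<theta>
    using max[OF that(1)] L_log_integrable[OF that(1) Q that(3)] L_log_integrable[OF \<psi> Q fin] that(2)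
      \<open>mass (psi Q) = 1\<close> by simp
  ultimately show ?thesis using \<psi> fin unfolding maximises_loglik_def by blast
qed

text \<open>At the midpoint of two maximisers the likelihood is the same, but the mass
  \<open>\<integral> sqrt (f\<^sub>1 f\<^sub>2)\<close> falls short of one by half of \<open>\<integral> (sqrt f\<^sub>1 - sqrt f\<^sub>2)\<^sup>2\<close>, and renormalising would
  gain.\<close>

lemma maximiser_unique:
  assumes \<phi>1: "maximises_loglik \<phi>1 Q" and \<phi>2: "\<phi>2 \<in> Phi" "mass \<phi>2 = 1" "log_integrable \<phi>2 Q"
    and le: "loglik \<phi>1 Q \<le> loglik \<phi>2 Q"
    and Q: "real_distribution Q" and s: "s > 0" "spread_at_least s Q"
  shows "AE x in lborel. exp_of \<phi>1 x = exp_of \<phi>2 x"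
proof -
  have \<phi>1': "\<phi>1 \<in> Phi" "mass \<phi>1 = 1" "log_integrable \<phi>1 Q" using \<phi>1 by (auto simp: maximises_loglik_def)
  let ?m = "log_midpoint \<phi>1 \<phi>2"
  note M = Phi_log_midpoint[OF \<phi>1'(1) \<phi>2(1)]
  note F = log_integrable_log_midpoint[OF \<phi>1'(1) \<phi>2(1) Q \<phi>1'(3) \<phi>2(3)]
  have J: "mass ?m > 0" by (rule mass_pos[OF M Q F(1) s])
  note N = Phi_normalise[OF M J Q F(1)]
  have "loglik ?m Q - ln (mass ?m) \<le> loglik \<phi>1 Q" using \<phi>1 N unfolding maximises_loglik_def by metis
  then have "0 \<le> ln (mass ?m)" unfolding F(2) using le by argo
  then have J1: "mass ?m \<ge> 1" using J by simp
  define f1 f2 where "f1 = exp_of \<phi>1" and "f2 = exp_of \<phi>2"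
  have i: "integrable lborel f1" "integrable lborel f2" "integrable lborel (exp_of ?m)"
    unfolding f1_def f2_def using exp_of_integrable(1) \<phi>1'(1) \<phi>2(1) M by blast+
  have [simp]: "f1 x \<ge> 0" "f2 x \<ge> 0" for x by (auto simp: f1_def f2_def)
  have sq: "(sqrt (f1 x) - sqrt (f2 x))\<^sup>2 = f1 x + f2 x - 2 * exp_of ?m x" for x
    using exp_of_log_midpoint[of \<phi>1 x \<phi>2, OF Phi_not_infinity[OF \<phi>1'(1)] Phi_not_infinity[OF \<phi>2(1)]]
    by (simp add: power2_diff f1_def f2_def real_sqrt_mult)
  have isq: "integrable lborel (\<lambda>x. (sqrt (f1 x) - sqrt (f2 x))\<^sup>2)" unfolding sq using i by simp
  have "(\<integral>x. (sqrt (f1 x) - sqrt (f2 x))\<^sup>2 \<partial>lborel) = 2 - 2 * mass ?m"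
    unfolding sq using i \<phi>1'(2) \<phi>2(2) by (simp add: mass_def f1_def f2_def)
  moreover have "0 \<le> (\<integral>x. (sqrt (f1 x) - sqrt (f2 x))\<^sup>2 \<partial>lborel)" by (rule integral_nonneg_AE) simp
  ultimately have "(\<integral>x. (sqrt (f1 x) - sqrt (f2 x))\<^sup>2 \<partial>lborel) = 0" using J1 by linarith
  then have "AE x in lborel. (sqrt (f1 x) - sqrt (f2 x))\<^sup>2 = 0"
    using integral_nonneg_eq_0_iff_AE[OF isq] by simp
  then show ?thesis by eventually_elim (simp add: f1_def f2_def)
qed

lemma abs_exp_minus_one_le: "\<bar>exp u - 1\<bar> \<le> \<bar>u\<bar> * exp \<bar>u\<bar>" for u :: real
proof (cases "u \<ge> 0")
  case True
  have "1 - u \<le> exp (- u)" using exp_ge_add_one_self[of "-u"] by simp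
  then have "(1 - u) * exp u \<le> exp (- u) * exp u" by (intro mult_right_mono) auto
  then have "exp u - 1 \<le> u * exp u" by (simp add: algebra_simps exp_minus)
  then show ?thesis using True by simp
next
  case False
  then have "1 - exp u \<le> - u" using exp_ge_add_one_self[of u] by linarith
  also have "- u \<le> \<bar>u\<bar> * exp \<bar>u\<bar>"
    using False mult_left_mono[of 1 "exp \<bar>u\<bar>" "\<bar>u\<bar>"] by simp
  finally show ?thesis using False by simp
qed

text \<open>Tilting \<open>\<phi>\<close> by \<open>t x\<close> with small \<open>t\<close> of either sign must not increase the likelihood, and the
  derivatives at \<open>t = 0\<close> are the two means.\<close>

lemma maximiser_mean:
  assumes \<phi>: "maximises_loglik \<phi> Q" and Q: "real_distribution Q" and int: "integrable Q (\<lambda>x. x)"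
  shows "(\<integral>x. x * exp_of \<phi> x \<partial>lborel) = (\<integral>x. x \<partial>Q)"
proof -
  have \<phi>': "\<phi> \<in> Phi" "mass \<phi> = 1" "log_integrable \<phi> Q" using \<phi> by (auto simp: maximises_loglik_def)
  have max: "loglik \<theta> Q \<le> loglik \<phi> Q" if "\<theta> \<in> Phi" "mass \<theta> = 1" "log_integrable \<theta> Q" for \<theta>
    using \<phi> that by (simp add: maximises_loglik_def)
  obtain a b where b: "b > 0" and env: "\<And>x. \<phi> x \<le> ereal (a - b * \<bar>x\<bar>)"
    using Phi_envelope[OF \<phi>'(1)] by blast
  note [measurable] = exp_of_measurable[OF \<phi>'(1)]
  define f where "f = exp_of \<phi>"
  define J where "J t = mass (\<lambda>x. \<phi> x + ereal (0 + t * x))" for t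
  have tilt: "exp_of (\<lambda>x. \<phi> x + ereal (0 + t * x)) = (\<lambda>x. f x * exp (t * x))" for t
  proof
    fix x
    show "exp_of (\<lambda>x. \<phi> x + ereal (0 + t * x)) x = f x * exp (t * x)"
      using exp_of_tilt[where \<phi> = \<phi> and x = x and g = "\<lambda>x. 0 + t * x", OF Phi_not_infinity[OF \<phi>'(1)]]
      by (simp add: f_def)
  qed
  have Jt: "J t = (\<integral>x. f x * exp (t * x) \<partial>lborel)" for t
    unfolding J_def mass_def tilt ..
  have fint: "integrable lborel f" unfolding f_def by (rule exp_of_integrable[OF \<phi>'(1)])
  have f1: "(\<integral>x. f x \<partial>lborel) = 1" using \<phi>'(2) by (simp add: mass_def f_def)
  have ft: "integrable lborel (\<lambda>x. f x * exp (t * x))" if "\<bar>t\<bar> < b" for t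
  proof -
    have "integrable lborel (exp_of (\<lambda>x. \<phi> x + ereal (0 + t * x)))"
      by (rule exp_of_integrable[OF Phi_tilt[OF \<phi>'(1) env that]])
    then show ?thesis unfolding tilt .
  qed
  have ineq: "t * (\<integral>x. x \<partial>Q) \<le> J t - 1" if t: "\<bar>t\<bar> < b" for t
  proof -
    note T = Phi_tilt[OF \<phi>'(1) env t, of 0]
    have ti: "integrable Q (\<lambda>x. 0 + t * x)" using int by simp
    note F = log_integrable_tilt[OF \<phi>'(1) Q \<phi>'(3) ti]
    have Jpos: "J t > 0"
    proof (rule ccontr)
      assume "\<not> ?thesis"
      moreover have "J t \<ge> 0" unfolding J_def by (rule mass_nonneg)
      ultimately have "(\<integral>x. f x * exp (t * x) \<partial>lborel) = 0" using Jt by simp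
      then have "AE x in lborel. f x * exp (t * x) = 0"
        using integral_nonneg_eq_0_iff_AE[OF ft[OF t]] by (simp add: f_def)
      then have "AE x in lborel. f x = 0" by eventually_elim simp
      then have "(\<integral>x. f x \<partial>lborel) = 0" by (simp add: integral_eq_zero_AE)
      then show False using f1 by simp
    qed
    note N = Phi_normalise[OF T Jpos[unfolded J_def] Q F(1)]
    have "loglik (\<lambda>x. \<phi> x + ereal (0 + t * x)) Q - ln (J t) \<le> loglik \<phi> Q"
      using max[OF N(1) N(2) N(3)] unfolding N(4) J_def .
    then have "t * (\<integral>x. x \<partial>Q) \<le> ln (J t)" using F(2) by simp
    then show ?thesis using ln_le_minus_one[OF Jpos] by linarith
  qed
  \<comment> \<open>\<open>J\<close> is differentiable at zero with the mean as derivative; only the sequences \<open>c/(j+1)\<close> are needed,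
    with \<open>c\<close> small enough for an integrable dominating function.\<close>
  have lim: "(\<lambda>j. (J (c / real (Suc j)) - 1) / (c / real (Suc j))) \<longlonglongrightarrow> (\<integral>x. x * f x \<partial>lborel)"
    if c: "c \<noteq> 0" "\<bar>c\<bar> \<le> b / 2" for c
  proof -
    define t where "t j = c / real (Suc j)" for j
    have t0: "t j \<noteq> 0" for j using c by (simp add: t_def)
    have tb: "\<bar>t j\<bar> \<le> b / 2" for j
    proof -
      have "\<bar>c\<bar> / real (Suc j) \<le> \<bar>c\<bar> / 1" by (intro divide_left_mono) auto
      moreover have "\<bar>t j\<bar> = \<bar>c\<bar> / real (Suc j)" by (simp add: t_def del: of_nat_Suc)
      ultimately show ?thesis using c(2) by linarith
    qed
    have tl: "t \<longlonglongrightarrow> 0"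
      unfolding t_def by (rule LIMSEQ_Suc[OF lim_const_over_n])
    then have "filterlim t (at 0) sequentially" using t0 by (simp add: filterlim_at)
    have i: "integrable lborel (\<lambda>x. exp a * (\<bar>x\<bar> * exp (- ((b / 2) * \<bar>x\<bar>))))"
      using integrable_abs_exp_abs[of "b / 2"] b by simp
    have conv: "(\<lambda>j. \<integral>x. f x * ((exp (t j * x) - 1) / t j) \<partial>lborel) \<longlonglongrightarrow> (\<integral>x. f x * x \<partial>lborel)"
    proof (rule integral_dominated_convergence[OF _ _ i])
      show "AE x in lborel. (\<lambda>j. f x * ((exp (t j * x) - 1) / t j)) \<longlonglongrightarrow> f x * x"
      proof (intro AE_I2 tendsto_mult tendsto_const)
        fix x :: real
        have "((\<lambda>u. exp (u * x)) has_field_derivative x) (at 0)"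
          by (auto intro!: derivative_eq_intros)
        then have "((\<lambda>h. (exp (h * x) - 1) / h) \<longlongrightarrow> x) (at 0)"
          unfolding has_field_derivative_def DERIV_def by (simp add: field_has_derivative_at)
        then show "(\<lambda>j. (exp (t j * x) - 1) / t j) \<longlonglongrightarrow> x"
          using \<open>filterlim t (at 0) sequentially\<close> by (rule filterlim_compose)
      qed
      show "AE x in lborel. norm (f x * ((exp (t j * x) - 1) / t j)) \<le> exp a * (\<bar>x\<bar> * exp (- ((b / 2) * \<bar>x\<bar>)))" for j
      proof (intro AE_I2)
        fix x :: real
        have "f x \<le> exp (a - b * \<bar>x\<bar>)" unfolding f_def by (rule exp_of_le[OF env])
        moreover have "\<bar>(exp (t j * x) - 1) / t j\<bar> \<le> \<bar>x\<bar> * exp ((b / 2) * \<bar>x\<bar>)"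
        proof -
          have "\<bar>exp (t j * x) - 1\<bar> \<le> \<bar>t j * x\<bar> * exp \<bar>t j * x\<bar>" by (rule abs_exp_minus_one_le)
          then have "\<bar>(exp (t j * x) - 1) / t j\<bar> \<le> \<bar>x\<bar> * exp \<bar>t j * x\<bar>"
            using t0[of j] by (simp add: abs_mult field_simps)
          also have "\<dots> \<le> \<bar>x\<bar> * exp ((b / 2) * \<bar>x\<bar>)"
            using mult_right_mono[OF tb[of j], of "\<bar>x\<bar>"] by (intro mult_left_mono) (auto simp: abs_mult)
          finally show ?thesis .
        qed
        ultimately have "f x * \<bar>(exp (t j * x) - 1) / t j\<bar> \<le> exp (a - b * \<bar>x\<bar>) * (\<bar>x\<bar> * exp ((b / 2) * \<bar>x\<bar>))"
          by (intro mult_mono) auto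
        also have "\<dots> = exp (a - b * \<bar>x\<bar> + (b / 2) * \<bar>x\<bar>) * \<bar>x\<bar>" by (simp only: exp_add) (simp add: mult_ac)
        also have "a - b * \<bar>x\<bar> + (b / 2) * \<bar>x\<bar> = a + - ((b / 2) * \<bar>x\<bar>)" by (simp add: field_simps)
        also have "exp (a + - ((b / 2) * \<bar>x\<bar>)) * \<bar>x\<bar> = exp a * (\<bar>x\<bar> * exp (- ((b / 2) * \<bar>x\<bar>)))"
          by (simp only: exp_add) (simp add: mult_ac)
        finally show "norm (f x * ((exp (t j * x) - 1) / t j)) \<le> exp a * (\<bar>x\<bar> * exp (- ((b / 2) * \<bar>x\<bar>)))"
          by (simp add: abs_mult f_def)
      qed
    qed (auto simp: f_def)
    have eq: "(\<integral>x. f x * ((exp (t j * x) - 1) / t j) \<partial>lborel) = (J (t j) - 1) / t j" for j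
    proof -
      have tb': "\<bar>t j\<bar> < b" using tb[of j] b by linarith
      have "(\<integral>x. f x * ((exp (t j * x) - 1) / t j) \<partial>lborel) = (\<integral>x. (f x * exp (t j * x) - f x) / t j \<partial>lborel)"
        by (simp add: right_diff_distrib)
      also have "\<dots> = (J (t j) - 1) / t j" using ft[OF tb'] fint f1 by (simp add: Jt)
      finally show ?thesis .
    qed
    show ?thesis using conv[unfolded eq] unfolding t_def by (simp only: mult.commute)
  qed
  have "(\<integral>x. x \<partial>Q) \<le> (\<integral>x. x * f x \<partial>lborel)"
  proof (rule LIMSEQ_le_const[OF lim[of "b / 2"]])
    have "(\<integral>x. x \<partial>Q) \<le> (J (b / 2 / real (Suc j)) - 1) / (b / 2 / real (Suc j))" for j
    proof -
      have "b / 2 / real (Suc j) \<le> b / 2 / 1" using b by (intro divide_left_mono) auto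
      then have t: "b / 2 / real (Suc j) > 0" "b / 2 / real (Suc j) \<le> b / 2" using b by auto
      define u where "u = b / 2 / real (Suc j)"
      have u: "u > 0" "\<bar>u\<bar> < b" using t b unfolding u_def by linarith+
      have "u * (\<integral>x. x \<partial>Q) \<le> J u - 1" by (rule ineq[OF u(2)])
      then have "(\<integral>x. x \<partial>Q) \<le> (J u - 1) / u" using u(1) by (simp add: pos_le_divide_eq mult.commute)
      then show ?thesis by (simp add: u_def)
    qed
    then show "\<exists>N. \<forall>j\<ge>N. (\<integral>x. x \<partial>Q) \<le> (J (b / 2 / real (Suc j)) - 1) / (b / 2 / real (Suc j))" by blast
  qed (use b in auto)
  moreover have "(\<integral>x. x * f x \<partial>lborel) \<le> (\<integral>x. x \<partial>Q)"
  proof (rule LIMSEQ_le_const2[OF lim[of "- (b / 2)"]])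
    have "(J (- (b / 2) / real (Suc j)) - 1) / (- (b / 2) / real (Suc j)) \<le> (\<integral>x. x \<partial>Q)" for j
    proof -
      have "b / 2 / real (Suc j) \<le> b / 2 / 1" using b by (intro divide_left_mono) auto
      then have t: "b / 2 / real (Suc j) > 0" "b / 2 / real (Suc j) \<le> b / 2" using b by auto
      define u where "u = - (b / 2) / real (Suc j)"
      have "u = - (b / 2 / real (Suc j))" by (simp add: u_def)
      then have u: "u < 0" "\<bar>u\<bar> < b" using t b by linarith+
      have "u * (\<integral>x. x \<partial>Q) \<le> J u - 1" by (rule ineq[OF u(2)])
      then have "(J u - 1) / u \<le> (\<integral>x. x \<partial>Q)" using u(1) by (simp add: neg_divide_le_eq mult.commute)
      then show ?thesis by (simp add: u_def)
    qed
    then show "\<exists>N. \<forall>j\<ge>N. (J (- (b / 2) / real (Suc j)) - 1) / (- (b / 2) / real (Suc j)) \<le> (\<integral>x. x \<partial>Q)" by blast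
  qed (use b in auto)
  ultimately show ?thesis by (simp add: f_def)
qed

section \<open>Lower semicontinuity in mean distance\<close>

lemma log_integrable_lipschitz_majorant:
  assumes \<phi>: "\<phi> \<in> Phi" and env: "\<And>x. \<phi> x \<le> ereal (a - b * \<bar>x\<bar>)" and b: "0 < b" "b \<le> \<kappa>" and z: "\<phi> z \<noteq> -\<infinity>"
    and int: "integrable Q (\<lambda>x. x)" and Q: "real_distribution Q"
  shows "log_integrable (lipschitz_majorant \<kappa> \<phi>) Q" "lipschitz_majorant \<kappa> \<phi> x \<noteq> -\<infinity>"
proof -
  interpret real_distribution Q by fact
  let ?M = "lipschitz_majorant \<kappa> \<phi>"
  have M: "?M \<in> Phi" by (rule Phi_lipschitz_majorant[OF \<phi> env b])
  note [measurable] = Phi_measurable[OF M]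
  have "?M z \<noteq> -\<infinity>" using z lipschitz_majorant_ge[of \<phi> z \<kappa>] by auto
  then obtain w where w: "?M z = ereal w" using Phi_not_infinity[OF M, of z] by (metis ereal_cases)
  have real: "?M x \<noteq> -\<infinity> \<and> w - \<kappa> * \<bar>z - x\<bar> \<le> real_of_ereal (?M x) \<and> real_of_ereal (?M x) \<le> a" for x
  proof -
    have 1: "ereal w \<le> ?M x + ereal (\<kappa> * \<bar>z - x\<bar>)"
      using lipschitz_majorant_lipschitz[of \<kappa> \<phi> z x] b w by simp
    have 2: "?M x \<le> ereal (a - b * \<bar>x\<bar>)" by (rule lipschitz_majorant_le[OF env b])
    have "b * \<bar>x\<bar> \<ge> 0" using b by simp
    then show ?thesis using 1 2 by (cases "?M x") auto
  qed
  then show "?M x \<noteq> -\<infinity>" by blast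
  have "integrable Q (\<lambda>x. \<bar>a\<bar> + \<bar>w\<bar> + \<kappa> * \<bar>z - x\<bar>)" using int by simp
  then have "integrable Q (\<lambda>x. real_of_ereal (?M x))"
  proof (rule Bochner_Integration.integrable_bound)
    show "AE x in Q. norm (real_of_ereal (?M x)) \<le> norm (\<bar>a\<bar> + \<bar>w\<bar> + \<kappa> * \<bar>z - x\<bar>)"
    proof (intro AE_I2)
      fix x
      have "0 \<le> \<kappa> * \<bar>z - x\<bar>" using b by simp
      then show "norm (real_of_ereal (?M x)) \<le> norm (\<bar>a\<bar> + \<bar>w\<bar> + \<kappa> * \<bar>z - x\<bar>)"
        using real[of x] unfolding real_norm_def by linarith
    qed
  qed measurable
  then show "log_integrable ?M Q" using real by (simp add: log_integrable_def)
qed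

text \<open>Replacing \<open>\<phi>\<close> by its Lipschitz majorant costs little mass when the Lipschitz constant is large,
  and moves to nearby distributions at a cost proportional to their mean distance.\<close>

lemma loglik_lsc:
  assumes \<Omega>: "prob_space \<Omega>" and Y: "\<And>k. integrable \<Omega> (Y k)" "integrable \<Omega> Y0"
    and lim: "(\<lambda>k. \<integral>\<omega>. \<bar>Y k \<omega> - Y0 \<omega>\<bar> \<partial>\<Omega>) \<longlonglongrightarrow> 0"
    and \<phi>: "\<phi> \<in> Phi" "mass \<phi> = 1" "log_integrable \<phi> (distr \<Omega> borel Y0)" and e: "e > 0"
  shows "\<forall>\<^sub>F k in sequentially. \<exists>\<theta>\<in>Phi. mass \<theta> = 1 \<and> log_integrable \<theta> (distr \<Omega> borel (Y k)) \<and>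
    loglik \<phi> (distr \<Omega> borel Y0) - e \<le> loglik \<theta> (distr \<Omega> borel (Y k))"
proof -
  interpret prob_space \<Omega> by fact
  note m = borel_measurable_integrable[OF Y(1)] borel_measurable_integrable[OF Y(2)]
  note [measurable] = m
  obtain a b where b: "b > 0" and env: "\<And>x. \<phi> x \<le> ereal (a - b * \<bar>x\<bar>)"
    using Phi_envelope[OF \<phi>(1)] by blast
  have ae: "AE \<omega> in \<Omega>. \<phi> (Y0 \<omega>) \<noteq> -\<infinity>" and pint: "integrable \<Omega> (\<lambda>\<omega>. real_of_ereal (\<phi> (Y0 \<omega>)))"
    using \<phi>(3) unfolding log_integrable_distr(1)[OF \<phi>(1) m(2)] by auto
  obtain z where z: "\<phi> z \<noteq> -\<infinity>" using eventually_happens'[OF ae_filter_bot ae] by blast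
  have "(\<lambda>j. mass (lipschitz_majorant (b + real j) \<phi>)) \<longlonglongrightarrow> 1"
    using mass_lipschitz_majorant_tendsto[OF \<phi>(1) env b] \<phi>(2) by simp
  then have "\<forall>\<^sub>F j in sequentially. mass (lipschitz_majorant (b + real j) \<phi>) < exp (e / 2)"
    by (rule order_tendstoD(2)) (use e in simp)
  then obtain j where j: "mass (lipschitz_majorant (b + real j) \<phi>) < exp (e / 2)"
    by (auto simp: eventually_sequentially)
  define \<kappa> where "\<kappa> = b + real j"
  have \<kappa>: "b \<le> \<kappa>" "\<kappa> > 0" using b by (auto simp: \<kappa>_def)
  let ?M = "lipschitz_majorant \<kappa> \<phi>"
  have M: "?M \<in> Phi" by (rule Phi_lipschitz_majorant[OF \<phi>(1) env b \<kappa>(1)])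
  have "mass \<phi> \<le> mass ?M"
    unfolding mass_def
  proof (rule integral_mono)
    show "exp_of \<phi> x \<le> exp_of ?M x" for x
      using lipschitz_majorant_ge[of \<phi> x \<kappa>] Phi_not_infinity[OF M, of x]
      by (cases "\<phi> x"; cases "?M x") (auto simp: exp_of_def)
  qed (use exp_of_integrable \<phi> M in blast)+
  then have Jpos: "mass ?M > 0" using \<phi>(2) by simp
  have "ln (mass ?M) \<le> ln (exp (e / 2))"
    using j Jpos by (subst ln_le_cancel_iff) (auto simp: \<kappa>_def)
  then have Jln: "ln (mass ?M) \<le> e / 2" by simp
  have "\<forall>\<^sub>F k in sequentially. (\<integral>\<omega>. \<bar>Y k \<omega> - Y0 \<omega>\<bar> \<partial>\<Omega>) < e / (2 * \<kappa>)"
    by (rule order_tendstoD(2)[OF lim]) (use e \<kappa> in simp)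
  then show ?thesis
  proof eventually_elim
    case (elim k)
    have Qk: "real_distribution (distr \<Omega> borel (Y k))" by (rule real_distribution_distr[OF m(1)])
    have intk: "integrable (distr \<Omega> borel (Y k)) (\<lambda>x. x)" using Y(1)[of k] by (simp add: integrable_distr_eq)
    note LI = log_integrable_lipschitz_majorant[OF \<phi>(1) env b \<kappa>(1) z intk Qk]
    note N = Phi_normalise[OF M Jpos Qk LI(1)]
    have Mint: "integrable \<Omega> (\<lambda>\<omega>. real_of_ereal (?M (Y k \<omega>)))"
      using LI(1) unfolding log_integrable_distr(1)[OF M m(1)] by blast
    have "(\<integral>\<omega>. real_of_ereal (\<phi> (Y0 \<omega>)) \<partial>\<Omega>) \<le> (\<integral>\<omega>. real_of_ereal (?M (Y k \<omega>)) + \<kappa> * \<bar>Y k \<omega> - Y0 \<omega>\<bar> \<partial>\<Omega>)"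
    proof (rule integral_mono_AE)
      show "AE \<omega> in \<Omega>. real_of_ereal (\<phi> (Y0 \<omega>)) \<le> real_of_ereal (?M (Y k \<omega>)) + \<kappa> * \<bar>Y k \<omega> - Y0 \<omega>\<bar>"
        using ae
      proof eventually_elim
        case (elim \<omega>)
        have "\<phi> (Y0 \<omega>) \<le> ?M (Y k \<omega>) + ereal (\<kappa> * \<bar>Y0 \<omega> - Y k \<omega>\<bar>)"
          using lipschitz_majorant_ge[of \<phi> "Y0 \<omega>" \<kappa>] lipschitz_majorant_lipschitz[of \<kappa> \<phi> "Y0 \<omega>" "Y k \<omega>"] \<kappa>
          by (meson less_imp_le order_trans)
        then show ?case
          using elim LI(2)[of "Y k \<omega>"] Phi_not_infinity[OF M, of "Y k \<omega>"]
          by (cases "\<phi> (Y0 \<omega>)"; cases "?M (Y k \<omega>)") (auto simp: abs_minus_commute)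
      qed
    qed (use pint Mint Y in auto)
    also have "\<dots> = loglik ?M (distr \<Omega> borel (Y k)) + \<kappa> * (\<integral>\<omega>. \<bar>Y k \<omega> - Y0 \<omega>\<bar> \<partial>\<Omega>)"
      using Mint Y unfolding log_integrable_distr(2)[OF M m(1)] by simp
    finally have "loglik \<phi> (distr \<Omega> borel Y0) \<le> loglik ?M (distr \<Omega> borel (Y k)) + \<kappa> * (\<integral>\<omega>. \<bar>Y k \<omega> - Y0 \<omega>\<bar> \<partial>\<Omega>)"
      unfolding log_integrable_distr(2)[OF \<phi>(1) m(2)] .
    moreover have "\<kappa> * (\<integral>\<omega>. \<bar>Y k \<omega> - Y0 \<omega>\<bar> \<partial>\<Omega>) \<le> e / 2"
      using elim \<kappa> by (simp add: field_simps)
    ultimately have "loglik \<phi> (distr \<Omega> borel Y0) - e \<le> loglik ?M (distr \<Omega> borel (Y k)) - ln (mass ?M)"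
      using Jln by linarith
    then show ?case using N by (metis (no_types, lifting))
  qed
qed

text \<open>Skorohod's representation turns weak into almost sure convergence, and Scheffe's lemma uses the
  convergence of the mean absolute values.\<close>

lemma mean_coupling:
  assumes Qn: "\<And>k. real_distribution (Qn k)" and Q: "real_distribution Q" and w: "weak_conv_m Qn Q"
    and int: "\<And>k. integrable (Qn k) (\<lambda>x. x)" "integrable Q (\<lambda>x. x)"
    and m: "(\<lambda>k. \<integral>x. \<bar>x\<bar> \<partial>Qn k) \<longlonglongrightarrow> (\<integral>x. \<bar>x\<bar> \<partial>Q)"
  shows "\<exists>(\<Omega> :: real measure) Y Y0. prob_space \<Omega> \<and> (\<forall>k. integrable \<Omega> (Y k)) \<and> integrable \<Omega> Y0 \<and>
    (\<forall>k. distr \<Omega> borel (Y k) = Qn k) \<and> distr \<Omega> borel Y0 = Q \<and>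
    (AE \<omega> in \<Omega>. (\<lambda>k. Y k \<omega>) \<longlonglongrightarrow> Y0 \<omega>) \<and> (\<lambda>k. \<integral>\<omega>. \<bar>Y k \<omega> - Y0 \<omega>\<bar> \<partial>\<Omega>) \<longlonglongrightarrow> 0"
proof -
  obtain \<Omega> :: "real measure" and Y Y0 where \<Omega>: "prob_space \<Omega>" and Y: "\<And>k. Y k \<in> measurable \<Omega> borel"
    "\<And>k. distr \<Omega> borel (Y k) = Qn k" and Y0: "Y0 \<in> measurable \<Omega> lborel" "distr \<Omega> borel Y0 = Q"
    and lim: "\<And>x. x \<in> space \<Omega> \<Longrightarrow> (\<lambda>k. Y k x) \<longlonglongrightarrow> Y0 x"
    using Skorohod[OF Qn Q w] by blast
  have Y0m: "Y0 \<in> measurable \<Omega> borel" using Y0(1) by simp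
  have iY: "integrable \<Omega> (Y k)" for k using int(1)[of k] unfolding Y(2)[symmetric] by (subst (asm) integrable_distr_eq) (use Y in auto)
  have iY0: "integrable \<Omega> Y0" using int(2) unfolding Y0(2)[symmetric] by (subst (asm) integrable_distr_eq) (use Y0m in auto)
  have aY: "(\<integral>\<^sup>+\<omega>. norm (Y k \<omega>) \<partial>\<Omega>) = ennreal (\<integral>x. \<bar>x\<bar> \<partial>Qn k)" for k
    unfolding Y(2)[symmetric] by (subst integral_distr) (use Y iY[of k] in \<open>auto simp: nn_integral_eq_integral\<close>)
  have aY0: "(\<integral>\<^sup>+\<omega>. norm (Y0 \<omega>) \<partial>\<Omega>) = ennreal (\<integral>x. \<bar>x\<bar> \<partial>Q)"
    unfolding Y0(2)[symmetric] by (subst integral_distr) (use Y0m iY0 in \<open>auto simp: nn_integral_eq_integral\<close>)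
  have ae: "AE \<omega> in \<Omega>. (\<lambda>k. Y k \<omega>) \<longlonglongrightarrow> Y0 \<omega>" using lim by (intro AE_I2) auto
  have "(\<lambda>k. ennreal (\<integral>x. \<bar>x\<bar> \<partial>Qn k)) \<longlonglongrightarrow> ennreal (\<integral>x. \<bar>x\<bar> \<partial>Q)" using m by (rule tendsto_ennrealI)
  then have "limsup (\<lambda>k. \<integral>\<^sup>+\<omega>. norm (Y k \<omega>) \<partial>\<Omega>) \<le> (\<integral>\<^sup>+\<omega>. norm (Y0 \<omega>) \<partial>\<Omega>)"
    unfolding aY aY0 using lim_imp_Limsup[OF sequentially_bot] by (metis order_refl)
  from Scheffe_lemma1[OF iY iY0 ae this]
  have "(\<lambda>k. \<integral>\<^sup>+\<omega>. norm (Y k \<omega> - Y0 \<omega>) \<partial>\<Omega>) \<longlonglongrightarrow> 0" .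
  also have "(\<lambda>k. \<integral>\<^sup>+\<omega>. norm (Y k \<omega> - Y0 \<omega>) \<partial>\<Omega>) = (\<lambda>k. ennreal (\<integral>\<omega>. \<bar>Y k \<omega> - Y0 \<omega>\<bar> \<partial>\<Omega>))"
    by (intro ext) (use iY iY0 in \<open>simp add: nn_integral_eq_integral\<close>)
  finally have "(\<lambda>k. \<integral>\<omega>. \<bar>Y k \<omega> - Y0 \<omega>\<bar> \<partial>\<Omega>) \<longlonglongrightarrow> 0"
    by (subst (asm) ennreal_0[symmetric], subst (asm) tendsto_ennreal_iff) auto
  then show ?thesis using \<Omega> iY iY0 Y Y0 ae by blast
qed

section \<open>Empirical distributions\<close>

lemma uniform_measurable [measurable]: "v \<in> borel_measurable (uniform_count_measure A)" for v :: "'a \<Rightarrow> real"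
  by (auto simp: measurable_def sets_uniform_count_measure space_uniform_count_measure)

lemma prob_space_uniform: "n \<ge> 1 \<Longrightarrow> prob_space (uniform_count_measure {1..n})" for n :: nat
  by (rule prob_space_uniform_count_measure) auto

lemma integrable_uniform: "finite A \<Longrightarrow> integrable (uniform_count_measure A) f" for f :: "'a \<Rightarrow> real"
  unfolding uniform_count_measure_def by (rule integrable_point_measure_finite)

lemma AE_uniform: "finite A \<Longrightarrow> (AE i in uniform_count_measure A. P i) \<longleftrightarrow> (\<forall>i\<in>A. P i)"
  unfolding uniform_count_measure_def by (subst AE_point_measure) (auto simp: card_gt_0_iff)

lemma real_distribution_empirical: "n \<ge> 1 \<Longrightarrow> real_distribution (empirical n v)"
  unfolding empirical_def by (rule prob_space.real_distribution_distr[OF prob_space_uniform]) measurable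

lemma integral_empirical:
  "g \<in> borel_measurable borel \<Longrightarrow> (\<integral>x. g x \<partial>empirical n v) = (1 / real n) * (\<Sum>i=1..n. g (v i))"
  unfolding empirical_def by (subst integral_distr) (auto simp: integral_uniform_count_measure uniform_measurable)

lemma integrable_empirical: "g \<in> borel_measurable borel \<Longrightarrow> integrable (empirical n v) g" for g :: "real \<Rightarrow> real"
  unfolding empirical_def by (subst integrable_distr_eq) (auto simp: integrable_uniform uniform_measurable)

lemma empirical_cong: "(\<And>i. i \<in> {1..n} \<Longrightarrow> v i = w i) \<Longrightarrow> empirical n v = empirical n w"
  unfolding empirical_def by (rule distr_cong) (auto simp: space_uniform_count_measure)

lemma log_integrable_empirical:
  "\<phi> \<in> Phi \<Longrightarrow> log_integrable \<phi> (empirical n v) \<longleftrightarrow> (\<forall>i\<in>{1..n}. \<phi> (v i) \<noteq> -\<infinity>)"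
  unfolding empirical_def by (subst log_integrable_distr) (auto simp: AE_uniform integrable_uniform uniform_measurable)

lemma loglik_empirical:
  "\<phi> \<in> Phi \<Longrightarrow> loglik \<phi> (empirical n v) = (1 / real n) * (\<Sum>i=1..n. real_of_ereal (\<phi> (v i)))"
  unfolding loglik_def by (rule integral_empirical) (use Phi_measurable in measurable)

lemma mean_abs_empirical: "mean_abs n v = (\<integral>x. \<bar>x\<bar> \<partial>empirical n v)"
  unfolding mean_abs_def by (subst integral_empirical) auto

lemma shift_empirical:
  assumes \<phi>: "\<phi> \<in> Phi"
  shows "log_integrable (\<lambda>t. \<phi> (t + c)) (empirical n v) \<longleftrightarrow> log_integrable \<phi> (empirical n (\<lambda>i. v i + c))"
    and "loglik (\<lambda>t. \<phi> (t + c)) (empirical n v) = loglik \<phi> (empirical n (\<lambda>i. v i + c))"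
  using log_integrable_empirical[OF Phi_shift[OF \<phi>, of c], of n v] log_integrable_empirical[OF \<phi>, of n "\<lambda>i. v i + c"]
    loglik_empirical[OF Phi_shift[OF \<phi>, of c], of n v] loglik_empirical[OF \<phi>, of n "\<lambda>i. v i + c"] by simp_all

lemma spread_empirical:
  assumes n: "n \<ge> 1" and ij: "i \<in> {1..n}" "j \<in> {1..n}" "v i \<noteq> v j"
  shows "\<exists>s>0. spread_at_least s (empirical n v)"
proof -
  have "min 1 \<bar>v i - v j\<bar> / real n \<le> (\<integral>x. min 1 \<bar>x - x0\<bar> \<partial>empirical n v)" for x0
  proof -
    have "(\<Sum>k\<in>{i, j}. min 1 \<bar>v k - x0\<bar>) \<le> (\<Sum>k=1..n. min 1 \<bar>v k - x0\<bar>)"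
      by (rule sum_mono2) (use ij in auto)
    moreover have "(\<Sum>k\<in>{i, j}. min 1 \<bar>v k - x0\<bar>) = min 1 \<bar>v i - x0\<bar> + min 1 \<bar>v j - x0\<bar>"
      using ij(3) by (subst sum.insert) auto
    moreover have "min 1 \<bar>v i - v j\<bar> \<le> min 1 \<bar>v i - x0\<bar> + min 1 \<bar>v j - x0\<bar>" by linarith
    ultimately have "min 1 \<bar>v i - v j\<bar> \<le> (\<Sum>k=1..n. min 1 \<bar>v k - x0\<bar>)" by linarith
    then show ?thesis using n by (subst integral_empirical) (auto simp: divide_right_mono)
  qed
  then show ?thesis using ij n by (intro exI[of _ "min 1 \<bar>v i - v j\<bar> / real n"]) (auto simp: spread_at_least_def)
qed

section \<open>The maximum likelihood estimator\<close>

text \<open>Invariance of the fitted vectors under constants, stated on the design points because nothing else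
  of a regression function is visible to the likelihood.\<close>

definition shift_invariant :: "nat \<Rightarrow> (nat \<Rightarrow> 'a) \<Rightarrow> ('a \<Rightarrow> real) set \<Rightarrow> bool" where
  "shift_invariant n x M \<longleftrightarrow> (\<forall>m\<in>M. \<forall>c. \<exists>m'\<in>M. \<forall>i\<in>{1..n}. m' (x i) = m (x i) + c)"

lemma shift_invariantD:
  "shift_invariant n x M \<Longrightarrow> m \<in> M \<Longrightarrow> \<exists>m'\<in>M. \<forall>i\<in>{1..n}. m' (x i) = m (x i) + c"
  by (simp add: shift_invariant_def)

text \<open>Since shifting a density and the regression function together leaves the likelihood unchanged,
  the constraint of mean zero only normalises: a maximiser under the constraints is one without
  them.\<close>

lemma is_mle_maximises:
  assumes n: "n \<ge> 1" and shift: "shift_invariant n x M"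
    and mle: "is_mle n x M y (\<phi>, m)"
  shows "m \<in> M" "maximises_loglik \<phi> (empirical n (\<lambda>i. y i - m (x i)))"
    "(\<integral>t. t * exp_of \<phi> t \<partial>lborel) = 0"
    "\<And>m' \<theta>. m' \<in> M \<Longrightarrow> \<theta> \<in> Phi \<Longrightarrow> mass \<theta> = 1 \<Longrightarrow> log_integrable \<theta> (empirical n (\<lambda>i. y i - m' (x i)))
      \<Longrightarrow> loglik \<theta> (empirical n (\<lambda>i. y i - m' (x i))) \<le> loglik \<phi> (empirical n (\<lambda>i. y i - m (x i)))"
proof -
  let ?Q = "\<lambda>m. empirical n (\<lambda>i. y i - m (x i))"
  note rd = real_distribution_empirical[OF n]
  have mM: "m \<in> M" and \<phi>: "\<phi> \<in> Phi" and J: "(\<integral>\<^sup>+t. ennreal (exp_of \<phi> t) \<partial>lborel) = 1"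
    and mean: "(\<integral>t. t * exp_of \<phi> t \<partial>lborel) = 0"
    using mle unfolding is_mle_def is_arg_max_def by auto
  have J1: "mass \<phi> = 1" using J mass_eq_1_iff[OF \<phi>] by simp
  have opt: "L \<theta> (?Q m') \<le> L \<phi> (?Q m)"
    if "\<theta> \<in> Phi" "m' \<in> M" "mass \<theta> = 1" "(\<integral>t. t * exp_of \<theta> t \<partial>lborel) = 0" for \<theta> m'
    using mle that mass_eq_1_iff[OF that(1)] unfolding is_mle_def is_arg_max_def by (auto simp: not_less)
  have key: "ereal (loglik \<theta> (?Q m')) \<le> L \<phi> (?Q m)"
    if m': "m' \<in> M" and \<theta>: "\<theta> \<in> Phi" "mass \<theta> = 1" "log_integrable \<theta> (?Q m')" for m' \<theta>
  proof -
    define c where "c = (\<integral>t. t * exp_of \<theta> t \<partial>lborel)"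
    obtain m'' where m'': "m'' \<in> M" "\<And>i. i \<in> {1..n} \<Longrightarrow> m'' (x i) = m' (x i) + c" using shift_invariantD[OF shift m'] by blast
    have Q: "?Q m'' = empirical n (\<lambda>i. y i - m' (x i) - c)" by (rule empirical_cong) (simp add: m''(2))
    have Q': "?Q m' = empirical n (\<lambda>i. y i - m' (x i) - c + c)" by simp
    have \<theta>c: "(\<lambda>t. \<theta> (t + c)) \<in> Phi" by (rule Phi_shift[OF \<theta>(1)])
    have f: "log_integrable (\<lambda>t. \<theta> (t + c)) (?Q m'')" "loglik (\<lambda>t. \<theta> (t + c)) (?Q m'') = loglik \<theta> (?Q m')"
      using shift_empirical[OF \<theta>(1), of c n "\<lambda>i. y i - m' (x i) - c"] \<theta>(3) unfolding Q Q' by auto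
    have "L (\<lambda>t. \<theta> (t + c)) (?Q m'') \<le> L \<phi> (?Q m)"
      using \<theta>(2) mean_shift[OF \<theta>(1), of c] mass_shift[of \<theta> c]
      by (intro opt[OF \<theta>c m''(1)]) (auto simp: c_def)
    then show ?thesis using L_log_integrable[OF \<theta>c rd f(1)] f(2) mass_shift[of \<theta> c] \<theta>(2) by simp
  qed
  obtain \<theta> where \<theta>: "\<theta> \<in> Phi" "mass \<theta> = 1" "log_integrable \<theta> (?Q m)"
    using log_integrable_exists[OF rd integrable_empirical] by auto
  have fin: "log_integrable \<phi> (?Q m)" using key[OF mM \<theta>] L_not_log_integrable[OF \<phi> rd] by force
  have L\<phi>: "L \<phi> (?Q m) = ereal (loglik \<phi> (?Q m))" using L_log_integrable[OF \<phi> rd fin] J1 by simp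
  show "m \<in> M" by fact
  show "(\<integral>t. t * exp_of \<phi> t \<partial>lborel) = 0" by fact
  show best: "loglik \<theta> (?Q m') \<le> loglik \<phi> (?Q m)"
    if "m' \<in> M" "\<theta> \<in> Phi" "mass \<theta> = 1" "log_integrable \<theta> (?Q m')" for m' \<theta>
    using key[OF that] L\<phi> by simp
  show "maximises_loglik \<phi> (?Q m)"
    unfolding maximises_loglik_def using \<phi> J1 fin best[OF mM] by blast
qed

text \<open>The density of the estimator has mean zero, hence so have the residuals, and the likelihood controls
  their size.\<close>

lemma is_mle_centred:
  assumes n: "n \<ge> 1" and shift: "shift_invariant n x M"
    and mle: "is_mle n x M y (\<phi>, m)"
  shows "mean_abs n (\<lambda>i. y i - m (x i)) \<le> 4 * exp (2 - loglik \<phi> (empirical n (\<lambda>i. y i - m (x i))))"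
proof -
  let ?Q = "empirical n (\<lambda>i. y i - m (x i))"
  note F = is_mle_maximises[OF n shift mle]
  have int: "integrable ?Q (\<lambda>x. x)" by (rule integrable_empirical) simp
  have \<phi>: "\<phi> \<in> Phi" "mass \<phi> = 1" "log_integrable \<phi> ?Q" using F(2) by (auto simp: maximises_loglik_def)
  have "(\<integral>x. x \<partial>?Q) = 0" using maximiser_mean[OF F(2) real_distribution_empirical[OF n] int] F(3) by simp
  then show ?thesis
    unfolding mean_abs_empirical using \<phi>
    by (intro abs_mean_le_loglik[OF _ _ real_distribution_empirical[OF n] _ int]) auto
qed

lemma bounded_sequence_convergent_subsequence:
  fixes v :: "nat \<Rightarrow> nat \<Rightarrow> real"
  assumes "\<And>k i. i \<in> I \<Longrightarrow> \<bar>v k i\<bar> \<le> B"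
  shows "\<exists>r. strict_mono (r :: nat \<Rightarrow> nat) \<and> (\<forall>i\<in>I. convergent (\<lambda>k. v (r k) i))"
proof -
  define D where "D i s \<longleftrightarrow> (i \<in> I \<longrightarrow> convergent (\<lambda>k. v (s k) i))" for i and s :: "nat \<Rightarrow> nat"
  interpret subseqs D
  proof
    fix i and s :: "nat \<Rightarrow> nat" assume "strict_mono s"
    show "\<exists>r'. strict_mono r' \<and> D i (s \<circ> r')"
    proof (cases "i \<in> I")
      case True
      have "bounded (range (\<lambda>k. v (s k) i))"
        unfolding bounded_iff using assms[OF True] by (intro exI[of _ B]) auto
      then obtain l r' where "strict_mono (r' :: nat \<Rightarrow> nat)" "((\<lambda>k. v (s k) i) \<circ> r') \<longlonglongrightarrow> l"
        using bounded_imp_convergent_subsequence by blast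
      then show ?thesis by (auto simp: D_def o_def convergent_def)
    next
      case False
      then show ?thesis by (auto simp: D_def intro: exI[of _ id] strict_mono_id)
    qed
  qed
  have "convergent (\<lambda>k. v (diagseq k) i)" if i: "i \<in> I" for i
  proof -
    have "D i (diagseq \<circ> ((+) (Suc i)))"
    proof (rule diagseq_holds)
      fix r s :: "nat \<Rightarrow> nat" and n assume "strict_mono r" "D n s"
      then show "D n (s \<circ> r)"
        unfolding D_def using convergent_subseq_convergent[of "\<lambda>k. v (s k) n" r] by (simp add: o_def)
    qed
    then have "convergent (\<lambda>k. v (diagseq (k + Suc i)) i)" using i by (simp add: D_def o_def add.commute)
    then show ?thesis using convergent_ignore_initial_segment[of "\<lambda>k. v (diagseq k) i" "Suc i"] by simp
  qed
  then show ?thesis using subseq_diagseq by blast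
qed

lemma design_limit:
  assumes closed: "closedin (powertop_real {1..n}) ((\<lambda>m. \<lambda>i\<in>{1..n}. m (x i)) ` M)"
    and ms: "\<And>k. ms k \<in> M" and lim: "\<And>i. i \<in> {1..n} \<Longrightarrow> (\<lambda>k. ms k (x i)) \<longlonglongrightarrow> v i"
  shows "\<exists>m\<in>M. \<forall>i\<in>{1..n::nat}. m (x i) = v i"
proof -
  have "limitin (powertop_real {1..n}) (\<lambda>k. \<lambda>i\<in>{1..n}. ms k (x i)) (\<lambda>i\<in>{1..n}. v i) sequentially"
    unfolding limitin_componentwise using lim by auto
  then have "(\<lambda>i\<in>{1..n}. v i) \<in> (\<lambda>m. \<lambda>i\<in>{1..n}. m (x i)) ` M"
    by (rule limitin_closedin[OF _ closed]) (use ms in auto)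
  then obtain m where m: "m \<in> M" "(\<lambda>i\<in>{1..n}. v i) = (\<lambda>i\<in>{1..n}. m (x i))" by blast
  have "m (x i) = v i" if "i \<in> {1..n}" for i using fun_cong[OF m(2), of i] that by simp
  then show ?thesis using m(1) by blast
qed

text \<open>Along a sequence of pairs whose likelihood approaches the supremum, recentring the residuals keeps
  them bounded. The limit is a pair of the same kind, unless the data can be fitted exactly, when
  the likelihood is unbounded.\<close>

lemma is_mle_exists:
  assumes n: "n \<ge> 1" and shift: "shift_invariant n x M"
    and closed: "closedin (powertop_real {1..n}) ((\<lambda>m. \<lambda>i\<in>{1..n}. m (x i)) ` M)"
    and ne: "M \<noteq> {}" and nofit: "\<not> (\<exists>m\<in>M. \<forall>i\<in>{1..n}. m (x i) = y i)"
  shows "\<exists>\<theta>. is_mle n x M y \<theta>"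
proof -
  let ?Q = "\<lambda>m. empirical n (\<lambda>i. y i - m (x i))"
  note rd = real_distribution_empirical[OF n]
  have int: "integrable (?Q m) (\<lambda>x. x)" for m by (rule integrable_empirical) simp
  define G where "G \<theta> m \<longleftrightarrow> \<theta> \<in> Phi \<and> mass \<theta> = 1 \<and> m \<in> M \<and> log_integrable \<theta> (?Q m) \<and> (\<integral>x. x \<partial>?Q m) = 0" for \<theta> m
  define S where "S = {loglik \<theta> (?Q m) | \<theta> m. G \<theta> m}"
  have recentre: "loglik \<theta> (?Q m) \<in> S" if \<theta>: "\<theta> \<in> Phi" "mass \<theta> = 1" "log_integrable \<theta> (?Q m)" and m: "m \<in> M" for \<theta> m
  proof -
    define c where "c = (\<integral>x. x \<partial>?Q m)"
    obtain m' where m': "m' \<in> M" "\<And>i. i \<in> {1..n} \<Longrightarrow> m' (x i) = m (x i) + c" using shift_invariantD[OF shift m] by blast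
    have Q: "?Q m' = empirical n (\<lambda>i. y i - m (x i) - c)" by (rule empirical_cong) (simp add: m'(2))
    have Q': "?Q m = empirical n (\<lambda>i. y i - m (x i) - c + c)" by simp
    have f: "log_integrable (\<lambda>t. \<theta> (t + c)) (?Q m')" "loglik (\<lambda>t. \<theta> (t + c)) (?Q m') = loglik \<theta> (?Q m)"
      using shift_empirical[OF \<theta>(1), of c n "\<lambda>i. y i - m (x i) - c"] \<theta>(3) unfolding Q Q' by auto
    have "(\<integral>x. x \<partial>?Q m') = c - c"
      unfolding Q c_def using n by (subst integral_empirical, simp)+ (simp add: sum_subtractf diff_divide_distrib)
    then have "G (\<lambda>t. \<theta> (t + c)) m'"
      using Phi_shift[OF \<theta>(1)] mass_shift[of \<theta> c] \<theta>(2) m'(1) f(1) by (simp add: G_def)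
    then show ?thesis unfolding S_def using f(2)[symmetric] by blast
  qed
  \<comment> \<open>High likelihood means small centred residuals; as \<open>v\<close> grows the bound tends to zero.\<close>
  have bound: "\<bar>y i - m (x i)\<bar> \<le> real n * (4 * exp (2 - v))" if G: "G \<theta> m" and v: "v \<le> loglik \<theta> (?Q m)" and i: "i \<in> {1..n}" for \<theta> m v i
  proof -
    have "\<bar>y i - m (x i)\<bar> \<le> (\<Sum>i=1..n. \<bar>y i - m (x i)\<bar>)" by (rule member_le_sum) (use i in auto)
    also have "\<dots> = real n * mean_abs n (\<lambda>i. y i - m (x i))" using n by (simp add: mean_abs_def)
    also have "\<dots> \<le> real n * (4 * exp (2 - loglik \<theta> (?Q m)))"
      unfolding mean_abs_empirical using G
      by (intro mult_left_mono abs_mean_le_loglik[OF _ _ rd _ int]) (auto simp: G_def)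
    also have "\<dots> \<le> real n * (4 * exp (2 - v))" using v by (intro mult_left_mono) auto
    finally show ?thesis .
  qed
  obtain m0 where "m0 \<in> M" using ne by blast
  then have Sne: "S \<noteq> {}" using log_integrable_exists[OF rd int[of m0]] recentre by blast
  have bdd: "bdd_above S"
  proof (rule ccontr)
    assume nb: "\<not> bdd_above S"
    have "\<exists>\<theta> m. G \<theta> m \<and> real k \<le> loglik \<theta> (?Q m)" for k
    proof -
      obtain v where "v \<in> S" "real k < v" using nb unfolding bdd_above_def by (meson not_le)
      then show ?thesis unfolding S_def by (auto intro: less_imp_le)
    qed
    then obtain \<theta>s ms where G: "\<And>k. G (\<theta>s k) (ms k)" and big: "\<And>k. real k \<le> loglik (\<theta>s k) (?Q (ms k))" by metis
    have "\<exists>m\<in>M. \<forall>i\<in>{1..n}. m (x i) = y i"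
    proof (rule design_limit[OF closed])
      show "ms k \<in> M" for k using G by (simp add: G_def)
      show "(\<lambda>k. ms k (x i)) \<longlonglongrightarrow> y i" if i: "i \<in> {1..n}" for i
      proof -
        have "(\<lambda>k. exp (- real k)) \<longlonglongrightarrow> 0" by real_asymp
        then have "(\<lambda>k. real n * (4 * (exp 2 * exp (- real k)))) \<longlonglongrightarrow> real n * (4 * (exp 2 * 0))" by (intro tendsto_intros)
        then have "(\<lambda>k. real n * (4 * exp (2 - real k))) \<longlonglongrightarrow> 0" by (simp flip: exp_add)
        then have "(\<lambda>k. y i - ms k (x i)) \<longlonglongrightarrow> 0"
          by (rule Lim_null_comparison[rotated]) (use bound[OF G big i] in simp)
        then show ?thesis using tendsto_diff[OF tendsto_const[of "y i"]] by fastforce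
      qed
    qed
    with nofit show False by blast
  qed
  define V where "V = Sup S"
  have "\<exists>\<theta> m. G \<theta> m \<and> V - 1 / real (Suc k) \<le> loglik \<theta> (?Q m)" for k
  proof -
    have "V - 1 / real (Suc k) < V" by simp
    then obtain v where "v \<in> S" "V - 1 / real (Suc k) < v" using less_cSup_iff[OF Sne bdd] V_def by blast
    then show ?thesis unfolding S_def by (auto intro: less_imp_le)
  qed
  then obtain \<theta>s ms where G: "\<And>k. G (\<theta>s k) (ms k)"
    and close: "\<And>k. V - 1 / real (Suc k) \<le> loglik (\<theta>s k) (?Q (ms k))" by metis
  have V1: "V - 1 \<le> loglik (\<theta>s k) (?Q (ms k))" for k
  proof -
    have "1 / real (Suc k) \<le> 1" by simp
    then show ?thesis using close[of k] by linarith
  qed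
  define v where "v k i = y i - ms k (x i)" for k i
  have vb: "\<bar>v k i\<bar> \<le> real n * (4 * exp (2 - (V - 1)))" if "i \<in> {1..n}" for k i
    unfolding v_def by (rule bound[OF G V1 that])
  have "\<exists>r. strict_mono (r :: nat \<Rightarrow> nat) \<and> (\<forall>i\<in>{1..n}. convergent (\<lambda>k. v (r k) i))"
    by (rule bounded_sequence_convergent_subsequence[of "{1..n}" v, OF vb])
  then obtain r where r: "strict_mono (r :: nat \<Rightarrow> nat)" "\<And>i. i \<in> {1..n} \<Longrightarrow> convergent (\<lambda>k. v (r k) i)" by blast
  define v0 where "v0 i = lim (\<lambda>k. v (r k) i)" for i
  have v0: "(\<lambda>k. v (r k) i) \<longlonglongrightarrow> v0 i" if "i \<in> {1..n}" for i
    using r(2)[OF that] by (simp add: v0_def convergent_LIMSEQ_iff)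
  have "(\<lambda>k. ms (r k) (x i)) \<longlonglongrightarrow> y i - v0 i" if "i \<in> {1..n}" for i
    using tendsto_diff[OF tendsto_const[of "y i"] v0[OF that]] by (simp add: v_def)
  then have "\<exists>m\<in>M. \<forall>i\<in>{1..n}. m (x i) = y i - v0 i"
    by (intro design_limit[OF closed, of "\<lambda>k. ms (r k)"]) (use G in \<open>auto simp: G_def\<close>)
  then obtain m where m: "m \<in> M" "\<And>i. i \<in> {1..n} \<Longrightarrow> m (x i) = y i - v0 i" by blast
  have Qm: "?Q m = empirical n v0" by (rule empirical_cong) (simp add: m(2))
  have "\<exists>i\<in>{1..n}. v0 i \<noteq> v0 1"
  proof (rule ccontr)
    assume c: "\<not> ?thesis"
    obtain m' where m': "m' \<in> M" "\<And>i. i \<in> {1..n} \<Longrightarrow> m' (x i) = m (x i) + v0 1" using shift_invariantD[OF shift m(1)] by blast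
    have "m' (x i) = y i" if i: "i \<in> {1..n}" for i
    proof -
      have "v0 i = v0 1" using c i by blast
      then show ?thesis using m'(2)[OF i] m(2)[OF i] by simp
    qed
    with nofit m'(1) show False by blast
  qed
  then obtain i where "i \<in> {1..n}" "v0 i \<noteq> v0 1" by blast
  then obtain s where s: "s > 0" "spread_at_least s (empirical n v0)"
    using spread_empirical[OF n, of i 1 v0] n by auto
  have ev: "\<forall>e>0. \<forall>\<^sub>F k in sequentially. V - e \<le> loglik (\<theta>s (r k)) (?Q (ms (r k)))"
    using eventually_compose_filterlim[OF eventually_inverse_Suc_close[OF close] filterlim_subseq[OF r(1)]] by blast
  obtain \<phi> where \<phi>: "\<phi> \<in> Phi" "mass \<phi> = 1" "log_integrable \<phi> (empirical n v0)" "V \<le> loglik \<phi> (empirical n v0)"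
  proof (rule loglik_compactness[of "uniform_count_measure {1..n}" "\<lambda>k. v (r k)" v0 s "\<lambda>k. \<theta>s (r k)" V])
    show "prob_space (uniform_count_measure {1..n})" by (rule prob_space_uniform[OF n])
    show "AE i in uniform_count_measure {1..n}. (\<lambda>k. v (r k) i) \<longlonglongrightarrow> v0 i" using v0 by (subst AE_uniform) auto
    show "\<forall>e>0. \<forall>\<^sub>F k in sequentially. V - e \<le> loglik (\<theta>s (r k)) (distr (uniform_count_measure {1..n}) borel (v (r k)))"
      using ev by (simp add: empirical_def v_def[abs_def])
    show "spread_at_least s (distr (uniform_count_measure {1..n}) borel v0)" using s(2) by (simp add: empirical_def)
    show "log_integrable (\<theta>s (r k)) (distr (uniform_count_measure {1..n}) borel (v (r k)))" for k
      using G[of "r k"] by (simp add: G_def empirical_def v_def[abs_def])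
  qed (use G s that in \<open>auto simp: G_def empirical_def\<close>)
  define c where "c = (\<integral>t. t * exp_of \<phi> t \<partial>lborel)"
  define \<phi>c where "\<phi>c = (\<lambda>t. \<phi> (t + c))"
  obtain m' where m': "m' \<in> M" "\<And>i. i \<in> {1..n} \<Longrightarrow> m' (x i) = m (x i) + c" using shift_invariantD[OF shift m(1)] by blast
  have Q: "?Q m' = empirical n (\<lambda>i. v0 i - c)" by (rule empirical_cong) (simp add: m'(2) m(2))
  have Q': "empirical n v0 = empirical n (\<lambda>i. v0 i - c + c)" by simp
  have \<phi>c: "\<phi>c \<in> Phi" "mass \<phi>c = 1" "(\<integral>t. t * exp_of \<phi>c t \<partial>lborel) = 0"
    unfolding \<phi>c_def using Phi_shift[OF \<phi>(1)] mass_shift[of \<phi> c] mean_shift[OF \<phi>(1), of c] \<phi>(2) by (auto simp: c_def)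
  have f: "log_integrable \<phi>c (?Q m')" "V \<le> loglik \<phi>c (?Q m')"
    using shift_empirical[OF \<phi>(1), of c n "\<lambda>i. v0 i - c"] \<phi>(3,4) unfolding Q Q' \<phi>c_def by auto
  have "L \<theta> (?Q m'') \<le> L \<phi>c (?Q m')" if \<theta>: "\<theta> \<in> Phi" "m'' \<in> M" "mass \<theta> = 1" for \<theta> m''
  proof (cases "log_integrable \<theta> (?Q m'')")
    case True
    have "loglik \<theta> (?Q m'') \<le> V"
      unfolding V_def by (rule cSup_upper[OF recentre[OF \<theta>(1) \<theta>(3) True \<theta>(2)] bdd])
    then show ?thesis using L_log_integrable[OF \<theta>(1) rd True] L_log_integrable[OF \<phi>c(1) rd f(1)] \<theta>(3) \<phi>c(2) f(2) by simp
  qed (use L_not_log_integrable[OF \<theta>(1) rd] in simp)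
  then have "is_mle n x M y (\<phi>c, m')"
    unfolding is_mle_def is_arg_max_def using \<phi>c m'(1) by (auto simp: not_less mass_eq_1_iff)
  then show ?thesis by blast
qed

section \<open>Distances and weak convergence\<close>

lemma lipschitz_measurable:
  fixes h :: "real \<Rightarrow> real"
  assumes "\<And>x y. \<bar>h x - h y\<bar> \<le> \<bar>x - y\<bar>"
  shows "h \<in> borel_measurable borel"
proof (rule borel_measurable_continuous_onI)
  have "1-lipschitz_on UNIV h" using assms by (intro lipschitz_onI) (auto simp: dist_real_def)
  then show "continuous_on UNIV h" by (rule lipschitz_on_continuous_on)
qed

lemma H_BL_D:
  assumes "h \<in> H_BL"
  shows "\<bar>h x\<bar> \<le> 1" "\<bar>h x - h y\<bar> \<le> \<bar>x - y\<bar>" "h \<in> borel_measurable borel"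
  using assms lipschitz_measurable[of h] by (auto simp: H_BL_def abs_le_iff minus_le_iff)

lemma H_BL_I:
  assumes "\<And>x. \<bar>h x\<bar> \<le> 1" "\<And>x y. \<bar>h x - h y\<bar> \<le> \<bar>x - y\<bar>"
  shows "h \<in> H_BL"
proof -
  have "h x \<in> {-1..1}" for x using assms(1)[of x] unfolding atLeastAtMost_iff by linarith
  then show ?thesis using assms(2) unfolding H_BL_def by blast
qed

lemma H_BL_integrable: "real_distribution Q \<Longrightarrow> h \<in> H_BL \<Longrightarrow> integrable Q h"
proof -
  assume "real_distribution Q" and h: "h \<in> H_BL"
  then interpret real_distribution Q by simp
  show ?thesis by (rule integrable_const_bound[where B = 1]) (use H_BL_D[OF h] in auto)
qed

lemma H_BL_integral_le: "real_distribution Q \<Longrightarrow> h \<in> H_BL \<Longrightarrow> \<bar>\<integral>x. h x \<partial>Q\<bar> \<le> 1"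
proof -
  assume Q: "real_distribution Q" and h: "h \<in> H_BL"
  then interpret real_distribution Q by simp
  have "\<bar>\<integral>x. h x \<partial>Q\<bar> \<le> (\<integral>x. \<bar>h x\<bar> \<partial>Q)" by (rule integral_abs_bound)
  also have "\<dots> \<le> (\<integral>x. 1 \<partial>Q)"
    using H_BL_integrable[OF Q h] H_BL_D(1)[OF h] by (intro integral_mono) auto
  finally show ?thesis by (simp add: prob_space[simplified])
qed

lemma H_BL_diff_le_2:
  "real_distribution Q \<Longrightarrow> real_distribution Q' \<Longrightarrow> h \<in> H_BL \<Longrightarrow> \<bar>(\<integral>x. h x \<partial>Q) - (\<integral>x. h x \<partial>Q')\<bar> \<le> 2"
  using H_BL_integral_le[of Q h] H_BL_integral_le[of Q' h] by linarith

lemma H_BL_diff_le_D_BL: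
  assumes "real_distribution Q" "real_distribution Q'" "h \<in> H_BL"
  shows "\<bar>(\<integral>x. h x \<partial>Q) - (\<integral>x. h x \<partial>Q')\<bar> \<le> D_BL Q Q'"
  unfolding D_BL_def
  by (rule cSUP_upper[OF assms(3)]) (use H_BL_diff_le_2[OF assms(1,2)] in \<open>auto intro!: bdd_aboveI[of _ 2]\<close>)

lemma D_BL_le_2:
  assumes "real_distribution Q" "real_distribution Q'"
  shows "D_BL Q Q' \<le> 2"
  unfolding D_BL_def
proof (rule cSUP_least)
  have "(\<lambda>_. 0) \<in> H_BL" by (simp add: H_BL_def)
  then show "H_BL \<noteq> {}" by blast
qed (rule H_BL_diff_le_2[OF assms])

lemma H_BL_scaleI:
  assumes K: "K \<ge> 1" and h: "\<And>x. \<bar>h x\<bar> \<le> K" "\<And>x y. \<bar>h x - h y\<bar> \<le> K * \<bar>x - y\<bar>"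
  shows "(\<lambda>x. h x / K) \<in> H_BL"
proof -
  have "\<bar>h x / K\<bar> \<le> 1" for x using h(1)[of x] K by simp
  moreover have "\<bar>h x / K - h y / K\<bar> \<le> \<bar>x - y\<bar>" for x y
  proof -
    have "\<bar>h x / K - h y / K\<bar> = \<bar>h x - h y\<bar> / K" using K by (simp flip: diff_divide_distrib)
    then show ?thesis using h(2)[of x y] K by (simp add: pos_divide_le_eq mult.commute)
  qed
  ultimately show ?thesis by (rule H_BL_I)
qed

lemma H_BL_truncated_distance: "(\<lambda>x. min 1 \<bar>x - x0\<bar>) \<in> H_BL"
proof -
  have "\<bar>min 1 \<bar>x - x0\<bar> - min 1 \<bar>y - x0\<bar>\<bar> \<le> \<bar>x - y\<bar>" for x y by linarith
  moreover have "-1 \<le> min 1 \<bar>x - x0\<bar>" for x by linarith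
  ultimately show ?thesis by (simp add: H_BL_def)
qed

lemma lipschitz_sin_cos: "\<bar>cos (t * x) - cos (t * y)\<bar> \<le> \<bar>t\<bar> * \<bar>x - y\<bar>" "\<bar>sin (t * x) - sin (t * y)\<bar> \<le> \<bar>t\<bar> * \<bar>x - y\<bar>"
  for t x y :: real
proof -
  have 1: "\<bar>sin ((u - v) / 2)\<bar> \<le> \<bar>u - v\<bar> / 2" for u v :: real using abs_sin_x_le_abs_x[of "(u - v) / 2"] by simp
  have le: "\<bar>2 * a * b\<bar> \<le> c" if "\<bar>a\<bar> \<le> 1" "\<bar>b\<bar> \<le> c / 2" for a b c :: real
    using mult_mono[OF that] by (simp add: abs_mult)
  have e: "\<bar>t * x - t * y\<bar> = \<bar>t\<bar> * \<bar>x - y\<bar>" by (simp flip: right_diff_distrib abs_mult)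
  have "cos (t * x) - cos (t * y) = 2 * sin ((t * x + t * y) / 2) * sin ((t * y - t * x) / 2)"
    by (rule cos_diff_cos)
  then show "\<bar>cos (t * x) - cos (t * y)\<bar> \<le> \<bar>t\<bar> * \<bar>x - y\<bar>"
    using le[of "sin ((t * x + t * y) / 2)" "sin ((t * y - t * x) / 2)" "\<bar>t\<bar> * \<bar>x - y\<bar>"] 1[of "t * y" "t * x"] e
    by (simp add: abs_minus_commute)
  have "sin (t * x) - sin (t * y) = 2 * sin ((t * x - t * y) / 2) * cos ((t * x + t * y) / 2)"
    by (rule sin_diff_sin)
  then show "\<bar>sin (t * x) - sin (t * y)\<bar> \<le> \<bar>t\<bar> * \<bar>x - y\<bar>"
    using le[of "cos ((t * x + t * y) / 2)" "sin ((t * x - t * y) / 2)" "\<bar>t\<bar> * \<bar>x - y\<bar>"] 1[of "t * x" "t * y"] e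
    by (simp add: mult_ac)
qed

text \<open>The real and imaginary parts of \<open>exp (i t x)\<close> are multiples of bounded Lipschitz functions, so
  the bounded Lipschitz distance controls characteristic functions.\<close>

lemma char_diff_le:
  assumes A: "real_distribution A" and B: "real_distribution B"
    and D: "\<And>h. h \<in> H_BL \<Longrightarrow> \<bar>(\<integral>x. h x \<partial>A) - (\<integral>x. h x \<partial>B)\<bar> \<le> D"
  shows "norm (char A t - char B t) \<le> 2 * (1 + \<bar>t\<bar>) * D"
proof -
  interpret A: real_distribution A by fact
  interpret B: real_distribution B by fact
  have RI: "Re (char M t) = (\<integral>x. cos (t * x) \<partial>M)" "Im (char M t) = (\<integral>x. sin (t * x) \<partial>M)"
    if "real_distribution M" for M
  proof -
    interpret real_distribution M by fact
    have i: "integrable M (\<lambda>x. iexp (t * x))" by (rule integrable_iexp) auto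
    show "Re (char M t) = (\<integral>x. cos (t * x) \<partial>M)" "Im (char M t) = (\<integral>x. sin (t * x) \<partial>M)"
      unfolding char_def using i by (simp_all add: Re_exp Im_exp flip: integral_Re integral_Im)
  qed
  have h: "(\<lambda>x. cos (t * x) / (1 + \<bar>t\<bar>)) \<in> H_BL" "(\<lambda>x. sin (t * x) / (1 + \<bar>t\<bar>)) \<in> H_BL"
  proof -
    have "\<bar>t\<bar> * \<bar>x - y\<bar> \<le> (1 + \<bar>t\<bar>) * \<bar>x - y\<bar>" for x y :: real by (intro mult_right_mono) auto
    then have le: "\<bar>cos (t * x) - cos (t * y)\<bar> \<le> (1 + \<bar>t\<bar>) * \<bar>x - y\<bar>"
      "\<bar>sin (t * x) - sin (t * y)\<bar> \<le> (1 + \<bar>t\<bar>) * \<bar>x - y\<bar>" for x y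
      using lipschitz_sin_cos[of t x y] by (meson order_trans)+
    have b: "\<bar>cos (t * x)\<bar> \<le> 1 + \<bar>t\<bar>" "\<bar>sin (t * x)\<bar> \<le> 1 + \<bar>t\<bar>" for x
      using abs_cos_le_one[of "t * x"] abs_sin_le_one[of "t * x"] by linarith+
    show "(\<lambda>x. cos (t * x) / (1 + \<bar>t\<bar>)) \<in> H_BL" "(\<lambda>x. sin (t * x) / (1 + \<bar>t\<bar>)) \<in> H_BL"
      by (rule H_BL_scaleI; use b le in simp)+
  qed
  have pos: "1 + \<bar>t\<bar> > 0" by linarith
  have "\<bar>(\<integral>x. cos (t * x) / (1 + \<bar>t\<bar>) \<partial>A) - (\<integral>x. cos (t * x) / (1 + \<bar>t\<bar>) \<partial>B)\<bar> \<le> D"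
    "\<bar>(\<integral>x. sin (t * x) / (1 + \<bar>t\<bar>) \<partial>A) - (\<integral>x. sin (t * x) / (1 + \<bar>t\<bar>) \<partial>B)\<bar> \<le> D"
    by (rule D[OF h(1)], rule D[OF h(2)])
  then have "\<bar>Re (char A t) - Re (char B t)\<bar> / (1 + \<bar>t\<bar>) \<le> D" "\<bar>Im (char A t) - Im (char B t)\<bar> / (1 + \<bar>t\<bar>) \<le> D"
    using pos unfolding RI[OF A] RI[OF B] by (simp_all flip: diff_divide_distrib)
  then have "\<bar>Re (char A t - char B t)\<bar> \<le> (1 + \<bar>t\<bar>) * D" "\<bar>Im (char A t - char B t)\<bar> \<le> (1 + \<bar>t\<bar>) * D"
    using pos by (simp_all add: pos_divide_le_eq mult.commute)
  then show ?thesis using cmod_le[of "char A t - char B t"] by linarith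
qed

text \<open>Laws that approach \<open>B k\<close> in the bounded Lipschitz distance have the same weak limit, by continuity
  of characteristic functions.\<close>

lemma weak_conv_BL:
  assumes A: "\<And>k. real_distribution (A k)" and B: "\<And>k. real_distribution (B k)" and M: "real_distribution M"
    and D: "\<And>k h. h \<in> H_BL \<Longrightarrow> \<bar>(\<integral>x. h x \<partial>A k) - (\<integral>x. h x \<partial>B k)\<bar> \<le> D k" "D \<longlonglongrightarrow> 0"
    and char: "\<And>t. (\<lambda>k. char (B k) t) \<longlonglongrightarrow> char M t"
  shows "weak_conv_m A M"
proof (rule levy_continuity[OF A M])
  fix t
  have "(\<lambda>k. 2 * (1 + \<bar>t\<bar>) * D k) \<longlonglongrightarrow> 2 * (1 + \<bar>t\<bar>) * 0" by (intro tendsto_intros D(2))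
  then have lim: "(\<lambda>k. 2 * (1 + \<bar>t\<bar>) * D k) \<longlonglongrightarrow> 0" by simp
  have "\<forall>\<^sub>F k in sequentially. norm (char (A k) t - char (B k) t) \<le> 2 * (1 + \<bar>t\<bar>) * D k"
    by (intro always_eventually allI char_diff_le[OF A B D(1)])
  then have "(\<lambda>k. char (A k) t - char (B k) t) \<longlonglongrightarrow> 0" by (rule Lim_null_comparison[OF _ lim])
  from tendsto_add[OF this char[of t]] show "(\<lambda>k. char (A k) t) \<longlonglongrightarrow> char M t" by simp
qed

lemma D1_lipschitz:
  assumes Q: "real_distribution Q" "real_distribution Q'" and D: "D1 Q Q' < ennreal e" and e: "e \<ge> 0"
    and h: "\<And>x y. \<bar>h x - h y\<bar> \<le> \<bar>x - (y::real)\<bar>" "integrable Q h" "integrable Q' h"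
  shows "\<bar>(\<integral>x. h x \<partial>Q) - (\<integral>x. h x \<partial>Q')\<bar> \<le> (e::real)"
proof -
  obtain \<pi> where \<pi>: "\<pi> \<in> couplings Q Q'" and le: "(\<integral>\<^sup>+ z. ennreal \<bar>fst z - snd z\<bar> \<partial>\<pi>) < ennreal e"
    using D unfolding D1_def INF_less_iff by blast
  have sets: "sets \<pi> = sets (borel \<Otimes>\<^sub>M borel)" and d: "distr \<pi> borel fst = Q" "distr \<pi> borel snd = Q'"
    using \<pi> by (auto simp: couplings_def)
  note [measurable_cong] = sets
  note [measurable] = lipschitz_measurable[OF h(1)]
  have f: "fst \<in> measurable \<pi> borel" "snd \<in> measurable \<pi> borel" by measurable
  have i: "integrable \<pi> (\<lambda>z. h (fst z))" "integrable \<pi> (\<lambda>z. h (snd z))"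
    using h(2,3) unfolding d[symmetric] by (simp_all add: integrable_distr_eq)
  have "(\<integral>x. h x \<partial>Q) - (\<integral>x. h x \<partial>Q') = (\<integral>z. h (fst z) \<partial>\<pi>) - (\<integral>z. h (snd z) \<partial>\<pi>)"
    unfolding d[symmetric] by (simp add: integral_distr)
  also have "\<dots> = (\<integral>z. h (fst z) - h (snd z) \<partial>\<pi>)" using i by simp
  finally have "ennreal \<bar>(\<integral>x. h x \<partial>Q) - (\<integral>x. h x \<partial>Q')\<bar> \<le> (\<integral>\<^sup>+ z. ennreal (norm (h (fst z) - h (snd z))) \<partial>\<pi>)"
    using integral_norm_bound_ennreal[of \<pi> "\<lambda>z. h (fst z) - h (snd z)"] i by simp
  also have "\<dots> \<le> (\<integral>\<^sup>+ z. ennreal \<bar>fst z - snd z\<bar> \<partial>\<pi>)" by (intro nn_integral_mono ennreal_leI) (use h(1) in simp)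
  also have "\<dots> \<le> ennreal e" using le by simp
  finally show ?thesis using e by (simp add: ennreal_le_iff)
qed

lemma D1_approx:
  assumes D: "(\<lambda>k. D1 (A k) Q) \<longlonglongrightarrow> 0" and A: "\<And>k. real_distribution (A k)" and Q: "real_distribution Q"
    and h: "\<And>x y. \<bar>h x - h y\<bar> \<le> \<bar>x - (y::real)\<bar>" "\<And>k. integrable (A k) h" "integrable Q h"
  shows "(\<lambda>k. \<integral>x. h x \<partial>A k) \<longlonglongrightarrow> (\<integral>x. h x \<partial>Q)"
proof (rule tendstoI)
  fix e :: real assume e: "e > 0"
  have "\<forall>\<^sub>F k in sequentially. D1 (A k) Q < ennreal (e / 2)"
    by (rule order_tendstoD(2)[OF D]) (use e in simp)
  then show "\<forall>\<^sub>F k in sequentially. dist (\<integral>x. h x \<partial>A k) (\<integral>x. h x \<partial>Q) < e"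
  proof eventually_elim
    case (elim k)
    have "\<bar>(\<integral>x. h x \<partial>A k) - (\<integral>x. h x \<partial>Q)\<bar> \<le> e / 2"
      by (rule D1_lipschitz[OF A Q elim _ h(1) h(2,3)]) (use e in simp)
    then show ?case using e by (simp add: dist_real_def)
  qed
qed

lemma D1_weak_conv:
  assumes D: "(\<lambda>k. D1 (A k) Q) \<longlonglongrightarrow> 0" and A: "\<And>k. real_distribution (A k)" and Q: "real_distribution Q"
  shows "weak_conv_m A Q"
proof (rule levy_continuity[OF A Q])
  fix t
  have "(\<lambda>k. char (A k) t - char Q t) \<longlonglongrightarrow> 0"
  proof (rule tendstoI)
    fix e :: real assume e: "e > 0"
    define u where "u = 1 + \<bar>t\<bar>"
    define e' where "e' = e / (4 * u)"
    have p: "u > 0" unfolding u_def by linarith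
    then have e': "e' > 0" "2 * (1 + \<bar>t\<bar>) * e' < e" using e unfolding u_def[symmetric] by (auto simp: e'_def)
    have "\<forall>\<^sub>F k in sequentially. D1 (A k) Q < ennreal e'"
      by (rule order_tendstoD(2)[OF D]) (use e' in simp)
    then show "\<forall>\<^sub>F k in sequentially. dist (char (A k) t - char Q t) 0 < e"
    proof eventually_elim
      case (elim k)
      have "norm (char (A k) t - char Q t) \<le> 2 * (1 + \<bar>t\<bar>) * e'"
      proof (rule char_diff_le[OF A Q])
        fix h assume h: "h \<in> H_BL"
        show "\<bar>(\<integral>x. h x \<partial>A k) - (\<integral>x. h x \<partial>Q)\<bar> \<le> e'"
          by (rule D1_lipschitz[OF A Q elim _ H_BL_D(2)[OF h] H_BL_integrable[OF A h] H_BL_integrable[OF Q h]])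
            (use e' in simp)
      qed
      then show ?case using e'(2) by simp
    qed
  qed
  from tendsto_add[OF this tendsto_const[of "char Q t"]] show "(\<lambda>k. char (A k) t) \<longlonglongrightarrow> char Q t" by simp
qed

lemma weak_conv_subseq:
  "weak_conv_m A Q \<Longrightarrow> strict_mono (r :: nat \<Rightarrow> nat) \<Longrightarrow> weak_conv_m (\<lambda>k. A (r k)) Q"
  using LIMSEQ_subseq_LIMSEQ[of _ _ r] unfolding weak_conv_m_def weak_conv_def by (auto simp: o_def)

section \<open>Convolution\<close>

lemma real_distribution_convolution:
  assumes "real_distribution Q" "real_distribution R"
  shows "real_distribution (Q \<star> R)"
proof -
  interpret Q: real_distribution Q by fact
  interpret R: real_distribution R by fact
  interpret P: pair_prob_space Q R ..
  show ?thesis unfolding convolution_def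
    by (rule prob_space.real_distribution_distr[OF P.prob_space_axioms]) measurable
qed

lemma char_convolution:
  assumes "real_distribution Q" "real_distribution R"
  shows "char (Q \<star> R) t = char Q t * char R t"
proof -
  interpret Q: real_distribution Q by fact
  interpret R: real_distribution R by fact
  interpret P: pair_prob_space Q R ..
  have i: "integrable (Q \<Otimes>\<^sub>M R) (\<lambda>z. iexp (t * (fst z + snd z)))"
    by (rule P.integrable_iexp) auto
  have "char (Q \<star> R) t = (\<integral>z. iexp (t * (fst z + snd z)) \<partial>(Q \<Otimes>\<^sub>M R))"
    unfolding char_def convolution_def by (subst integral_distr) (auto simp: case_prod_unfold)
  also have "\<dots> = (\<integral>x. (\<integral>y. iexp (t * (x + y)) \<partial>R) \<partial>Q)"
    using P.integral_fst'[OF i] by simp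
  also have "\<dots> = (\<integral>x. iexp (t * x) * char R t \<partial>Q)"
    unfolding char_def by (simp add: distrib_left exp_add)
  also have "\<dots> = char Q t * char R t" unfolding char_def by simp
  finally show ?thesis .
qed

lemma nn_integral_convolution_swap:
  assumes "real_distribution Q" "real_distribution R" "f \<in> borel_measurable borel"
  shows "(\<integral>\<^sup>+z. f z \<partial>(Q \<star> R)) = (\<integral>\<^sup>+r. (\<integral>\<^sup>+x. f (x + r) \<partial>Q) \<partial>R)"
proof -
  interpret Q: real_distribution Q by fact
  interpret R: real_distribution R by fact
  have c: "(Q \<star> R) = (R \<star> Q)"
    by (rule convolution_commutative) (auto simp: Q.finite_measure_axioms R.finite_measure_axioms)
  show ?thesis unfolding c
    by (subst nn_integral_convolution)
      (auto simp: Q.finite_measure_axioms R.finite_measure_axioms assms(3) add.commute)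
qed

text \<open>Given the noise, the distance to \<open>x0\<close> is the distance of the \<open>Q\<close>-distributed part to a shifted
  point.\<close>

lemma spread_convolution:
  assumes Q: "real_distribution Q" and R: "real_distribution R" and s: "s \<ge> 0" "spread_at_least s Q"
  shows "spread_at_least s (Q \<star> R)"
  unfolding spread_at_least_def
proof
  fix x0
  interpret Q: real_distribution Q by fact
  interpret R: real_distribution R by fact
  interpret C: real_distribution "Q \<star> R" by (rule real_distribution_convolution[OF Q R])
  have nn: "(\<integral>\<^sup>+x. ennreal (min 1 \<bar>x - y\<bar>) \<partial>M) = ennreal (\<integral>x. min 1 \<bar>x - y\<bar> \<partial>M)" if "real_distribution M" for M y
    by (rule nn_integral_eq_integral[OF H_BL_integrable[OF that H_BL_truncated_distance]]) simp
  have "ennreal s = (\<integral>\<^sup>+r. ennreal s \<partial>R)" using R.emeasure_space_1 by simp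
  also have "\<dots> \<le> (\<integral>\<^sup>+r. (\<integral>\<^sup>+x. ennreal (min 1 \<bar>x + r - x0\<bar>) \<partial>Q) \<partial>R)"
  proof (rule nn_integral_mono)
    fix r
    have "ennreal s \<le> ennreal (\<integral>x. min 1 \<bar>x - (x0 - r)\<bar> \<partial>Q)"
      using s(2) by (intro ennreal_leI) (simp add: spread_at_least_def)
    also have "\<dots> = (\<integral>\<^sup>+x. ennreal (min 1 \<bar>x - (x0 - r)\<bar>) \<partial>Q)" by (rule nn[OF Q, symmetric])
    finally show "ennreal s \<le> (\<integral>\<^sup>+x. ennreal (min 1 \<bar>x + r - x0\<bar>) \<partial>Q)" by (simp add: algebra_simps)
  qed
  also have "\<dots> = (\<integral>\<^sup>+z. ennreal (min 1 \<bar>z - x0\<bar>) \<partial>(Q \<star> R))"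
    by (rule nn_integral_convolution_swap[OF Q R, symmetric]) measurable
  also have "\<dots> = ennreal (\<integral>z. min 1 \<bar>z - x0\<bar> \<partial>(Q \<star> R))" by (rule nn[OF C.real_distribution_axioms])
  finally show "s \<le> (\<integral>x. min 1 \<bar>x - x0\<bar> \<partial>(Q \<star> R))"
    using s(1) by (subst (asm) ennreal_le_iff) (auto intro!: integral_nonneg_AE)
qed

text \<open>The deficit \<open>a - \<phi>\<close> is nonnegative, so its integral exists in \<open>[0, \<infinity>]\<close> and Fubini's theorem
  applies to it before integrability is known.\<close>

lemma nn_integral_deficit:
  assumes \<phi>: "\<phi> \<in> Phi" and a: "\<And>x. \<phi> x \<le> ereal a" and Q: "real_distribution Q"
  shows "log_integrable \<phi> Q \<Longrightarrow> (\<integral>\<^sup>+x. e2ennreal (ereal a - \<phi> x) \<partial>Q) = ennreal (a - loglik \<phi> Q)"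
    and "(\<integral>\<^sup>+x. e2ennreal (ereal a - \<phi> x) \<partial>Q) < \<infinity> \<Longrightarrow> log_integrable \<phi> Q"
proof -
  interpret real_distribution Q by fact
  note [measurable] = Phi_measurable[OF \<phi>]
  define p where "p x = real_of_ereal (\<phi> x)" for x
  have [measurable]: "p \<in> borel_measurable borel" unfolding p_def by measurable
  have pt: "e2ennreal (ereal a - \<phi> x) = ennreal (a - p x) \<and> p x \<le> a" if "\<phi> x \<noteq> -\<infinity>" for x
    using that Phi_not_infinity[OF \<phi>, of x] a[of x] by (cases "\<phi> x") (auto simp: p_def)
  show "(\<integral>\<^sup>+x. e2ennreal (ereal a - \<phi> x) \<partial>Q) = ennreal (a - loglik \<phi> Q)" if fin: "log_integrable \<phi> Q"
  proof -
    have ae: "AE x in Q. \<phi> x \<noteq> -\<infinity>" and int: "integrable Q p"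
      using fin by (auto simp: log_integrable_def p_def[abs_def])
    have "(\<integral>\<^sup>+x. e2ennreal (ereal a - \<phi> x) \<partial>Q) = (\<integral>\<^sup>+x. ennreal (a - p x) \<partial>Q)"
      by (rule nn_integral_cong_AE, use ae in eventually_elim) (use pt in blast)
    also have "\<dots> = ennreal (\<integral>x. a - p x \<partial>Q)"
      by (rule nn_integral_eq_integral) (use ae int pt in \<open>auto elim: eventually_mono\<close>)
    also have "(\<integral>x. a - p x \<partial>Q) = a - loglik \<phi> Q"
      using int by (simp add: loglik_def p_def[abs_def] prob_space[simplified])
    finally show ?thesis .
  qed
  show "log_integrable \<phi> Q" if fin: "(\<integral>\<^sup>+x. e2ennreal (ereal a - \<phi> x) \<partial>Q) < \<infinity>"
  proof -
    have "AE x in Q. e2ennreal (ereal a - \<phi> x) \<noteq> \<infinity>"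
      by (rule nn_integral_PInf_AE) (use fin in auto)
    then have ae: "AE x in Q. \<phi> x \<noteq> -\<infinity>" by eventually_elim auto
    have "(\<integral>\<^sup>+x. ennreal (norm (a - p x)) \<partial>Q) = (\<integral>\<^sup>+x. e2ennreal (ereal a - \<phi> x) \<partial>Q)"
      by (rule nn_integral_cong_AE, use ae in eventually_elim) (use pt in simp)
    then have "integrable Q (\<lambda>x. a - p x)" using fin by (intro integrableI_bounded) auto
    then have "integrable Q (\<lambda>x. a - (a - p x))" by (rule Bochner_Integration.integrable_diff[rotated]) simp
    then have "integrable Q p" by simp
    then show ?thesis using ae by (simp add: log_integrable_def p_def[abs_def])
  qed
qed

text \<open>Convolution lowers the maximal likelihood. The likelihood of \<open>\<phi>\<close> under \<open>Q \<star> R\<close> is the \<open>R\<close>-average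
  of the likelihoods of its translates under \<open>Q\<close>; if it reaches the maximum for \<open>Q\<close>, almost all
  translates are maximisers. These agree, so their means single out one translation.\<close>

lemma convolution_maximum_degenerate:
  assumes \<psi>: "maximises_loglik \<psi> Q" and Q: "real_distribution Q" and R: "real_distribution R"
    and int: "integrable Q (\<lambda>x. x)" "(\<integral>x. x \<partial>Q) = 0" and s: "s > 0" "spread_at_least s Q"
    and \<phi>: "\<phi> \<in> Phi" "mass \<phi> = 1" "log_integrable \<phi> (Q \<star> R)" "(\<integral>x. x * exp_of \<phi> x \<partial>lborel) = 0"
    and ge: "loglik \<psi> Q \<le> loglik \<phi> (Q \<star> R)"
  shows "AE r in R. r = 0"
proof -
  interpret Q: real_distribution Q by fact
  interpret R: real_distribution R by fact
  interpret P: pair_sigma_finite R Q ..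
  note C = real_distribution_convolution[OF Q R]
  note [measurable] = Phi_measurable[OF \<phi>(1)]
  obtain a0 b where b: "b > 0" and env: "\<And>x. \<phi> x \<le> ereal (a0 - b * \<bar>x\<bar>)"
    using Phi_envelope[OF \<phi>(1)] by blast
  define a where "a = max a0 (loglik \<psi> Q)"
  have a: "\<phi> x \<le> ereal a" for x
  proof -
    have "b * \<bar>x\<bar> \<ge> 0" using b by simp
    then have "a0 - b * \<bar>x\<bar> \<le> a" by (simp add: a_def)
    then show ?thesis using env[of x] by (meson ereal_less_eq(3) order_trans)
  qed
  define V where "V = loglik \<psi> Q"
  define c where "c r = (\<integral>\<^sup>+x. e2ennreal (ereal a - \<phi> (x + r)) \<partial>Q)" for r
  have [measurable]: "c \<in> borel_measurable R"
    unfolding c_def by measurable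
  have "(\<integral>\<^sup>+r. c r \<partial>R) = (\<integral>\<^sup>+z. e2ennreal (ereal a - \<phi> z) \<partial>(Q \<star> R))"
    unfolding c_def by (rule nn_integral_convolution_swap[OF Q R, symmetric]) measurable
  also have "\<dots> = ennreal (a - loglik \<phi> (Q \<star> R))" by (rule nn_integral_deficit(1)[OF \<phi>(1) a C \<phi>(3)])
  also have "\<dots> \<le> ennreal (a - V)" using ge by (intro ennreal_leI) (simp add: V_def)
  finally have up: "(\<integral>\<^sup>+r. c r \<partial>R) \<le> ennreal (a - V)" .
  have translate: "log_integrable (\<lambda>x. \<phi> (x + r)) Q \<and> c r = ennreal (a - loglik (\<lambda>x. \<phi> (x + r)) Q)
      \<and> loglik (\<lambda>x. \<phi> (x + r)) Q \<le> V" if "c r < \<infinity>" for r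
  proof -
    note S = Phi_shift[OF \<phi>(1), of r]
    have fin: "log_integrable (\<lambda>x. \<phi> (x + r)) Q"
      by (rule nn_integral_deficit(2)[OF S a Q]) (use that in \<open>simp add: c_def\<close>)
    moreover have "c r = ennreal (a - loglik (\<lambda>x. \<phi> (x + r)) Q)"
      unfolding c_def by (rule nn_integral_deficit(1)[OF S a Q fin])
    moreover have "loglik (\<lambda>x. \<phi> (x + r)) Q \<le> V"
      using \<psi> S fin mass_shift[of \<phi> r] \<phi>(2) unfolding maximises_loglik_def V_def by auto
    ultimately show ?thesis by blast
  qed
  \<comment> \<open>The deficit \<open>c r\<close> of every translate is at least \<open>a - V\<close>, and its average is at most that.\<close>
  have low: "ennreal (a - V) \<le> c r" for r
  proof (cases "c r < \<infinity>")
    case True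
    then show ?thesis using translate[OF True] by (auto intro!: ennreal_leI)
  qed (simp add: less_top[symmetric])
  have const: "(\<integral>\<^sup>+r. ennreal (a - V) \<partial>R) = ennreal (a - V)" using R.emeasure_space_1 by simp
  have "(\<integral>\<^sup>+r. c r - ennreal (a - V) \<partial>R) = (\<integral>\<^sup>+r. c r \<partial>R) - (\<integral>\<^sup>+r. ennreal (a - V) \<partial>R)"
    by (rule nn_integral_diff) (use low const in auto)
  also have "\<dots> = 0" unfolding const using up le_less_trans[OF up] by (simp add: diff_eq_0_iff_ennreal)
  finally have "AE r in R. c r - ennreal (a - V) = 0" by (subst (asm) nn_integral_0_iff_AE) auto
  then show ?thesis
  proof eventually_elim
    case (elim r)
    then have le: "c r \<le> ennreal (a - V)" by (simp add: diff_eq_0_iff_ennreal)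
    then have "c r < \<infinity>" by (rule le_less_trans) simp
    note T = translate[OF this]
    note S = Phi_shift[OF \<phi>(1), of r]
    have "ennreal (a - loglik (\<lambda>x. \<phi> (x + r)) Q) \<le> ennreal (a - V)" using le T by simp
    moreover have "0 \<le> a - V" by (simp add: a_def V_def)
    ultimately have "a - loglik (\<lambda>x. \<phi> (x + r)) Q \<le> a - V" by (simp only: ennreal_le_iff)
    then have "loglik \<psi> Q \<le> loglik (\<lambda>x. \<phi> (x + r)) Q" by (simp add: V_def)
    then have "AE x in lborel. exp_of \<psi> x = exp_of (\<lambda>x. \<phi> (x + r)) x"
      using T mass_shift[of \<phi> r] \<phi>(2) by (intro maximiser_unique[OF \<psi> S _ _ _ Q s]) auto
    then have "(\<integral>x. x * exp_of \<psi> x \<partial>lborel) = (\<integral>x. x * exp_of (\<lambda>x. \<phi> (x + r)) x \<partial>lborel)"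
      using \<psi> exp_of_integrable(2)[OF S] exp_of_integrable(2)[of \<psi>]
      by (intro integral_cong_AE) (auto simp: maximises_loglik_def elim: eventually_mono)
    then show "r = 0"
      using maximiser_mean[OF \<psi> Q int(1)] int(2) mean_shift[OF \<phi>(1), of r] \<phi>(2,4) by simp
  qed
qed

lemma convolution_null:
  assumes Q: "real_distribution Q" and R: "real_distribution R" and 0: "AE r in R. r = 0"
  shows "Q \<star> R = Q"
proof (rule measure_eqI)
  interpret Q: real_distribution Q by fact
  interpret R: real_distribution R by fact
  show "sets (Q \<star> R) = sets Q" by simp
  fix A assume "A \<in> sets (Q \<star> R)"
  then have A[measurable]: "A \<in> sets borel" by simp
  have "emeasure (Q \<star> R) A = (\<integral>\<^sup>+z. indicator A z \<partial>(Q \<star> R))" using A by simp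
  also have "\<dots> = (\<integral>\<^sup>+r. (\<integral>\<^sup>+x. indicator A (x + r) \<partial>Q) \<partial>R)"
    by (rule nn_integral_convolution_swap[OF Q R]) measurable
  also have "\<dots> = (\<integral>\<^sup>+r. emeasure Q A \<partial>R)"
    by (rule nn_integral_cong_AE, use 0 in eventually_elim) simp
  also have "\<dots> = emeasure Q A" using R.emeasure_space_1 by simp
  finally show "emeasure (Q \<star> R) A = emeasure Q A" .
qed

lemma convolution_empirical_zero:
  assumes "real_distribution Q" "n \<ge> 1"
  shows "(Q \<star> empirical n (\<lambda>i. 0)) = Q"
proof (rule convolution_null[OF assms(1) real_distribution_empirical[OF assms(2)]])
  show "AE r in empirical n (\<lambda>i. 0). r = 0"
    unfolding empirical_def by (subst AE_distr_iff) (auto simp: uniform_measurable)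
qed

section \<open>Limits of the estimators\<close>

lemma tight_if_bounded_mean:
  assumes \<mu>: "\<And>k. real_distribution (\<mu> k)" and int: "\<And>k. integrable (\<mu> k) (\<lambda>x. x)"
    and c: "\<And>k. (\<integral>x. \<bar>x\<bar> \<partial>\<mu> k) \<le> c"
  shows "tight \<mu>"
  unfolding tight_def
proof (intro conjI allI impI)
  show "real_distribution (\<mu> k)" for k by (rule \<mu>)
  fix e :: real assume e: "e > 0"
  define K where "K = (\<bar>c\<bar> + 1) / e"
  have p: "\<bar>c\<bar> + 1 > 0" "c < \<bar>c\<bar> + 1" by linarith+
  have "c / K = c * e / (\<bar>c\<bar> + 1)" by (simp add: K_def)
  also have "\<dots> < e" using p e mult_strict_right_mono[OF p(2) e] by (simp add: pos_divide_less_eq mult.commute)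
  finally have K: "K > 0" "c / K < e" using p(1) e unfolding K_def by simp_all
  have "measure (\<mu> k) {- K<..K} > 1 - e" for k
  proof -
    interpret real_distribution "\<mu> k" by (rule \<mu>)
    have "(\<integral>x. K * indicator (UNIV - {- K<..K}) x \<partial>\<mu> k) \<le> (\<integral>x. \<bar>x\<bar> \<partial>\<mu> k)"
    proof (rule integral_mono)
      show "K * indicator (UNIV - {- K<..K}) x \<le> \<bar>x\<bar>" for x using K by (auto simp: indicator_def)
      show "integrable (\<mu> k) (\<lambda>x. K * indicator (UNIV - {- K<..K}) x)"
        by (intro integrable_mult_right integrable_real_indicator) (auto simp: less_top[symmetric])
    qed (use int[of k] in auto)
    then have "K * measure (\<mu> k) (UNIV - {- K<..K}) \<le> c" using c[of k] by simp
    then have "measure (\<mu> k) (UNIV - {- K<..K}) \<le> c / K" using K(1) by (simp add: field_simps)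
    moreover have "measure (\<mu> k) (UNIV - {- K<..K}) = 1 - measure (\<mu> k) {- K<..K}"
      using prob_compl[of "{- K<..K}"] by simp
    ultimately show ?thesis using K(2) by linarith
  qed
  then show "\<exists>a b. a < b \<and> (\<forall>k. measure (\<mu> k) {a<..b} > 1 - e)"
    using K(1) by (intro exI[of _ "- K"] exI[of _ K]) auto
qed

lemma weak_conv_truncated:
  assumes "\<And>k. real_distribution (A k)" "real_distribution M" "weak_conv_m A M"
  shows "(\<lambda>k. \<integral>x. min T \<bar>x\<bar> \<partial>A k) \<longlonglongrightarrow> (\<integral>x. min T \<bar>x\<bar> \<partial>M)"
proof (rule weak_conv_imp_integral_bdd_continuous_conv[OF assms])
  show "isCont (\<lambda>x. min T \<bar>x\<bar>) x" for x by (intro continuous_intros)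
  show "norm (min T \<bar>x\<bar>) \<le> \<bar>T\<bar>" for x unfolding real_norm_def by linarith
qed

lemma truncated_tail_tendsto:
  assumes Q: "real_distribution Q" and int: "integrable Q (\<lambda>x. x)"
  shows "(\<lambda>T. \<integral>x. \<bar>x\<bar> - min (real T) \<bar>x\<bar> \<partial>Q) \<longlonglongrightarrow> 0"
proof -
  interpret real_distribution Q by fact
  have "(\<lambda>T. \<integral>x. \<bar>x\<bar> - min (real T) \<bar>x\<bar> \<partial>Q) \<longlonglongrightarrow> (\<integral>x. 0 \<partial>Q)"
  proof (rule integral_dominated_convergence[where w = "\<lambda>x. \<bar>x\<bar>"])
    show "AE x in Q. (\<lambda>T. \<bar>x\<bar> - min (real T) \<bar>x\<bar>) \<longlonglongrightarrow> 0"
    proof (intro AE_I2 tendsto_eventually)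
      fix x :: real
      obtain T0 where "\<bar>x\<bar> \<le> real T0" using real_arch_simple by blast
      then show "\<forall>\<^sub>F T in sequentially. \<bar>x\<bar> - min (real T) \<bar>x\<bar> = 0"
        unfolding eventually_sequentially by (intro exI[of _ T0]) auto
    qed
    show "AE x in Q. norm (\<bar>x\<bar> - min (real T) \<bar>x\<bar>) \<le> \<bar>x\<bar>" for T
    proof (intro AE_I2)
      fix x :: real
      have "0 \<le> real T" by simp
      then show "norm (\<bar>x\<bar> - min (real T) \<bar>x\<bar>) \<le> \<bar>x\<bar>" unfolding real_norm_def by linarith
    qed
    show "integrable Q (\<lambda>x. \<bar>x\<bar>)" using int by simp
    show "(\<lambda>x. \<bar>x\<bar> - min (real T) \<bar>x\<bar>) \<in> borel_measurable Q" for T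
      by (intro borel_measurable_diff borel_measurable_min borel_measurable_const borel_measurable_abs) auto
  qed simp
  then show ?thesis by simp
qed

lemma integrable_truncated: "real_distribution Q \<Longrightarrow> integrable Q (\<lambda>x. min T \<bar>x\<bar>)" for T :: real
proof -
  assume "real_distribution Q"
  then interpret real_distribution Q .
  show ?thesis by (rule integrable_const_bound[where B = "\<bar>T\<bar>"]) (auto simp: min_def abs_if)
qed

text \<open>Differences that tend to zero weakly but not in mean would take large values, which must come from
  large errors or large residuals. The tails of both are uniformly small in mean, because neither
  loses first moment in the limit.\<close>

lemma mean_abs_difference_tendsto_0:
  assumes Q: "real_distribution Q" "integrable Q (\<lambda>x. x)" and N: "\<And>k. N k \<ge> 1"
    and E: "weak_conv_m (\<lambda>k. empirical (N k) (e k)) Q" "(\<lambda>k. mean_abs (N k) (e k)) \<longlonglongrightarrow> (\<integral>x. \<bar>x\<bar> \<partial>Q)"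
    and S: "weak_conv_m (\<lambda>k. empirical (N k) (\<lambda>i. e k i - d k i)) Q"
      "\<And>\<delta>. \<delta> > 0 \<Longrightarrow> \<forall>\<^sub>F k in sequentially. mean_abs (N k) (\<lambda>i. e k i - d k i) \<le> (\<integral>x. \<bar>x\<bar> \<partial>Q) + \<delta>"
    and R: "real_distribution R" "AE r in R. r = 0" "weak_conv_m (\<lambda>k. empirical (N k) (\<lambda>i. - d k i)) R"
  shows "(\<lambda>k. mean_abs (N k) (d k)) \<longlonglongrightarrow> 0"
proof (rule order_tendstoI)
  fix b :: real assume "b < 0"
  moreover have "0 \<le> mean_abs n v" for n v by (simp add: mean_abs_def sum_nonneg)
  ultimately show "\<forall>\<^sub>F k in sequentially. b < mean_abs (N k) (d k)"
    by (intro always_eventually allI) (meson less_le_trans)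
next
  fix b :: real assume b: "0 < b"
  define \<delta> where "\<delta> = b / 5"
  have \<delta>: "\<delta> > 0" using b by (simp add: \<delta>_def)
  note rd = real_distribution_empirical[OF N]
  have "\<forall>\<^sub>F T in sequentially. (\<integral>x. \<bar>x\<bar> - min (real T) \<bar>x\<bar> \<partial>Q) < \<delta>"
    by (rule order_tendstoD(2)[OF truncated_tail_tendsto[OF Q] \<delta>])
  then obtain T :: nat where "(\<integral>x. \<bar>x\<bar> - min (real T) \<bar>x\<bar> \<partial>Q) < \<delta>" by (auto simp: eventually_sequentially)
  then have T: "(\<integral>x. \<bar>x\<bar> \<partial>Q) - (\<integral>x. min (real T) \<bar>x\<bar> \<partial>Q) < \<delta>"
    using Q integrable_truncated[OF Q(1)] by simp
  have "(\<integral>x. min (2 * real T) \<bar>x\<bar> \<partial>R) = (\<integral>x. 0 \<partial>R)"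
  proof -
    interpret R: real_distribution R by fact
    show ?thesis by (rule integral_cong_AE) (use R(2) in \<open>auto elim: eventually_mono\<close>)
  qed
  then have "(\<lambda>k. \<integral>x. min (2 * real T) \<bar>x\<bar> \<partial>empirical (N k) (\<lambda>i. - d k i)) \<longlonglongrightarrow> 0"
    using weak_conv_truncated[OF rd R(1,3), of "2 * real T"] by simp
  then have r: "\<forall>\<^sub>F k in sequentially. (\<integral>x. min (2 * real T) \<bar>x\<bar> \<partial>empirical (N k) (\<lambda>i. - d k i)) < \<delta>"
    by (rule order_tendstoD(2)[OF _ \<delta>])
  have te: "\<forall>\<^sub>F k in sequentially. (\<integral>x. min (real T) \<bar>x\<bar> \<partial>Q) - \<delta> / 2 < (\<integral>x. min (real T) \<bar>x\<bar> \<partial>empirical (N k) (e k))"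
    by (rule order_tendstoD(1)[OF weak_conv_truncated[OF rd Q(1) E(1)]]) (use \<delta> in simp)
  have ts: "\<forall>\<^sub>F k in sequentially. (\<integral>x. min (real T) \<bar>x\<bar> \<partial>Q) - \<delta> / 2 < (\<integral>x. min (real T) \<bar>x\<bar> \<partial>empirical (N k) (\<lambda>i. e k i - d k i))"
    by (rule order_tendstoD(1)[OF weak_conv_truncated[OF rd Q(1) S(1)]]) (use \<delta> in simp)
  have me: "\<forall>\<^sub>F k in sequentially. mean_abs (N k) (e k) < (\<integral>x. \<bar>x\<bar> \<partial>Q) + \<delta> / 2"
    by (rule order_tendstoD(2)[OF E(2)]) (use \<delta> in simp)
  have ms: "\<forall>\<^sub>F k in sequentially. mean_abs (N k) (\<lambda>i. e k i - d k i) \<le> (\<integral>x. \<bar>x\<bar> \<partial>Q) + \<delta> / 2"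
    by (rule S(2)) (use \<delta> in simp)
  show "\<forall>\<^sub>F k in sequentially. mean_abs (N k) (d k) < b"
    using r te ts me ms
  proof eventually_elim
    case (elim k)
    let ?c = "1 / real (N k)"
    have i: "(\<integral>x. min U \<bar>x\<bar> \<partial>empirical (N k) v) = ?c * (\<Sum>i=1..N k. min U \<bar>v i\<bar>)" for U v
      by (rule integral_empirical) (intro borel_measurable_min borel_measurable_const borel_measurable_abs, simp)
    \<comment> \<open>If \<open>\<bar>d\<bar>\<close> exceeds \<open>2 T\<close>, the excess is shared between \<open>e\<close> and \<open>e - d\<close> beyond the level \<open>T\<close>.\<close>
    have "\<bar>d k i\<bar> \<le> min (2 * real T) \<bar>- d k i\<bar> + (\<bar>e k i\<bar> - min (real T) \<bar>e k i\<bar>)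
        + (\<bar>e k i - d k i\<bar> - min (real T) \<bar>e k i - d k i\<bar>)" for i
      by linarith
    then have "(\<Sum>i=1..N k. \<bar>d k i\<bar>) \<le> (\<Sum>i=1..N k. min (2 * real T) \<bar>- d k i\<bar> + (\<bar>e k i\<bar> - min (real T) \<bar>e k i\<bar>)
        + (\<bar>e k i - d k i\<bar> - min (real T) \<bar>e k i - d k i\<bar>))"
      by (intro sum_mono)
    then have "?c * (\<Sum>i=1..N k. \<bar>d k i\<bar>) \<le> ?c * (\<Sum>i=1..N k. min (2 * real T) \<bar>- d k i\<bar> + (\<bar>e k i\<bar> - min (real T) \<bar>e k i\<bar>)
        + (\<bar>e k i - d k i\<bar> - min (real T) \<bar>e k i - d k i\<bar>))"
      by (rule mult_left_mono) simp
    also have "\<dots> = (\<integral>x. min (2 * real T) \<bar>x\<bar> \<partial>empirical (N k) (\<lambda>i. - d k i))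
        + (mean_abs (N k) (e k) - (\<integral>x. min (real T) \<bar>x\<bar> \<partial>empirical (N k) (e k)))
        + (mean_abs (N k) (\<lambda>i. e k i - d k i) - (\<integral>x. min (real T) \<bar>x\<bar> \<partial>empirical (N k) (\<lambda>i. e k i - d k i)))"
      unfolding i mean_abs_def by (simp only: sum.distrib sum_subtractf distrib_left right_diff_distrib)
    also have "\<dots> < b" using elim T unfolding \<delta>_def by linarith
    finally show ?case by (simp add: mean_abs_def)
  qed
qed

text \<open>The competitors are normalised Lipschitz majorants of the maximiser for \<open>Q\<close>, evaluated under a
  coupling with \<open>Q\<close>.\<close>

lemma maximum_lsc:
  assumes \<psi>: "maximises_loglik \<psi> Q" and Q: "real_distribution Q" "integrable Q (\<lambda>x. x)"
    and A: "\<And>k. real_distribution (A k)" "\<And>k. integrable (A k) (\<lambda>x. x)" "weak_conv_m A Q"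
      "(\<lambda>k. \<integral>x. \<bar>x\<bar> \<partial>A k) \<longlonglongrightarrow> (\<integral>x. \<bar>x\<bar> \<partial>Q)"
    and e: "e > 0"
  shows "\<forall>\<^sub>F k in sequentially. \<exists>\<theta>\<in>Phi. mass \<theta> = 1 \<and> log_integrable \<theta> (A k) \<and> loglik \<psi> Q - e \<le> loglik \<theta> (A k)"
proof -
  obtain \<Omega> :: "real measure" and Y Y0 where "prob_space \<Omega>" "\<And>k. integrable \<Omega> (Y k)" "integrable \<Omega> Y0"
    "\<And>k. distr \<Omega> borel (Y k) = A k" "distr \<Omega> borel Y0 = Q"
    "(\<lambda>k. \<integral>\<omega>. \<bar>Y k \<omega> - Y0 \<omega>\<bar> \<partial>\<Omega>) \<longlonglongrightarrow> 0"
    using mean_coupling[OF A(1) Q(1) A(3) A(2) Q(2) A(4)] by blast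
  with loglik_lsc[of \<Omega> Y Y0 \<psi> e] \<psi> e show ?thesis by (simp add: maximises_loglik_def)
qed

lemma maximiser_exp_of_integral_eq:
  assumes "AE x in lborel. exp_of \<psi> x = exp_of \<phi> x" "\<psi> \<in> Phi" "\<phi> \<in> Phi" "\<theta> \<in> Phi"
  shows "(\<integral>x. \<bar>exp_of \<theta> x - exp_of \<phi> x\<bar> \<partial>lborel) = (\<integral>x. \<bar>exp_of \<theta> x - exp_of \<psi> x\<bar> \<partial>lborel)"
proof -
  note [measurable] = exp_of_measurable[OF assms(2)] exp_of_measurable[OF assms(3)] exp_of_measurable[OF assms(4)]
  show ?thesis by (rule integral_cong_AE) (use assms(1) in \<open>auto elim: eventually_mono\<close>)
qed

text \<open>Every limit of the maximisers has at least the maximal likelihood for \<open>Q\<close>, so it is the maximiser.\<close>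

lemma maximiser_continuous:
  assumes \<psi>: "maximises_loglik \<psi> Q" and Q: "real_distribution Q" "integrable Q (\<lambda>x. x)"
    and s: "s > 0" "spread_at_least s Q"
    and A: "\<And>k. real_distribution (A k)" "\<And>k. integrable (A k) (\<lambda>x. x)" "weak_conv_m A Q"
      "(\<lambda>k. \<integral>x. \<bar>x\<bar> \<partial>A k) \<longlonglongrightarrow> (\<integral>x. \<bar>x\<bar> \<partial>Q)"
    and \<psi>s: "\<And>k. maximises_loglik (\<psi>s k) (A k)"
  shows "\<exists>r. strict_mono (r :: nat \<Rightarrow> nat) \<and> (\<lambda>k. \<integral>x. \<bar>exp_of (\<psi>s (r k)) x - exp_of \<psi> x\<bar> \<partial>lborel) \<longlonglongrightarrow> 0"
proof -
  have \<psi>s': "\<psi>s k \<in> Phi" "mass (\<psi>s k) = 1" "log_integrable (\<psi>s k) (A k)" for k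
    using \<psi>s by (auto simp: maximises_loglik_def)
  have v: "\<forall>e>0. \<forall>\<^sub>F k in sequentially. loglik \<psi> Q - e \<le> loglik (\<psi>s k) (A k)"
  proof (intro allI impI)
    fix e :: real assume "e > 0"
    from maximum_lsc[OF \<psi> Q A this] show "\<forall>\<^sub>F k in sequentially. loglik \<psi> Q - e \<le> loglik (\<psi>s k) (A k)"
      by eventually_elim (use \<psi>s in \<open>auto simp: maximises_loglik_def intro: order_trans\<close>)
  qed
  obtain \<Omega> :: "real measure" and Y Y0 where \<Omega>: "prob_space \<Omega>" "\<And>k. integrable \<Omega> (Y k)" "integrable \<Omega> Y0"
    and d: "\<And>k. distr \<Omega> borel (Y k) = A k" "distr \<Omega> borel Y0 = Q" and lim: "AE \<omega> in \<Omega>. (\<lambda>k. Y k \<omega>) \<longlonglongrightarrow> Y0 \<omega>"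
    using mean_coupling[OF A(1) Q(1) A(3) A(2) Q(2) A(4)] by blast
  obtain r \<phi> where r: "strict_mono (r :: nat \<Rightarrow> nat)" and \<phi>: "\<phi> \<in> Phi" "mass \<phi> = 1" "log_integrable \<phi> Q"
    "loglik \<psi> Q \<le> loglik \<phi> Q" and l: "(\<lambda>k. \<integral>x. \<bar>exp_of (\<psi>s (r k)) x - exp_of \<phi> x\<bar> \<partial>lborel) \<longlonglongrightarrow> 0"
    by (rule loglik_compactness[OF \<Omega>(1) borel_measurable_integrable[OF \<Omega>(2)] borel_measurable_integrable[OF \<Omega>(3)]
          lim s(1), of \<psi>s "loglik \<psi> Q"])
      (use s \<psi>s' v in \<open>auto simp: d\<close>)
  have "AE x in lborel. exp_of \<psi> x = exp_of \<phi> x" by (rule maximiser_unique[OF \<psi> \<phi> Q(1) s])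
  then show ?thesis
    using r l maximiser_exp_of_integral_eq[OF _ _ \<phi>(1) \<psi>s'(1)] \<psi> by (auto simp: maximises_loglik_def)
qed

text \<open>The residuals \<open>e - d\<close> of the estimator have approximately the law \<open>Q \<star> R\<close>, with \<open>R\<close> a limit of the
  empirical laws of \<open>-d\<close>. The estimator is at least as good as the truth, whose likelihood comes
  close to the maximum for \<open>Q\<close>, so \<open>R\<close> is concentrated at zero.\<close>

lemma estimator_limit:
  assumes \<psi>: "maximises_loglik \<psi> Q" and Q: "real_distribution Q" "integrable Q (\<lambda>x. x)" "(\<integral>x. x \<partial>Q) = 0"
    and s: "s > 0" "spread_at_least s Q" and N: "\<And>k. N k \<ge> 1"
    and A: "\<And>k. real_distribution (A k)" "weak_conv_m A Q"
    and E: "weak_conv_m (\<lambda>k. empirical (N k) (e k)) Q" "(\<lambda>k. mean_abs (N k) (e k)) \<longlonglongrightarrow> (\<integral>x. \<bar>x\<bar> \<partial>Q)"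
    and D: "(\<lambda>k. D_BL (empirical (N k) (\<lambda>i. e k i - d k i)) (A k \<star> empirical (N k) (\<lambda>i. - d k i))) \<longlonglongrightarrow> 0"
    and c: "\<And>k. mean_abs (N k) (d k) \<le> c"
    and \<phi>s: "\<And>k. \<phi>s k \<in> Phi" "\<And>k. mass (\<phi>s k) = 1" "\<And>k. log_integrable (\<phi>s k) (empirical (N k) (\<lambda>i. e k i - d k i))"
      "\<And>k. (\<integral>t. t * exp_of (\<phi>s k) t \<partial>lborel) = 0"
    and opt: "\<And>k \<theta>. \<theta> \<in> Phi \<Longrightarrow> mass \<theta> = 1 \<Longrightarrow> log_integrable \<theta> (empirical (N k) (e k)) \<Longrightarrow>
      loglik \<theta> (empirical (N k) (e k)) \<le> loglik (\<phi>s k) (empirical (N k) (\<lambda>i. e k i - d k i))"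
  shows "\<exists>r. strict_mono (r :: nat \<Rightarrow> nat) \<and> (\<lambda>k. mean_abs (N (r k)) (d (r k))) \<longlonglongrightarrow> 0 \<and>
    (\<lambda>k. \<integral>x. \<bar>exp_of (\<phi>s (r k)) x - exp_of \<psi> x\<bar> \<partial>lborel) \<longlonglongrightarrow> 0"
proof -
  define S where "S k = empirical (N k) (\<lambda>i. e k i - d k i)" for k
  define R where "R k = empirical (N k) (\<lambda>i. - d k i)" for k
  have rd: "real_distribution (empirical (N k) v)" for k v by (rule real_distribution_empirical[OF N])
  have rdS: "real_distribution (S k)" and rdR: "real_distribution (R k)" for k unfolding S_def R_def by (rule rd)+
  have int: "integrable (empirical n v) (\<lambda>x. x)" for n v by (rule integrable_empirical) simp
  have v: "\<forall>\<^sub>F k in sequentially. loglik \<psi> Q - e' \<le> loglik (\<phi>s k) (S k)" if "e' > 0" for e'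
    using maximum_lsc[OF \<psi> Q(1,2) rd int E(1) _ that] E(2) unfolding mean_abs_empirical
    by (auto elim!: eventually_mono dest!: opt simp: S_def)
  have "tight R"
  proof (rule tight_if_bounded_mean[OF rdR])
    show "integrable (R k) (\<lambda>x. x)" for k unfolding R_def by (rule int)
    show "(\<integral>x. \<bar>x\<bar> \<partial>R k) \<le> c" for k
      using c[of k] unfolding R_def mean_abs_empirical[symmetric] by (simp add: mean_abs_def)
  qed
  from tight_imp_convergent_subsubsequence[OF this strict_mono_id]
  obtain r1 R0 where r1: "strict_mono (r1 :: nat \<Rightarrow> nat)" and R0: "real_distribution R0" "weak_conv_m (\<lambda>k. R (r1 k)) R0"
    by (auto simp: o_def)
  have C: "real_distribution (Q \<star> R0)" by (rule real_distribution_convolution[OF Q(1) R0(1)])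
  have Ar: "(\<lambda>k. char (A (r1 k)) t) \<longlonglongrightarrow> char Q t" for t
    using LIMSEQ_subseq_LIMSEQ[OF levy_continuity1[OF A(1) Q(1) A(2), of t] r1] by (simp add: o_def)
  have "weak_conv_m (\<lambda>k. S (r1 k)) (Q \<star> R0)"
  proof (rule weak_conv_BL[where B = "\<lambda>k. A (r1 k) \<star> R (r1 k)" and D = "\<lambda>k. D_BL (S (r1 k)) (A (r1 k) \<star> R (r1 k))"])
    show "real_distribution (A (r1 k) \<star> R (r1 k))" for k by (rule real_distribution_convolution[OF A(1) rdR])
    then show "\<bar>(\<integral>x. h x \<partial>S (r1 k)) - (\<integral>x. h x \<partial>(A (r1 k) \<star> R (r1 k)))\<bar> \<le> D_BL (S (r1 k)) (A (r1 k) \<star> R (r1 k))"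
      if "h \<in> H_BL" for k h by (intro H_BL_diff_le_D_BL[OF rdS _ that])
    show "(\<lambda>k. D_BL (S (r1 k)) (A (r1 k) \<star> R (r1 k))) \<longlonglongrightarrow> 0"
      using LIMSEQ_subseq_LIMSEQ[OF D r1] by (simp add: o_def S_def R_def)
    show "(\<lambda>k. char (A (r1 k) \<star> R (r1 k)) t) \<longlonglongrightarrow> char (Q \<star> R0) t" for t
      unfolding char_convolution[OF A(1) rdR] char_convolution[OF Q(1) R0(1)]
      by (intro tendsto_mult Ar levy_continuity1[OF rdR R0])
  qed (rule rdS C)+
  then obtain \<Omega> :: "real measure" and Y Y0 where \<Omega>: "prob_space \<Omega>" and Y: "\<And>k. Y k \<in> measurable \<Omega> borel"
    "\<And>k. distr \<Omega> borel (Y k) = S (r1 k)" and Y0: "Y0 \<in> measurable \<Omega> lborel" "distr \<Omega> borel Y0 = (Q \<star> R0)"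
    and lim: "\<And>x. x \<in> space \<Omega> \<Longrightarrow> (\<lambda>k. Y k x) \<longlonglongrightarrow> Y0 x"
    using Skorohod[OF rdS C] by blast
  have Y0m: "Y0 \<in> measurable \<Omega> borel" using Y0(1) by simp
  have ae: "AE \<omega> in \<Omega>. (\<lambda>k. Y k \<omega>) \<longlonglongrightarrow> Y0 \<omega>" using lim by (intro AE_I2) auto
  have "spread_at_least s (Q \<star> R0)" by (rule spread_convolution[OF Q(1) R0(1) _ s(2)]) (use s in simp)
  then have sp: "spread_at_least s (distr \<Omega> borel Y0)" by (simp add: Y0(2))
  have vr: "\<forall>e'>0. \<forall>\<^sub>F k in sequentially. loglik \<psi> Q - e' \<le> loglik (\<phi>s (r1 k)) (distr \<Omega> borel (Y k))"
    using eventually_compose_filterlim[OF v filterlim_subseq[OF r1]] by (simp add: Y(2))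
  have fin: "log_integrable (\<phi>s (r1 k)) (distr \<Omega> borel (Y k))" for k using \<phi>s(3) by (simp add: Y(2) S_def)
  obtain r2 \<phi> where r2: "strict_mono (r2 :: nat \<Rightarrow> nat)" and \<phi>: "\<phi> \<in> Phi" "mass \<phi> = 1"
      "log_integrable \<phi> (distr \<Omega> borel Y0)" "loglik \<psi> Q \<le> loglik \<phi> (distr \<Omega> borel Y0)"
    and mean: "(\<lambda>k. \<integral>x. x * exp_of (\<phi>s (r1 (r2 k))) x \<partial>lborel) \<longlonglongrightarrow> (\<integral>x. x * exp_of \<phi> x \<partial>lborel)"
    and l1: "(\<lambda>k. \<integral>x. \<bar>exp_of (\<phi>s (r1 (r2 k))) x - exp_of \<phi> x\<bar> \<partial>lborel) \<longlonglongrightarrow> 0"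
    and moment: "\<And>\<delta>. (\<And>k. integrable \<Omega> (Y k)) \<Longrightarrow> integrable \<Omega> Y0 \<Longrightarrow> loglik \<phi> (distr \<Omega> borel Y0) \<le> loglik \<psi> Q \<Longrightarrow> \<delta> > 0
      \<Longrightarrow> \<forall>\<^sub>F k in sequentially. (\<integral>\<omega>. \<bar>Y (r2 k) \<omega>\<bar> \<partial>\<Omega>) \<le> (\<integral>\<omega>. \<bar>Y0 \<omega>\<bar> \<partial>\<Omega>) + \<delta>"
  proof (rule loglik_compactness[OF \<Omega> Y(1) Y0m ae s(1) sp \<phi>s(1) \<phi>s(2) fin vr], goal_cases)
    case (1 r \<phi>)
    show ?case by (rule that[OF 1(2-9)])
  qed
  have mean0: "(\<integral>x. x * exp_of \<phi> x \<partial>lborel) = 0"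
    using mean by (simp add: \<phi>s(4) LIMSEQ_const_iff)
  have R00: "AE r in R0. r = 0"
    by (rule convolution_maximum_degenerate[OF \<psi> Q(1) R0(1) Q(2,3) s \<phi>(1,2) _ mean0]) (use \<phi> in \<open>auto simp: Y0(2)\<close>)
  have QR: "(Q \<star> R0) = Q" by (rule convolution_null[OF Q(1) R0(1) R00])
  have \<phi>Q: "log_integrable \<phi> Q" "loglik \<psi> Q \<le> loglik \<phi> Q" using \<phi>(3,4) by (simp_all add: Y0(2) QR)
  have eq: "AE x in lborel. exp_of \<psi> x = exp_of \<phi> x" by (rule maximiser_unique[OF \<psi> \<phi>(1,2) \<phi>Q Q(1) s])
  define r where "r k = r1 (r2 k)" for k
  have r: "strict_mono r" using strict_mono_o[OF r1 r2] by (simp add: r_def[abs_def] o_def)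
  have "(\<lambda>k. mean_abs (N (r k)) (d (r k))) \<longlonglongrightarrow> 0"
  proof (rule mean_abs_difference_tendsto_0[OF Q(1,2) N _ _ _ _ R0(1) R00])
    show "weak_conv_m (\<lambda>k. empirical (N (r k)) (e (r k))) Q" by (rule weak_conv_subseq[OF E(1) r])
    show "(\<lambda>k. mean_abs (N (r k)) (e (r k))) \<longlonglongrightarrow> (\<integral>x. \<bar>x\<bar> \<partial>Q)"
      using LIMSEQ_subseq_LIMSEQ[OF E(2) r] by (simp add: o_def)
    show "weak_conv_m (\<lambda>k. empirical (N (r k)) (\<lambda>i. e (r k) i - d (r k) i)) Q"
      using weak_conv_subseq[OF \<open>weak_conv_m (\<lambda>k. S (r1 k)) (Q \<star> R0)\<close> r2] unfolding QR by (simp add: S_def r_def)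
    show "weak_conv_m (\<lambda>k. empirical (N (r k)) (\<lambda>i. - d (r k) i)) R0"
      using weak_conv_subseq[OF R0(2) r2] by (simp add: R_def r_def)
    fix \<delta> :: real assume \<delta>: "\<delta> > 0"
    have iY: "integrable \<Omega> (Y k)" for k
      using int[of "N (r1 k)" "\<lambda>i. e (r1 k) i - d (r1 k) i"] Y(1)[of k]
      unfolding S_def[symmetric] Y(2)[symmetric] by (subst (asm) integrable_distr_eq) auto
    have iY0: "integrable \<Omega> Y0"
    proof -
      have "integrable (distr \<Omega> borel Y0) (\<lambda>x. x)" unfolding Y0(2) QR by (rule Q(2))
      then show ?thesis by (subst (asm) integrable_distr_eq) (use Y0m in auto)
    qed
    have m1: "(\<integral>\<omega>. \<bar>Y (r2 k) \<omega>\<bar> \<partial>\<Omega>) = mean_abs (N (r k)) (\<lambda>i. e (r k) i - d (r k) i)" for k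
    proof -
      have "(\<integral>x. \<bar>x\<bar> \<partial>distr \<Omega> borel (Y (r2 k))) = (\<integral>\<omega>. \<bar>Y (r2 k) \<omega>\<bar> \<partial>\<Omega>)" using Y(1) by (subst integral_distr) auto
      then show ?thesis unfolding Y(2) mean_abs_empirical S_def r_def by simp
    qed
    have m2: "(\<integral>\<omega>. \<bar>Y0 \<omega>\<bar> \<partial>\<Omega>) = (\<integral>x. \<bar>x\<bar> \<partial>Q)"
    proof -
      have "(\<integral>x. \<bar>x\<bar> \<partial>distr \<Omega> borel Y0) = (\<integral>\<omega>. \<bar>Y0 \<omega>\<bar> \<partial>\<Omega>)" using Y0m by (subst integral_distr) auto
      then show ?thesis unfolding Y0(2) QR by simp
    qed
    have "loglik \<phi> (distr \<Omega> borel Y0) \<le> loglik \<psi> Q"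
      using \<psi> \<phi>(1,2) \<phi>Q(1) unfolding maximises_loglik_def Y0(2) QR by blast
    from moment[OF iY iY0 this \<delta>]
    show "\<forall>\<^sub>F k in sequentially. mean_abs (N (r k)) (\<lambda>i. e (r k) i - d (r k) i) \<le> (\<integral>x. \<bar>x\<bar> \<partial>Q) + \<delta>"
      unfolding m1 m2 .
  qed
  moreover have "(\<lambda>k. \<integral>x. \<bar>exp_of (\<phi>s (r k)) x - exp_of \<psi> x\<bar> \<partial>lborel) \<longlonglongrightarrow> 0"
    using l1 maximiser_exp_of_integral_eq[OF eq _ \<phi>(1) \<phi>s(1)] \<psi> by (simp add: maximises_loglik_def r_def)
  ultimately show ?thesis using r by blast
qed

lemma nondegenerate_finite_meanD:
  assumes "Q \<in> nondegenerate_distributions \<inter> finite_mean_distributions"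
  shows "real_distribution Q" "integrable Q (\<lambda>x. x)" "\<exists>s>0. spread_at_least s Q"
  using assms nondegenerate_spread by (auto simp: finite_mean_distributions_def)

section \<open>Consistency\<close>

text \<open>The probabilistic input is confined to two quantities: the mean absolute error and the bounded
  Lipschitz distances over a ball around the true regression function. When both are small, the
  estimator exists and is close to the truth. The radius \<open>c\<close> of the ball is fixed in advance because
  an estimator whose likelihood is near the maximum has residuals with bounded mean absolute value.\<close>

lemma consistency_deterministic:
  fixes Qn :: "nat \<Rightarrow> real measure" and M :: "nat \<Rightarrow> ('a \<Rightarrow> real) set" and x :: "nat \<Rightarrow> nat \<Rightarrow> 'a"
  assumes shift: "\<And>n. n \<ge> 1 \<Longrightarrow> shift_invariant n (x n) (M n)"
    and regression: "\<And>n. n \<ge> 1 \<Longrightarrow> \<mu> n \<in> M n"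
    and closed: "\<And>n. n \<ge> 1 \<Longrightarrow> closedin (powertop_real {1..n}) ((\<lambda>m. \<lambda>i\<in>{1..n}. m (x n i)) ` M n)"
    and Qn: "\<And>n. n \<ge> 1 \<Longrightarrow> Qn n \<in> nondegenerate_distributions \<inter> finite_mean_distributions"
      "\<And>n. n \<ge> 1 \<Longrightarrow> (\<integral>t. t \<partial>Qn n) = 0"
    and Q: "Q \<in> nondegenerate_distributions \<inter> finite_mean_distributions" "(\<lambda>n. D1 (Qn n) Q) \<longlonglongrightarrow> 0"
  shows "\<exists>c>0. \<forall>\<delta>>0. \<exists>\<eta>>0. \<exists>N0\<ge>1. \<forall>n\<ge>N0. \<forall>e.
    \<bar>mean_abs n e - (\<integral>t. \<bar>t\<bar> \<partial>Qn n)\<bar> \<le> \<eta> \<and>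
    (\<forall>m\<in>M n. mean_abs n (\<lambda>i. m (x n i) - \<mu> n (x n i)) \<le> c \<longrightarrow>
      D_BL (empirical n (\<lambda>i. \<mu> n (x n i) + e i - m (x n i)))
        (Qn n \<star> empirical n (\<lambda>i. \<mu> n (x n i) - m (x n i))) \<le> \<eta>) \<longrightarrow>
    (\<exists>\<theta>. is_mle n (x n) (M n) (\<lambda>i. \<mu> n (x n i) + e i) \<theta>) \<and>
    (\<forall>\<phi> m. is_mle n (x n) (M n) (\<lambda>i. \<mu> n (x n i) + e i) (\<phi>, m) \<longrightarrow>
      (\<integral>t. \<bar>exp_of \<phi> t - exp_of (psi (Qn n)) t\<bar> \<partial>lborel) \<le> \<delta> \<and>
      mean_abs n (\<lambda>i. m (x n i) - \<mu> n (x n i)) \<le> \<delta>)"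
proof -
  note Q' = nondegenerate_finite_meanD[OF Q(1)]
  note Qn' = nondegenerate_finite_meanD[OF Qn(1)]
  obtain s where s: "s > 0" "spread_at_least s Q" using Q'(3) by blast
  define \<psi> where "\<psi> = psi Q"
  have \<psi>: "maximises_loglik \<psi> Q" unfolding \<psi>_def by (rule psi_maximises[OF Q'(1,2) s])
  define V where "V = loglik \<psi> Q"
  \<comment> \<open>A likelihood of at least \<open>V - 1\<close> leaves residuals of mean size at most \<open>4 e\<^sup>3\<^sup>-\<^sup>V\<close>; the errors add less
    than \<open>\<integral>\<bar>t\<bar> dQ + 1\<close>.\<close>
  define c where "c = 4 * exp (3 - V) + (\<integral>t. \<bar>t\<bar> \<partial>Q) + 1"
  have m1: "(\<integral>t. \<bar>t\<bar> \<partial>Q) \<ge> 0" by simp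
  have c: "c > 0" using m1 exp_gt_zero[of "3 - V"] unfolding c_def by linarith
  define cond where "cond n e \<eta> \<longleftrightarrow> \<bar>mean_abs n e - (\<integral>t. \<bar>t\<bar> \<partial>Qn n)\<bar> \<le> \<eta> \<and>
    (\<forall>m\<in>M n. mean_abs n (\<lambda>i. m (x n i) - \<mu> n (x n i)) \<le> c \<longrightarrow>
      D_BL (empirical n (\<lambda>i. \<mu> n (x n i) + e i - m (x n i)))
        (Qn n \<star> empirical n (\<lambda>i. \<mu> n (x n i) - m (x n i))) \<le> \<eta>)" for n e \<eta>
  define mle where "mle n e \<phi> m \<longleftrightarrow> is_mle n (x n) (M n) (\<lambda>i. \<mu> n (x n i) + e i) (\<phi>, m)" for n e \<phi> m
  define close where "close n \<phi> m \<delta> \<longleftrightarrow> (\<integral>t. \<bar>exp_of \<phi> t - exp_of (psi (Qn n)) t\<bar> \<partial>lborel) \<le> \<delta> \<and>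
      mean_abs n (\<lambda>i. m (x n i) - \<mu> n (x n i)) \<le> \<delta>" for n \<phi> m \<delta>
  have main: "\<exists>\<eta>>0. \<exists>N0\<ge>1. \<forall>n\<ge>N0. \<forall>e. cond n e \<eta> \<longrightarrow> (\<exists>\<phi> m. mle n e \<phi> m) \<and> (\<forall>\<phi> m. mle n e \<phi> m \<longrightarrow> close n \<phi> m \<delta>)"
    if \<delta>: "\<delta> > 0" for \<delta>
  proof (rule ccontr)
    assume neg: "\<not> ?thesis"
    have "\<exists>n e. n \<ge> Suc k \<and> cond n e (1 / real (Suc k)) \<and> \<not> ((\<exists>\<phi> m. mle n e \<phi> m) \<and> (\<forall>\<phi> m. mle n e \<phi> m \<longrightarrow> close n \<phi> m \<delta>))" for k
    proof (rule ccontr)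
      assume "\<not> ?thesis"
      then have "\<forall>n\<ge>Suc k. \<forall>e. cond n e (1 / real (Suc k)) \<longrightarrow> (\<exists>\<phi> m. mle n e \<phi> m) \<and> (\<forall>\<phi> m. mle n e \<phi> m \<longrightarrow> close n \<phi> m \<delta>)" by blast
      moreover have "1 / real (Suc k) > 0" "Suc k \<ge> 1" by auto
      ultimately show False using neg by blast
    qed
    then obtain n e where nk: "\<And>k. n k \<ge> Suc k" and cnd: "\<And>k. cond (n k) (e k) (1 / real (Suc k))"
      and bad: "\<And>k. \<not> ((\<exists>\<phi> m. mle (n k) (e k) \<phi> m) \<and> (\<forall>\<phi> m. mle (n k) (e k) \<phi> m \<longrightarrow> close (n k) \<phi> m \<delta>))" by metis
    have n1: "n k \<ge> 1" for k using nk[of k] by simp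
    have nlim: "filterlim n at_top sequentially"
      by (rule filterlim_at_top_mono[OF filterlim_Suc]) (use nk in auto)
    have inv0: "(\<lambda>k. 1 / real (Suc k)) \<longlonglongrightarrow> 0"
      using LIMSEQ_inverse_real_of_nat by (simp add: inverse_eq_divide)
    define A where "A k = Qn (n k)" for k
    note A = Qn'(1)[OF n1, folded A_def] Qn'(2)[OF n1, folded A_def]
    have A0: "(\<integral>t. t \<partial>A k) = 0" for k unfolding A_def by (rule Qn(2)[OF n1])
    have DA: "(\<lambda>k. D1 (A k) Q) \<longlonglongrightarrow> 0" unfolding A_def using filterlim_compose[OF Q(2) nlim] by (simp add: o_def)
    note wA = D1_weak_conv[OF DA A(1) Q'(1)]
    have mA: "(\<lambda>k. \<integral>t. \<bar>t\<bar> \<partial>A k) \<longlonglongrightarrow> (\<integral>t. \<bar>t\<bar> \<partial>Q)"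
      by (rule D1_approx[OF DA A(1) Q'(1)]) (use A(2) Q'(2) in auto)
    have "(\<lambda>k. \<integral>t. t \<partial>A k) \<longlonglongrightarrow> (\<integral>t. t \<partial>Q)"
      by (rule D1_approx[OF DA A(1) Q'(1)]) (use A(2) Q'(2) in auto)
    then have Q0: "(\<integral>t. t \<partial>Q) = 0" by (simp add: A0 LIMSEQ_const_iff)
    have mE: "(\<lambda>k. mean_abs (n k) (e k)) \<longlonglongrightarrow> (\<integral>t. \<bar>t\<bar> \<partial>Q)"
    proof -
      have "(\<lambda>k. mean_abs (n k) (e k) - (\<integral>t. \<bar>t\<bar> \<partial>A k)) \<longlonglongrightarrow> 0"
        using inv0 by (rule Lim_null_comparison[rotated]) (use cnd in \<open>auto simp: cond_def A_def\<close>)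
      from tendsto_add[OF this mA] show ?thesis by simp
    qed
    have DBL: "D_BL (empirical (n k) (\<lambda>i. e k i - (m (x (n k) i) - \<mu> (n k) (x (n k) i))))
        (A k \<star> empirical (n k) (\<lambda>i. - (m (x (n k) i) - \<mu> (n k) (x (n k) i)))) \<le> 1 / real (Suc k)"
      if "m \<in> M (n k)" "mean_abs (n k) (\<lambda>i. m (x (n k) i) - \<mu> (n k) (x (n k) i)) \<le> c" for m k
    proof -
      have "(\<lambda>i. e k i - (m (x (n k) i) - \<mu> (n k) (x (n k) i))) = (\<lambda>i. \<mu> (n k) (x (n k) i) + e k i - m (x (n k) i))"
        by (simp add: algebra_simps)
      then show ?thesis using cnd[of k] that unfolding cond_def A_def by simp
    qed
    have rdE: "real_distribution (empirical (n k) v)" for k v by (rule real_distribution_empirical[OF n1])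
    have wE: "weak_conv_m (\<lambda>k. empirical (n k) (e k)) Q"
    proof (rule weak_conv_BL[OF rdE A(1) Q'(1) _ inv0 levy_continuity1[OF A(1) Q'(1) wA]])
      fix k h assume h: "h \<in> H_BL"
      have "D_BL (empirical (n k) (e k)) (A k) \<le> 1 / real (Suc k)"
        using DBL[OF regression[OF n1], of k] c convolution_empirical_zero[OF A(1) n1] by (simp add: mean_abs_def)
      then show "\<bar>(\<integral>x. h x \<partial>empirical (n k) (e k)) - (\<integral>x. h x \<partial>A k)\<bar> \<le> 1 / real (Suc k)"
        using H_BL_diff_le_D_BL[OF rdE A(1) h, of k "e k" k] by linarith
    qed
    have iE: "integrable (empirical N v) (\<lambda>t. t)" for N v by (rule integrable_empirical) simp
    have ev_mE: "\<forall>\<^sub>F k in sequentially. mean_abs (n k) (e k) < (\<integral>t. \<bar>t\<bar> \<partial>Q) + 1"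
      by (rule order_tendstoD(2)[OF mE]) simp
    have ev_inv: "\<forall>\<^sub>F k in sequentially. 1 / real (Suc k) < s / 2"
      by (rule order_tendstoD(2)[OF inv0]) (use s in simp)
    have ev_D1: "\<forall>\<^sub>F k in sequentially. D1 (A k) Q < ennreal (s / 2)"
      by (rule order_tendstoD(2)[OF DA]) (use s in simp)
    \<comment> \<open>An exact fit would make the residuals zero, although they are close to a law with spread \<open>s/2\<close>.\<close>
    have ex: "\<forall>\<^sub>F k in sequentially. \<exists>\<phi> m. mle (n k) (e k) \<phi> m"
      using ev_mE ev_inv ev_D1
    proof eventually_elim
      case (elim k)
      have spA: "spread_at_least (s / 2) (A k)"
        unfolding spread_at_least_def
      proof
        fix x0
        have "\<bar>(\<integral>x. min 1 \<bar>x - x0\<bar> \<partial>A k) - (\<integral>x. min 1 \<bar>x - x0\<bar> \<partial>Q)\<bar> \<le> s / 2"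
          by (rule D1_lipschitz[OF A(1) Q'(1) elim(3) _ H_BL_D(2)[OF H_BL_truncated_distance]
            H_BL_integrable[OF A(1) H_BL_truncated_distance] H_BL_integrable[OF Q'(1) H_BL_truncated_distance]])
            (use s in simp)
        moreover have "s \<le> (\<integral>x. min 1 \<bar>x - x0\<bar> \<partial>Q)" using s(2) by (simp add: spread_at_least_def)
        ultimately show "s / 2 \<le> (\<integral>x. min 1 \<bar>x - x0\<bar> \<partial>A k)" by linarith
      qed
      have "\<not> (\<exists>m\<in>M (n k). \<forall>i\<in>{1..n k}. m (x (n k) i) = \<mu> (n k) (x (n k) i) + e k i)"
      proof
        assume "\<exists>m\<in>M (n k). \<forall>i\<in>{1..n k}. m (x (n k) i) = \<mu> (n k) (x (n k) i) + e k i"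
        then obtain m where m: "m \<in> M (n k)" "\<And>i. i \<in> {1..n k} \<Longrightarrow> m (x (n k) i) = \<mu> (n k) (x (n k) i) + e k i" by blast
        let ?d = "\<lambda>i. m (x (n k) i) - \<mu> (n k) (x (n k) i)"
        have "mean_abs (n k) ?d = mean_abs (n k) (e k)" unfolding mean_abs_def using m(2) by simp
        also have "\<dots> \<le> c" using elim(1) exp_gt_zero[of "3 - V"] unfolding c_def by linarith
        finally have D: "D_BL (empirical (n k) (\<lambda>i. e k i - ?d i)) (A k \<star> empirical (n k) (\<lambda>i. - ?d i)) \<le> 1 / real (Suc k)"
          by (rule DBL[OF m(1)])
        have E0: "empirical (n k) (\<lambda>i. e k i - ?d i) = empirical (n k) (\<lambda>i. 0)"
          by (rule empirical_cong) (simp add: m(2))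
        have rdC: "real_distribution (A k \<star> empirical (n k) (\<lambda>i. - ?d i))"
          by (rule real_distribution_convolution[OF A(1) rdE])
        have "spread_at_least (s / 2) (A k \<star> empirical (n k) (\<lambda>i. - ?d i))"
          by (rule spread_convolution[OF A(1) rdE _ spA]) (use s in simp)
        then have "s / 2 \<le> (\<integral>x. min 1 \<bar>x - 0\<bar> \<partial>(A k \<star> empirical (n k) (\<lambda>i. - ?d i)))"
          unfolding spread_at_least_def by (rule spec)
        moreover have "(\<integral>x. min 1 \<bar>x - 0\<bar> \<partial>empirical (n k) (\<lambda>i. 0)) = 0"
          by (subst integral_empirical) auto
        moreover have "\<bar>(\<integral>x. min 1 \<bar>x - 0\<bar> \<partial>empirical (n k) (\<lambda>i. 0)) - (\<integral>x. min 1 \<bar>x - 0\<bar> \<partial>(A k \<star> empirical (n k) (\<lambda>i. - ?d i)))\<bar> \<le> 1 / real (Suc k)"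
          using H_BL_diff_le_D_BL[OF rdE rdC H_BL_truncated_distance[of 0], of k "\<lambda>i. 0"] D unfolding E0 by linarith
        ultimately show False using elim(2) by linarith
      qed
      from is_mle_exists[OF n1 shift[OF n1] closed[OF n1] _ this]
      have "\<exists>\<theta>. is_mle (n k) (x (n k)) (M (n k)) (\<lambda>i. \<mu> (n k) (x (n k) i) + e k i) \<theta>"
        using regression[OF n1] by blast
      then show ?case unfolding mle_def by auto
    qed
    define bad_pair where "bad_pair k \<phi> m \<longleftrightarrow> mle (n k) (e k) \<phi> m \<and> \<not> close (n k) \<phi> m \<delta>" for k \<phi> m
    have ev_lsc: "\<forall>\<^sub>F k in sequentially. \<exists>\<theta>\<in>Phi. mass \<theta> = 1 \<and> log_integrable \<theta> (empirical (n k) (e k)) \<and> V - 1 \<le> loglik \<theta> (empirical (n k) (e k))"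
      unfolding V_def using maximum_lsc[OF \<psi> Q'(1,2) rdE iE wE] mE unfolding mean_abs_empirical by simp
    from ex ev_lsc ev_mE have "\<forall>\<^sub>F k in sequentially. \<exists>\<phi> m. bad_pair k \<phi> m \<and> mean_abs (n k) (\<lambda>i. m (x (n k) i) - \<mu> (n k) (x (n k) i)) \<le> c"
    proof eventually_elim
      case (elim k)
      then obtain \<phi> m where bp: "bad_pair k \<phi> m" using bad[of k] unfolding bad_pair_def by blast
      then have mle: "is_mle (n k) (x (n k)) (M (n k)) (\<lambda>i. \<mu> (n k) (x (n k) i) + e k i) (\<phi>, m)"
        by (simp add: bad_pair_def mle_def)
      let ?y = "\<lambda>i. \<mu> (n k) (x (n k) i) + e k i"
      note F = is_mle_maximises[OF n1 shift[OF n1] mle]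
      obtain \<theta> where \<theta>: "\<theta> \<in> Phi" "mass \<theta> = 1" "log_integrable \<theta> (empirical (n k) (e k))" "V - 1 \<le> loglik \<theta> (empirical (n k) (e k))"
        using elim(2) by blast
      have "V - 1 \<le> loglik \<phi> (empirical (n k) (\<lambda>i. ?y i - m (x (n k) i)))"
        using F(4)[OF regression[OF n1] \<theta>(1,2)] \<theta>(3,4) by simp
      then have "exp (2 - loglik \<phi> (empirical (n k) (\<lambda>i. ?y i - m (x (n k) i)))) \<le> exp (3 - V)" by simp
      moreover have "mean_abs (n k) (\<lambda>i. ?y i - m (x (n k) i)) \<le> 4 * exp (2 - loglik \<phi> (empirical (n k) (\<lambda>i. ?y i - m (x (n k) i))))"
        by (rule is_mle_centred[OF n1 shift[OF n1] mle])
      moreover have "mean_abs (n k) (\<lambda>i. m (x (n k) i) - \<mu> (n k) (x (n k) i)) \<le> mean_abs (n k) (e k) + mean_abs (n k) (\<lambda>i. ?y i - m (x (n k) i))"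
      proof -
        have "(\<Sum>i=1..n k. \<bar>m (x (n k) i) - \<mu> (n k) (x (n k) i)\<bar>) \<le> (\<Sum>i=1..n k. \<bar>e k i\<bar> + \<bar>?y i - m (x (n k) i)\<bar>)"
          by (rule sum_mono) linarith
        then show ?thesis unfolding mean_abs_def distrib_left[symmetric] sum.distrib[symmetric]
          by (intro mult_left_mono) auto
      qed
      ultimately have "mean_abs (n k) (\<lambda>i. m (x (n k) i) - \<mu> (n k) (x (n k) i)) \<le> c"
        using elim(3) unfolding c_def by linarith
      with bp show ?case by blast
    qed
    then obtain k0 where "\<And>k. k \<ge> k0 \<Longrightarrow> \<exists>\<phi> m. bad_pair k \<phi> m \<and> mean_abs (n k) (\<lambda>i. m (x (n k) i) - \<mu> (n k) (x (n k) i)) \<le> c"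
      unfolding eventually_sequentially by blast
    then have "\<forall>k. \<exists>\<phi> m. bad_pair (k + k0) \<phi> m \<and> mean_abs (n (k + k0)) (\<lambda>i. m (x (n (k + k0)) i) - \<mu> (n (k + k0)) (x (n (k + k0)) i)) \<le> c"
      by simp
    then obtain \<phi>s ms where bp: "\<And>k. bad_pair (k + k0) (\<phi>s k) (ms k)"
      and mc: "\<And>k. mean_abs (n (k + k0)) (\<lambda>i. ms k (x (n (k + k0)) i) - \<mu> (n (k + k0)) (x (n (k + k0)) i)) \<le> c" by metis
    define N where "N k = n (k + k0)" for k
    define e' where "e' k = e (k + k0)" for k
    define d where "d k i = ms k (x (N k) i) - \<mu> (N k) (x (N k) i)" for k i
    have N1: "N k \<ge> 1" for k unfolding N_def by (rule n1)
    have off: "strict_mono (\<lambda>k. k + k0)" by (simp add: strict_mono_def)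
    have mle: "is_mle (N k) (x (N k)) (M (N k)) (\<lambda>i. \<mu> (N k) (x (N k) i) + e' k i) (\<phi>s k, ms k)" for k
      using bp[of k] by (simp add: bad_pair_def mle_def N_def e'_def)
    note F = is_mle_maximises[OF N1 shift[OF N1] mle]
    have res: "(\<lambda>i. \<mu> (N k) (x (N k) i) + e' k i - ms k (x (N k) i)) = (\<lambda>i. e' k i - d k i)" for k
      by (simp add: d_def algebra_simps)
    have "\<exists>r. strict_mono (r :: nat \<Rightarrow> nat) \<and> (\<lambda>k. mean_abs (N (r k)) (d (r k))) \<longlonglongrightarrow> 0 \<and>
      (\<lambda>k. \<integral>x. \<bar>exp_of (\<phi>s (r k)) x - exp_of \<psi> x\<bar> \<partial>lborel) \<longlonglongrightarrow> 0"
    proof (rule estimator_limit[where A = "\<lambda>k. A (k + k0)" and e = e' and d = d, OF \<psi> Q'(1,2) Q0 s N1])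
      show "real_distribution (A (k + k0))" for k by (rule A(1))
      show "weak_conv_m (\<lambda>k. A (k + k0)) Q" by (rule weak_conv_subseq[OF wA off])
      show "weak_conv_m (\<lambda>k. empirical (N k) (e' k)) Q" unfolding N_def e'_def by (rule weak_conv_subseq[OF wE off])
      show "(\<lambda>k. mean_abs (N k) (e' k)) \<longlonglongrightarrow> (\<integral>x. \<bar>x\<bar> \<partial>Q)"
        unfolding N_def e'_def using LIMSEQ_ignore_initial_segment[OF mE] by simp
      show "(\<lambda>k. D_BL (empirical (N k) (\<lambda>i. e' k i - d k i)) (A (k + k0) \<star> empirical (N k) (\<lambda>i. - d k i))) \<longlonglongrightarrow> 0"
      proof (rule Lim_null_comparison[OF always_eventually])
        have nn: "0 \<le> D_BL B C" if "real_distribution B" "real_distribution C" for B C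
          using H_BL_diff_le_D_BL[OF that H_BL_truncated_distance[of 0]] by linarith
        show "\<forall>k. norm (D_BL (empirical (N k) (\<lambda>i. e' k i - d k i)) (A (k + k0) \<star> empirical (N k) (\<lambda>i. - d k i))) \<le> 1 / real (Suc (k + k0))"
        proof
          fix k
          have "D_BL (empirical (N k) (\<lambda>i. e' k i - d k i)) (A (k + k0) \<star> empirical (N k) (\<lambda>i. - d k i)) \<le> 1 / real (Suc (k + k0))"
            using DBL[of "ms k" "k + k0"] F(1)[of k] mc[of k] by (simp add: N_def e'_def d_def)
          moreover have "0 \<le> D_BL (empirical (N k) (\<lambda>i. e' k i - d k i)) (A (k + k0) \<star> empirical (N k) (\<lambda>i. - d k i))"
            by (intro nn real_distribution_convolution A(1) real_distribution_empirical[OF N1])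
          ultimately show "norm (D_BL (empirical (N k) (\<lambda>i. e' k i - d k i)) (A (k + k0) \<star> empirical (N k) (\<lambda>i. - d k i))) \<le> 1 / real (Suc (k + k0))"
            by simp
        qed
        show "(\<lambda>k. 1 / real (Suc (k + k0))) \<longlonglongrightarrow> 0" using LIMSEQ_ignore_initial_segment[OF inv0] by simp
      qed
      show "mean_abs (N k) (d k) \<le> c" for k using mc[of k] by (simp add: N_def d_def[abs_def])
      show "\<phi>s k \<in> Phi" "mass (\<phi>s k) = 1" "log_integrable (\<phi>s k) (empirical (N k) (\<lambda>i. e' k i - d k i))" for k
        using F(2)[of k] unfolding res by (auto simp: maximises_loglik_def)
      show "(\<integral>t. t * exp_of (\<phi>s k) t \<partial>lborel) = 0" for k by (rule F(3))
      show "loglik \<theta> (empirical (N k) (e' k)) \<le> loglik (\<phi>s k) (empirical (N k) (\<lambda>i. e' k i - d k i))"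
        if "\<theta> \<in> Phi" "mass \<theta> = 1" "log_integrable \<theta> (empirical (N k) (e' k))" for k \<theta>
        using F(4)[OF regression[OF N1] that(1,2), of k] that(3) unfolding res by simp
    qed
    then obtain r where r: "strict_mono (r :: nat \<Rightarrow> nat)" and rd: "(\<lambda>k. mean_abs (N (r k)) (d (r k))) \<longlonglongrightarrow> 0"
      and r\<phi>: "(\<lambda>k. \<integral>x. \<bar>exp_of (\<phi>s (r k)) x - exp_of \<psi> x\<bar> \<partial>lborel) \<longlonglongrightarrow> 0" by blast
    define q where "q k = r k + k0" for k
    have q: "strict_mono q" using r by (simp add: q_def strict_mono_def)
    have max\<psi>: "maximises_loglik (psi (A k)) (A k)" for k
      using Qn'(3)[OF n1, of k] psi_maximises[OF A(1,2)] unfolding A_def by blast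
    have "\<exists>r'. strict_mono (r' :: nat \<Rightarrow> nat) \<and> (\<lambda>k. \<integral>x. \<bar>exp_of (psi (A (q (r' k)))) x - exp_of \<psi> x\<bar> \<partial>lborel) \<longlonglongrightarrow> 0"
      by (rule maximiser_continuous[OF \<psi> Q'(1,2) s A(1) A(2) weak_conv_subseq[OF wA q] _ max\<psi>])
        (use LIMSEQ_subseq_LIMSEQ[OF mA q] in \<open>simp add: o_def\<close>)
    then obtain r' where r': "strict_mono (r' :: nat \<Rightarrow> nat)"
      and l: "(\<lambda>k. \<integral>x. \<bar>exp_of (psi (A (q (r' k)))) x - exp_of \<psi> x\<bar> \<partial>lborel) \<longlonglongrightarrow> 0" by blast
    have "\<forall>\<^sub>F k in sequentially. (\<integral>x. \<bar>exp_of (psi (A (q (r' k)))) x - exp_of \<psi> x\<bar> \<partial>lborel) < \<delta> / 2"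
      by (rule order_tendstoD(2)[OF l]) (use \<delta> in simp)
    moreover have "\<forall>\<^sub>F k in sequentially. (\<integral>x. \<bar>exp_of (\<phi>s (r (r' k))) x - exp_of \<psi> x\<bar> \<partial>lborel) < \<delta> / 2"
      using order_tendstoD(2)[OF LIMSEQ_subseq_LIMSEQ[OF r\<phi> r'], of "\<delta> / 2"] \<delta> by (simp add: o_def)
    moreover have "\<forall>\<^sub>F k in sequentially. mean_abs (N (r (r' k))) (d (r (r' k))) < \<delta>"
      using order_tendstoD(2)[OF LIMSEQ_subseq_LIMSEQ[OF rd r'], of "\<delta>"] \<delta> by (simp add: o_def)
    ultimately have "\<forall>\<^sub>F k in sequentially. close (n (q (r' k))) (\<phi>s (r (r' k))) (ms (r (r' k))) \<delta>"
    proof eventually_elim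
      case (elim k)
      let ?f = "exp_of (\<phi>s (r (r' k)))" and ?g = "exp_of (psi (A (q (r' k))))"
      have i: "integrable lborel ?f" "integrable lborel ?g" "integrable lborel (exp_of \<psi>)"
        using exp_of_integrable(1) F(2)[of "r (r' k)"] max\<psi>[of "q (r' k)"] \<psi> unfolding maximises_loglik_def by blast+
      have "(\<integral>x. \<bar>?f x - ?g x\<bar> \<partial>lborel) \<le> (\<integral>x. \<bar>?f x - exp_of \<psi> x\<bar> + \<bar>?g x - exp_of \<psi> x\<bar> \<partial>lborel)"
        using i by (intro integral_mono) auto
      also have "\<dots> = (\<integral>x. \<bar>?f x - exp_of \<psi> x\<bar> \<partial>lborel) + (\<integral>x. \<bar>?g x - exp_of \<psi> x\<bar> \<partial>lborel)"
        using i by simp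
      finally show ?case using elim unfolding close_def by (simp add: A_def N_def q_def d_def[abs_def])
    qed
    then obtain k where "close (n (q (r' k))) (\<phi>s (r (r' k))) (ms (r (r' k))) \<delta>" by (auto simp: eventually_sequentially)
    then show False using bp[of "r (r' k)"] by (simp add: bad_pair_def q_def)
  qed
  have ex: "(\<exists>\<theta>. is_mle n (x n) (M n) (\<lambda>i. \<mu> n (x n i) + e i) \<theta>) \<longleftrightarrow> (\<exists>\<phi> m. mle n e \<phi> m)" for n e
    unfolding mle_def by auto
  show ?thesis
    unfolding ex using c main unfolding cond_def mle_def close_def by blast
qed

section \<open>Events of probability tending to one\<close>

lemma asymptotic_probability_oneI:
  assumes P: "\<And>n. prob_space (P n)" and A: "\<And>n. A n \<in> sets (P n)" "(\<lambda>n. measure (P n) (A n)) \<longlonglongrightarrow> 1"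
    and sub: "\<And>n. n \<ge> N0 \<Longrightarrow> A n \<subseteq> E n"
  shows "asymptotic_probability_one P E"
  unfolding asymptotic_probability_one_def
proof (intro exI[of _ "\<lambda>n. if n \<ge> N0 then A n else {}"] conjI allI)
  show "(if n \<ge> N0 then A n else {}) \<in> sets (P n)" "(if n \<ge> N0 then A n else {}) \<subseteq> E n" for n
    using A(1) sub by auto
  have "\<forall>\<^sub>F n in sequentially. measure (P n) (A n) = measure (P n) (if n \<ge> N0 then A n else {})"
    using eventually_ge_at_top[of N0] by eventually_elim simp
  then show "(\<lambda>n. measure (P n) (if n \<ge> N0 then A n else {})) \<longlonglongrightarrow> 1"
    using A(2) by (rule Lim_transform_eventually[rotated])
qed

lemma measure_inter_tendsto_1:
  assumes P: "\<And>n. prob_space (P n)" and A: "\<And>n. A n \<in> sets (P n)" "(\<lambda>n. measure (P n) (A n)) \<longlonglongrightarrow> 1"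
    and B: "\<And>n. B n \<in> sets (P n)" "(\<lambda>n. measure (P n) (B n)) \<longlonglongrightarrow> 1"
  shows "(\<lambda>n. measure (P n) (A n \<inter> B n)) \<longlonglongrightarrow> 1"
proof (rule tendsto_sandwich[of "\<lambda>n. measure (P n) (A n) + measure (P n) (B n) - 1" _ _ "\<lambda>_. 1"])
  have "measure (P n) (A n) + measure (P n) (B n) - 1 \<le> measure (P n) (A n \<inter> B n)" for n
  proof -
    interpret prob_space "P n" by (rule P)
    have "prob (A n \<union> B n) = prob (A n) + prob (B n) - prob (A n \<inter> B n)"
      by (rule measure_Un3) (use A B in \<open>auto simp: fmeasurable_eq_sets\<close>)
    then show ?thesis using prob_le_1[of "A n \<union> B n"] by linarith
  qed
  then show "\<forall>\<^sub>F n in sequentially. measure (P n) (A n) + measure (P n) (B n) - 1 \<le> measure (P n) (A n \<inter> B n)" by simp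
  show "\<forall>\<^sub>F n in sequentially. measure (P n) (A n \<inter> B n) \<le> 1" by (simp add: prob_space.prob_le_1[OF P])
  show "(\<lambda>n. measure (P n) (A n) + measure (P n) (B n) - 1) \<longlonglongrightarrow> 1"
    using tendsto_diff[OF tendsto_add[OF A(2) B(2)] tendsto_const[of 1]] by simp
qed simp

text \<open>A weak law of large numbers for \<open>\<bar>\<epsilon>\<^sub>i\<bar>\<close>: the truncated means are controlled by the bounded Lipschitz
  distance, the rest has small expectation, uniformly in large \<open>n\<close> because \<open>Q\<^sub>n\<close> converges in \<open>D\<^sub>1\<close>.\<close>

lemma mean_abs_error_concentrates:
  fixes \<epsilon> :: "nat \<Rightarrow> nat \<Rightarrow> 'w \<Rightarrow> real"
  assumes P: "\<And>n. prob_space (P n)"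
    and meas: "\<And>n i. n \<ge> 1 \<Longrightarrow> i \<in> {1..n} \<Longrightarrow> \<epsilon> n i \<in> borel_measurable (P n)"
    and distr: "\<And>n i. n \<ge> 1 \<Longrightarrow> i \<in> {1..n} \<Longrightarrow> distr (P n) borel (\<epsilon> n i) = Qn n"
    and Qn: "\<And>n. n \<ge> 1 \<Longrightarrow> real_distribution (Qn n)" "\<And>n. n \<ge> 1 \<Longrightarrow> integrable (Qn n) (\<lambda>x. x)"
    and Q: "real_distribution Q" "integrable Q (\<lambda>x. x)" "(\<lambda>n. D1 (Qn n) Q) \<longlonglongrightarrow> 0"
    and BL: "\<And>\<delta>. \<delta> > 0 \<Longrightarrow> \<exists>A. (\<forall>n. A n \<in> sets (P n)) \<and> (\<lambda>n. measure (P n) (A n)) \<longlonglongrightarrow> 1 \<and>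
      (\<forall>n\<ge>1. \<forall>\<omega>\<in>A n. \<forall>h\<in>H_BL. \<bar>(\<integral>x. h x \<partial>empirical n (\<lambda>i. \<epsilon> n i \<omega>)) - (\<integral>x. h x \<partial>Qn n)\<bar> \<le> \<delta>)"
    and \<eta>: "\<eta> > 0"
  defines "B \<equiv> \<lambda>n. {\<omega> \<in> space (P n). \<bar>mean_abs n (\<lambda>i. \<epsilon> n i \<omega>) - (\<integral>x. \<bar>x\<bar> \<partial>Qn n)\<bar> \<le> \<eta>}"
  shows "\<And>n. n \<ge> 1 \<Longrightarrow> B n \<in> sets (P n)" "(\<lambda>n. measure (P n) (B n)) \<longlonglongrightarrow> 1"
proof -
  show Bs: "B n \<in> sets (P n)" if n: "n \<ge> 1" for n
  proof -
    have "(\<lambda>\<omega>. mean_abs n (\<lambda>i. \<epsilon> n i \<omega>)) \<in> borel_measurable (P n)"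
      unfolding mean_abs_def by (intro borel_measurable_times borel_measurable_const borel_measurable_sum borel_measurable_abs meas[OF n])
    then show ?thesis unfolding B_def by measurable
  qed
  have low: "\<forall>\<^sub>F n in sequentially. 1 - \<theta> < measure (P n) (B n)" if \<theta>: "\<theta> > 0" for \<theta>
  proof -
    \<comment> \<open>\<open>\<eta>/8\<close> keeps the bias of truncation below \<open>\<eta>/4\<close>; \<open>\<theta>\<eta>/16\<close> is what Markov's inequality needs at level \<open>\<eta>/2\<close>.\<close>
    define \<kappa> where "\<kappa> = min (\<eta> / 8) (\<theta> * \<eta> / 16)"
    have \<kappa>: "\<kappa> > 0" "2 * \<kappa> \<le> \<eta> / 4" "2 * \<kappa> / (\<eta> / 2) \<le> \<theta> / 4"
      using \<eta> \<theta> by (auto simp: \<kappa>_def field_simps min_def)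
    have "\<forall>\<^sub>F K in sequentially. (\<integral>x. \<bar>x\<bar> - min (real K) \<bar>x\<bar> \<partial>Q) < \<kappa>"
      by (rule order_tendstoD(2)[OF truncated_tail_tendsto[OF Q(1,2)] \<kappa>(1)])
    then have "\<forall>\<^sub>F K in sequentially. (\<integral>x. \<bar>x\<bar> - min (real K) \<bar>x\<bar> \<partial>Q) < \<kappa> \<and> K \<ge> 1"
      using eventually_ge_at_top[of 1] by eventually_elim simp
    then obtain K0 :: nat where K0: "(\<integral>x. \<bar>x\<bar> - min (real K0) \<bar>x\<bar> \<partial>Q) < \<kappa>" "K0 \<ge> 1" by (auto simp: eventually_sequentially)
    define K where "K = real K0"
    have K: "(\<integral>x. \<bar>x\<bar> - min K \<bar>x\<bar> \<partial>Q) < \<kappa>" "K \<ge> 1" using K0 by (auto simp: K_def)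
    define \<tau> where "\<tau> n = (\<integral>x. \<bar>x\<bar> - min K \<bar>x\<bar> \<partial>Qn n)" for n
    have ti: "integrable M (\<lambda>x. \<bar>x\<bar> - min K \<bar>x\<bar>)" if "real_distribution M" "integrable M (\<lambda>x. x)" for M
      using integrable_truncated[OF that(1), of K] that(2) by simp
    define \<delta> where "\<delta> = \<eta> / (4 * K)"
    have \<delta>: "\<delta> > 0" "K * \<delta> = \<eta> / 4" using \<eta> K by (auto simp: \<delta>_def)
    obtain A where A: "\<And>n. A n \<in> sets (P n)" "(\<lambda>n. measure (P n) (A n)) \<longlonglongrightarrow> 1"
      and Ah: "\<And>n \<omega> h. n \<ge> 1 \<Longrightarrow> \<omega> \<in> A n \<Longrightarrow> h \<in> H_BL \<Longrightarrow> \<bar>(\<integral>x. h x \<partial>empirical n (\<lambda>i. \<epsilon> n i \<omega>)) - (\<integral>x. h x \<partial>Qn n)\<bar> \<le> \<delta>"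
      using BL[OF \<delta>(1)] by blast
    have "\<forall>\<^sub>F n in sequentially. D1 (Qn n) Q < ennreal \<kappa>"
      by (rule order_tendstoD(2)[OF Q(3)]) (use \<kappa> in simp)
    moreover have "\<forall>\<^sub>F n in sequentially. 1 - \<theta> / 2 < measure (P n) (A n)"
      by (rule order_tendstoD(1)[OF A(2)]) (use \<theta> in simp)
    ultimately show ?thesis
      using eventually_ge_at_top[of 1]
    proof eventually_elim
      case (elim n)
      interpret prob_space "P n" by (rule P)
      have n: "n \<ge> 1" by (rule elim(3))
      note [measurable] = meas[OF n]
      have "\<bar>\<tau> n - (\<integral>x. \<bar>x\<bar> - min K \<bar>x\<bar> \<partial>Q)\<bar> \<le> \<kappa>"
        unfolding \<tau>_def
      proof (rule D1_lipschitz[OF Qn(1)[OF n] Q(1) elim(1) _ _ ti[OF Qn[OF n]] ti[OF Q(1,2)]])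
        show "\<bar>\<bar>x\<bar> - min K \<bar>x\<bar> - (\<bar>y\<bar> - min K \<bar>y\<bar>)\<bar> \<le> \<bar>x - y\<bar>" for x y by linarith
      qed (use \<kappa> in simp)
      then have \<tau>2: "\<tau> n < 2 * \<kappa>" using K(1) by linarith
      have \<tau>0: "0 \<le> \<tau> n" unfolding \<tau>_def by (rule integral_nonneg_AE) simp
      define Z where "Z \<omega> = (1 / real n) * (\<Sum>i=1..n. \<bar>\<epsilon> n i \<omega>\<bar> - min K \<bar>\<epsilon> n i \<omega>\<bar>)" for \<omega>
      have Zi: "integrable (P n) (\<lambda>\<omega>. \<bar>\<epsilon> n i \<omega>\<bar> - min K \<bar>\<epsilon> n i \<omega>\<bar>)"
        "expectation (\<lambda>\<omega>. \<bar>\<epsilon> n i \<omega>\<bar> - min K \<bar>\<epsilon> n i \<omega>\<bar>) = \<tau> n" if i: "i \<in> {1..n}" for i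
      proof -
        note m = meas[OF n i]
        show "integrable (P n) (\<lambda>\<omega>. \<bar>\<epsilon> n i \<omega>\<bar> - min K \<bar>\<epsilon> n i \<omega>\<bar>)"
          using ti[OF Qn[OF n]] m unfolding distr[OF n i, symmetric] by (subst (asm) integrable_distr_eq) auto
        show "expectation (\<lambda>\<omega>. \<bar>\<epsilon> n i \<omega>\<bar> - min K \<bar>\<epsilon> n i \<omega>\<bar>) = \<tau> n"
          using m unfolding \<tau>_def distr[OF n i, symmetric] by (subst integral_distr) auto
      qed
      have iZ: "integrable (P n) Z" unfolding Z_def using Zi(1) by (intro integrable_mult_right integrable_sum) auto
      have EZ: "expectation Z = \<tau> n"
        unfolding Z_def using Zi n by (simp add: Bochner_Integration.integral_sum del: Bochner_Integration.integral_diff)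
      have [measurable]: "Z \<in> borel_measurable (P n)" using iZ by simp
      define C where "C = {\<omega> \<in> space (P n). \<eta> / 2 \<le> Z \<omega>}"
      have Cs: "C \<in> sets (P n)" unfolding C_def by measurable
      have Z0: "0 \<le> Z \<omega>" for \<omega> unfolding Z_def by (intro mult_nonneg_nonneg sum_nonneg) auto
      have "prob C \<le> expectation Z / (\<eta> / 2)"
        unfolding C_def by (rule integral_Markov_inequality_measure[OF iZ, of "{}"]) (use Z0 \<eta> in auto)
      also have "\<dots> \<le> 2 * \<kappa> / (\<eta> / 2)" unfolding EZ using \<tau>2 \<eta> by (intro divide_right_mono) auto
      also have "\<dots> \<le> \<theta> / 4" by (rule \<kappa>(3))
      finally have PC: "prob C \<le> \<theta> / 4" .
      have "A n - C \<subseteq> B n"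
      proof
        fix \<omega> assume \<omega>: "\<omega> \<in> A n - C"
        then have sp: "\<omega> \<in> space (P n)" using sets.sets_into_space[OF A(1)[of n]] by blast
        have Zl: "Z \<omega> < \<eta> / 2" using \<omega> sp by (auto simp: C_def)
        have hK: "(\<lambda>x. min K \<bar>x\<bar> / K) \<in> H_BL"
        proof (rule H_BL_scaleI[OF K(2)])
          show "\<bar>min K \<bar>x\<bar>\<bar> \<le> K" for x using K(2) by linarith
          show "\<bar>min K \<bar>x\<bar> - min K \<bar>y\<bar>\<bar> \<le> K * \<bar>x - y\<bar>" for x y
          proof -
            have "\<bar>min K u - min K v\<bar> \<le> \<bar>u - v\<bar>" for u v by (simp add: min_def)
            then have "\<bar>min K \<bar>x\<bar> - min K \<bar>y\<bar>\<bar> \<le> \<bar>\<bar>x\<bar> - \<bar>y\<bar>\<bar>" .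
            also have "\<dots> \<le> 1 * \<bar>x - y\<bar>" using abs_triangle_ineq3[of x y] by simp
            also have "\<dots> \<le> K * \<bar>x - y\<bar>" using K(2) by (intro mult_right_mono) auto
            finally show ?thesis .
          qed
        qed
        have "\<bar>(\<integral>x. min K \<bar>x\<bar> / K \<partial>empirical n (\<lambda>i. \<epsilon> n i \<omega>)) - (\<integral>x. min K \<bar>x\<bar> / K \<partial>Qn n)\<bar> \<le> \<delta>"
          by (rule Ah[OF n _ hK]) (use \<omega> in simp)
        then have "\<bar>(\<integral>x. min K \<bar>x\<bar> \<partial>empirical n (\<lambda>i. \<epsilon> n i \<omega>)) - (\<integral>x. min K \<bar>x\<bar> \<partial>Qn n)\<bar> / K \<le> \<delta>"
          using K(2) by (simp flip: diff_divide_distrib)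
        then have tr: "\<bar>(\<integral>x. min K \<bar>x\<bar> \<partial>empirical n (\<lambda>i. \<epsilon> n i \<omega>)) - (\<integral>x. min K \<bar>x\<bar> \<partial>Qn n)\<bar> \<le> \<eta> / 4"
          using K(2) \<delta>(2) by (simp add: pos_divide_le_eq mult.commute)
        have "mean_abs n (\<lambda>i. \<epsilon> n i \<omega>) = (\<integral>x. min K \<bar>x\<bar> \<partial>empirical n (\<lambda>i. \<epsilon> n i \<omega>)) + Z \<omega>"
          unfolding mean_abs_def Z_def
          by (subst integral_empirical) (auto simp: sum_subtractf right_diff_distrib diff_divide_distrib)
        moreover have "(\<integral>x. \<bar>x\<bar> \<partial>Qn n) = (\<integral>x. min K \<bar>x\<bar> \<partial>Qn n) + \<tau> n"
          unfolding \<tau>_def using integrable_truncated[OF Qn(1)[OF n], of K] Qn(2)[OF n] by simp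
        ultimately have "\<bar>mean_abs n (\<lambda>i. \<epsilon> n i \<omega>) - (\<integral>x. \<bar>x\<bar> \<partial>Qn n)\<bar> \<le> \<eta>"
          using tr Zl Z0[of \<omega>] \<tau>0 \<tau>2 \<kappa>(2) by linarith
        then show "\<omega> \<in> B n" using sp by (simp add: B_def)
      qed
      then have "prob (A n - C) \<le> prob (B n)" using Bs[OF n] by (rule finite_measure_mono)
      moreover have "prob (A n) \<le> prob (A n - C) + prob C"
      proof -
        have "prob (A n) \<le> prob ((A n - C) \<union> C)" using A(1)[of n] Cs by (intro finite_measure_mono) auto
        also have "\<dots> \<le> prob (A n - C) + prob C" using A(1)[of n] Cs by (intro measure_Un_le) auto
        finally show ?thesis .
      qed
      ultimately show ?case using PC elim(2) \<theta> by linarith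
    qed
  qed
  show "(\<lambda>n. measure (P n) (B n)) \<longlonglongrightarrow> 1"
  proof (rule order_tendstoI)
    fix a :: real assume "a < 1"
    then show "\<forall>\<^sub>F n in sequentially. a < measure (P n) (B n)" using low[of "1 - a"] by simp
  next
    fix a :: real assume "1 < a"
    then show "\<forall>\<^sub>F n in sequentially. measure (P n) (B n) < a"
      using prob_space.prob_le_1[OF P] by (intro always_eventually allI) (meson le_less_trans)
  qed
qed

theorem theorem3p6:
  fixes P :: "nat \<Rightarrow> 'w measure"
    and X :: "nat \<Rightarrow> 'a set"
    and M :: "nat \<Rightarrow> ('a \<Rightarrow> real) set"
    and x :: "nat \<Rightarrow> nat \<Rightarrow> 'a"
    and \<mu> :: "nat \<Rightarrow> 'a \<Rightarrow> real"
    and \<epsilon> :: "nat \<Rightarrow> nat \<Rightarrow> 'w \<Rightarrow> real"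
    and Y :: "nat \<Rightarrow> nat \<Rightarrow> 'w \<Rightarrow> real"
    and Qn :: "nat \<Rightarrow> real measure"
    and Q :: "real measure"
    and \<psi>_hat :: "nat \<Rightarrow> 'w \<Rightarrow> real \<Rightarrow> ereal"
    and \<mu>_hat :: "nat \<Rightarrow> 'w \<Rightarrow> 'a \<Rightarrow> real"
  assumes prob: "\<And>n. prob_space (P n)"
    and M_functions: "\<And>n. n \<ge> 1 \<Longrightarrow> M n \<subseteq> X n \<rightarrow>\<^sub>E UNIV"
    and M_shift: "\<And>n m c. n \<ge> 1 \<Longrightarrow> m \<in> M n \<Longrightarrow> (\<lambda>t\<in>X n. m t + c) \<in> M n"
    and design: "\<And>n i. n \<ge> 1 \<Longrightarrow> i \<in> {1..n} \<Longrightarrow> x n i \<in> X n"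
    and regression: "\<And>n. n \<ge> 1 \<Longrightarrow> \<mu> n \<in> M n"
    and indep: "\<And>n. n \<ge> 1 \<Longrightarrow> prob_space.indep_vars (P n) (\<lambda>_. borel) (\<epsilon> n) {1..n}"
    and error_distribution: "\<And>n i. n \<ge> 1 \<Longrightarrow> i \<in> {1..n} \<Longrightarrow> distr (P n) borel (\<epsilon> n i) = Qn n"
    and error_class: "\<And>n. n \<ge> 1 \<Longrightarrow> Qn n \<in> nondegenerate_distributions \<inter> finite_mean_distributions"
    and error_mean: "\<And>n i. n \<ge> 1 \<Longrightarrow> i \<in> {1..n} \<Longrightarrow> prob_space.expectation (P n) (\<epsilon> n i) = 0"
    and observations: "\<And>n i \<omega>. n \<ge> 1 \<Longrightarrow> i \<in> {1..n} \<Longrightarrow> \<omega> \<in> space (P n) \<Longrightarrow>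
          Y n i \<omega> = \<mu> n (x n i) + \<epsilon> n i \<omega>"
    and A1: "\<And>n. n \<ge> 1 \<Longrightarrow>
          closedin (powertop_real {1..n}) ((\<lambda>m. \<lambda>i\<in>{1..n}. m (x n i)) ` M n)"
    and A2: "Q \<in> nondegenerate_distributions \<inter> finite_mean_distributions"
            "(\<lambda>n. D1 (Qn n) Q) \<longlonglongrightarrow> 0"
    and A3: "\<And>c. c > 0 \<Longrightarrow> tends_in_probability_0 P (\<lambda>n \<omega>.
          SUP m\<in>{m \<in> M n. mean_abs n (\<lambda>i. m (x n i) - \<mu> n (x n i)) \<le> c}.
            D_BL (empirical n (\<lambda>i. Y n i \<omega> - m (x n i)))
                 (Qn n \<star> empirical n (\<lambda>i. \<mu> n (x n i) - m (x n i))))"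
    and estimators: "\<And>n \<omega>. n \<ge> 1 \<Longrightarrow> \<omega> \<in> space (P n) \<Longrightarrow>
          \<exists>\<theta>. is_mle n (x n) (M n) (\<lambda>i. Y n i \<omega>) \<theta> \<Longrightarrow>
          is_mle n (x n) (M n) (\<lambda>i. Y n i \<omega>) (\<psi>_hat n \<omega>, \<mu>_hat n \<omega>)"
  shows "asymptotic_probability_one P
           (\<lambda>n. {\<omega> \<in> space (P n). \<exists>\<theta>. is_mle n (x n) (M n) (\<lambda>i. Y n i \<omega>) \<theta>})
       \<and> tends_in_probability_0 P
           (\<lambda>n \<omega>. \<integral>t. \<bar>exp_of (\<psi>_hat n \<omega>) t - exp_of (psi (Qn n)) t\<bar> \<partial>lborel)
       \<and> tends_in_probability_0 P
           (\<lambda>n \<omega>. mean_abs n (\<lambda>i. \<mu>_hat n \<omega> (x n i) - \<mu> n (x n i)))"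
proof -
  have shift: "shift_invariant n (x n) (M n)" if n: "n \<ge> 1" for n
    unfolding shift_invariant_def
  proof (intro ballI allI)
    fix m c assume "m \<in> M n"
    then have "(\<lambda>t\<in>X n. m t + c) \<in> M n" by (rule M_shift[OF n])
    then show "\<exists>m'\<in>M n. \<forall>i\<in>{1..n}. m' (x n i) = m (x n i) + c"
      using design[OF n] by (intro bexI[of _ "\<lambda>t\<in>X n. m t + c"]) auto
  qed
  have meas: "\<epsilon> n i \<in> borel_measurable (P n)" if "n \<ge> 1" "i \<in> {1..n}" for n i
  proof -
    have "\<forall>i\<in>{1..n}. \<epsilon> n i \<in> borel_measurable (P n)"
      using indep[OF that(1)] unfolding prob_space.indep_vars_def2[OF prob] by (rule conjunct1)
    then show ?thesis using that(2) by (rule bspec)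
  qed
  note Qn = nondegenerate_finite_meanD(1,2)[OF error_class]
  note Q = nondegenerate_finite_meanD(1,2)[OF A2(1)]
  have mean0: "(\<integral>t. t \<partial>Qn n) = 0" if n: "n \<ge> 1" for n
  proof -
    have i: "1 \<in> {1..n}" using n by simp
    have "(\<integral>t. t \<partial>distr (P n) borel (\<epsilon> n 1)) = (\<integral>\<omega>. \<epsilon> n 1 \<omega> \<partial>P n)"
      by (rule integral_distr[OF meas[OF n i]]) simp
    then show ?thesis using error_distribution[OF n i] error_mean[OF n i] by simp
  qed
  define near where "near c n e \<eta> \<longleftrightarrow> \<bar>mean_abs n e - (\<integral>t. \<bar>t\<bar> \<partial>Qn n)\<bar> \<le> \<eta> \<and>
    (\<forall>m\<in>M n. mean_abs n (\<lambda>i. m (x n i) - \<mu> n (x n i)) \<le> c \<longrightarrow>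
      D_BL (empirical n (\<lambda>i. \<mu> n (x n i) + e i - m (x n i)))
        (Qn n \<star> empirical n (\<lambda>i. \<mu> n (x n i) - m (x n i))) \<le> \<eta>)" for c n e \<eta>
  define consistent where "consistent n y \<delta> \<longleftrightarrow> (\<exists>\<theta>. is_mle n (x n) (M n) y \<theta>) \<and>
    (\<forall>\<phi> m. is_mle n (x n) (M n) y (\<phi>, m) \<longrightarrow>
      (\<integral>t. \<bar>exp_of \<phi> t - exp_of (psi (Qn n)) t\<bar> \<partial>lborel) \<le> \<delta> \<and>
      mean_abs n (\<lambda>i. m (x n i) - \<mu> n (x n i)) \<le> \<delta>)" for n y \<delta>
  have "\<exists>c>0. \<forall>\<delta>>0. \<exists>\<eta>>0. \<exists>N0\<ge>1. \<forall>n\<ge>N0. \<forall>e. near c n e \<eta> \<longrightarrow> consistent n (\<lambda>i. \<mu> n (x n i) + e i) \<delta>"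
    unfolding near_def consistent_def
  proof (rule consistency_deterministic[where M = M and x = x and \<mu> = \<mu> and Qn = Qn and Q = Q])
    show "closedin (powertop_real {1..n}) ((\<lambda>m. \<lambda>i\<in>{1..n}. m (x n i)) ` M n)" if "n \<ge> 1" for n by (rule A1[OF that])
  qed (fact shift regression error_class mean0 A2)+
  then obtain c where c: "c > 0"
    and det: "\<forall>\<delta>>0. \<exists>\<eta>>0. \<exists>N0\<ge>1. \<forall>n\<ge>N0. \<forall>e. near c n e \<eta> \<longrightarrow> consistent n (\<lambda>i. \<mu> n (x n i) + e i) \<delta>"
    by blast
  \<comment> \<open>The supremum in the third assumption is over a bounded set, hence an upper bound.\<close>
  have ball: "\<exists>A. (\<forall>n. A n \<in> sets (P n)) \<and> (\<lambda>n. measure (P n) (A n)) \<longlonglongrightarrow> 1 \<and>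
      (\<forall>n\<ge>1. \<forall>\<omega>\<in>A n. \<forall>m\<in>M n. mean_abs n (\<lambda>i. m (x n i) - \<mu> n (x n i)) \<le> c \<longrightarrow>
        D_BL (empirical n (\<lambda>i. Y n i \<omega> - m (x n i))) (Qn n \<star> empirical n (\<lambda>i. \<mu> n (x n i) - m (x n i))) \<le> \<eta>)"
    if \<eta>: "\<eta> > 0" for \<eta>
  proof -
    let ?S = "\<lambda>n. {m \<in> M n. mean_abs n (\<lambda>i. m (x n i) - \<mu> n (x n i)) \<le> c}"
    let ?D = "\<lambda>n \<omega> m. D_BL (empirical n (\<lambda>i. Y n i \<omega> - m (x n i))) (Qn n \<star> empirical n (\<lambda>i. \<mu> n (x n i) - m (x n i)))"
    have "asymptotic_probability_one P (\<lambda>n. {\<omega> \<in> space (P n). \<bar>SUP m\<in>?S n. ?D n \<omega> m\<bar> \<le> \<eta>})"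
      using A3[OF c, unfolded tends_in_probability_0_def, rule_format, OF \<eta>] .
    then obtain A where A': "\<forall>n. A n \<in> sets (P n) \<and> A n \<subseteq> {\<omega> \<in> space (P n). \<bar>SUP m\<in>?S n. ?D n \<omega> m\<bar> \<le> \<eta>}"
      and A_lim: "(\<lambda>n. measure (P n) (A n)) \<longlonglongrightarrow> 1"
      unfolding asymptotic_probability_one_def by (elim exE conjE) (rule that)
    have A: "A n \<in> sets (P n)" and sub: "A n \<subseteq> {\<omega> \<in> space (P n). \<bar>SUP m\<in>?S n. ?D n \<omega> m\<bar> \<le> \<eta>}" for n
      using A' by blast+
    have "?D n \<omega> m \<le> \<eta>" if n: "n \<ge> 1" and \<omega>: "\<omega> \<in> A n" and m: "m \<in> ?S n" for n \<omega> m
    proof -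
      note rd = real_distribution_empirical[OF n]
      have "bdd_above (?D n \<omega> ` ?S n)"
        by (rule bdd_aboveI2[of _ _ 2]) (intro D_BL_le_2 rd real_distribution_convolution Qn[OF n])
      then have "?D n \<omega> m \<le> (SUP m\<in>?S n. ?D n \<omega> m)" by (rule cSUP_upper[OF m])
      moreover have "\<bar>SUP m\<in>?S n. ?D n \<omega> m\<bar> \<le> \<eta>" using sub[of n] \<omega> by blast
      ultimately show ?thesis by linarith
    qed
    then show ?thesis using A A_lim by (intro exI[of _ A]) simp
  qed
  have errors: "\<exists>A. (\<forall>n. A n \<in> sets (P n)) \<and> (\<lambda>n. measure (P n) (A n)) \<longlonglongrightarrow> 1 \<and>
      (\<forall>n\<ge>1. \<forall>\<omega>\<in>A n. \<forall>h\<in>H_BL. \<bar>(\<integral>x. h x \<partial>empirical n (\<lambda>i. \<epsilon> n i \<omega>)) - (\<integral>x. h x \<partial>Qn n)\<bar> \<le> \<delta>)"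
    if \<delta>: "\<delta> > 0" for \<delta>
  proof -
    obtain A where A: "\<And>n. A n \<in> sets (P n)" "(\<lambda>n. measure (P n) (A n)) \<longlonglongrightarrow> 1"
      and D: "\<And>n \<omega> m. n \<ge> 1 \<Longrightarrow> \<omega> \<in> A n \<Longrightarrow> m \<in> M n \<Longrightarrow> mean_abs n (\<lambda>i. m (x n i) - \<mu> n (x n i)) \<le> c \<Longrightarrow>
        D_BL (empirical n (\<lambda>i. Y n i \<omega> - m (x n i))) (Qn n \<star> empirical n (\<lambda>i. \<mu> n (x n i) - m (x n i))) \<le> \<delta>"
      using ball[OF \<delta>] by blast
    have "\<bar>(\<integral>x. h x \<partial>empirical n (\<lambda>i. \<epsilon> n i \<omega>)) - (\<integral>x. h x \<partial>Qn n)\<bar> \<le> \<delta>"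
      if n: "n \<ge> 1" and \<omega>: "\<omega> \<in> A n" and h: "h \<in> H_BL" for n \<omega> h
    proof -
      have sp: "\<omega> \<in> space (P n)" using sets.sets_into_space[OF A(1)[of n]] \<omega> by blast
      have rd: "real_distribution (empirical n v)" for v by (rule real_distribution_empirical[OF n])
      have "empirical n (\<lambda>i. Y n i \<omega> - \<mu> n (x n i)) = empirical n (\<lambda>i. \<epsilon> n i \<omega>)"
        by (rule empirical_cong) (simp add: observations[OF n _ sp])
      moreover have "(Qn n \<star> empirical n (\<lambda>i. 0)) = Qn n" by (rule convolution_empirical_zero[OF Qn(1)[OF n] n])
      moreover have "mean_abs n (\<lambda>i. \<mu> n (x n i) - \<mu> n (x n i)) \<le> c" using c by (simp add: mean_abs_def)
      ultimately have "D_BL (empirical n (\<lambda>i. \<epsilon> n i \<omega>)) (Qn n) \<le> \<delta>"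
        using D[OF n \<omega> regression[OF n]] by simp
      then show ?thesis using H_BL_diff_le_D_BL[OF rd Qn(1)[OF n] h] by (meson order_trans)
    qed
    then show ?thesis using A by (intro exI[of _ A]) simp
  qed
  have good: "\<exists>A N0. (\<forall>n. A n \<in> sets (P n)) \<and> (\<lambda>n. measure (P n) (A n)) \<longlonglongrightarrow> 1 \<and>
      (\<forall>n\<ge>N0. \<forall>\<omega>\<in>A n. \<omega> \<in> space (P n) \<and> (\<exists>\<theta>. is_mle n (x n) (M n) (\<lambda>i. Y n i \<omega>) \<theta>) \<and>
        (\<integral>t. \<bar>exp_of (\<psi>_hat n \<omega>) t - exp_of (psi (Qn n)) t\<bar> \<partial>lborel) \<le> \<delta> \<and>
        mean_abs n (\<lambda>i. \<mu>_hat n \<omega> (x n i) - \<mu> n (x n i)) \<le> \<delta>)"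
    if \<delta>: "\<delta> > 0" for \<delta>
  proof -
    obtain \<eta> N0 where \<eta>: "\<eta> > 0" and N0: "N0 \<ge> 1"
      and det': "\<forall>n\<ge>N0. \<forall>e. near c n e \<eta> \<longrightarrow> consistent n (\<lambda>i. \<mu> n (x n i) + e i) \<delta>"
      using det[rule_format, OF \<delta>] by blast
    obtain A where A: "\<And>n. A n \<in> sets (P n)" "(\<lambda>n. measure (P n) (A n)) \<longlonglongrightarrow> 1"
      and D: "\<And>n \<omega> m. n \<ge> 1 \<Longrightarrow> \<omega> \<in> A n \<Longrightarrow> m \<in> M n \<Longrightarrow> mean_abs n (\<lambda>i. m (x n i) - \<mu> n (x n i)) \<le> c \<Longrightarrow>
        D_BL (empirical n (\<lambda>i. Y n i \<omega> - m (x n i))) (Qn n \<star> empirical n (\<lambda>i. \<mu> n (x n i) - m (x n i))) \<le> \<eta>"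
      using ball[OF \<eta>] by blast
    define B0 where "B0 n = {\<omega> \<in> space (P n). \<bar>mean_abs n (\<lambda>i. \<epsilon> n i \<omega>) - (\<integral>x. \<bar>x\<bar> \<partial>Qn n)\<bar> \<le> \<eta>}" for n
    note conc' = mean_abs_error_concentrates[where \<epsilon> = \<epsilon> and Qn = Qn and Q = Q and P = P and \<eta> = \<eta>,
        OF prob meas error_distribution Qn Q A2(2) errors \<eta>, folded B0_def]
    have conc: "n \<ge> 1 \<Longrightarrow> B0 n \<in> sets (P n)" "(\<lambda>n. measure (P n) (B0 n)) \<longlonglongrightarrow> 1" for n
      by (rule conc'(1); assumption) (rule conc'(2); assumption)
    define B where "B n = (if n \<ge> 1 then B0 n else {})" for n
    have B: "B n \<in> sets (P n)" for n using conc(1)[of n] by (simp add: B_def)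
    have "\<forall>\<^sub>F n in sequentially. measure (P n) (B0 n) = measure (P n) (B n)"
      using eventually_ge_at_top[of 1] by eventually_elim (simp add: B_def)
    then have B1: "(\<lambda>n. measure (P n) (B n)) \<longlonglongrightarrow> 1" using conc(2) by (rule Lim_transform_eventually[rotated])
    have "\<omega> \<in> space (P n) \<and> (\<exists>\<theta>. is_mle n (x n) (M n) (\<lambda>i. Y n i \<omega>) \<theta>) \<and>
        (\<integral>t. \<bar>exp_of (\<psi>_hat n \<omega>) t - exp_of (psi (Qn n)) t\<bar> \<partial>lborel) \<le> \<delta> \<and>
        mean_abs n (\<lambda>i. \<mu>_hat n \<omega> (x n i) - \<mu> n (x n i)) \<le> \<delta>"
      if nN: "n \<ge> N0" and \<omega>: "\<omega> \<in> A n \<inter> B n" for n \<omega>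
    proof -
      have n: "n \<ge> 1" using nN N0 by simp
      have sp: "\<omega> \<in> space (P n)" and me: "\<bar>mean_abs n (\<lambda>i. \<epsilon> n i \<omega>) - (\<integral>x. \<bar>x\<bar> \<partial>Qn n)\<bar> \<le> \<eta>"
        using \<omega> n by (auto simp: B_def B0_def)
      \<comment> \<open>The data are prescribed on the design only, which is all that the estimator sees.\<close>
      have Yeq: "empirical n (\<lambda>i. \<mu> n (x n i) + \<epsilon> n i \<omega> - m (x n i)) = empirical n (\<lambda>i. Y n i \<omega> - m (x n i))" for m
        by (rule empirical_cong) (simp add: observations[OF n _ sp])
      have mle: "is_mle n (x n) (M n) (\<lambda>i. \<mu> n (x n i) + \<epsilon> n i \<omega>) = is_mle n (x n) (M n) (\<lambda>i. Y n i \<omega>)"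
        unfolding is_mle_def Yeq ..
      have "near c n (\<lambda>i. \<epsilon> n i \<omega>) \<eta>"
        unfolding near_def Yeq using me D[OF n] \<omega> by blast
      then have "consistent n (\<lambda>i. \<mu> n (x n i) + \<epsilon> n i \<omega>) \<delta>" by (rule det'[rule_format, OF nN])
      then have *: "consistent n (\<lambda>i. Y n i \<omega>) \<delta>" unfolding consistent_def mle .
      then have "is_mle n (x n) (M n) (\<lambda>i. Y n i \<omega>) (\<psi>_hat n \<omega>, \<mu>_hat n \<omega>)"
        unfolding consistent_def by (intro estimators[OF n sp]) blast
      then show ?thesis using * sp unfolding consistent_def by blast
    qed
    then show ?thesis using measure_inter_tendsto_1[OF prob A B B1] A(1) B
      by (intro exI[of _ "\<lambda>n. A n \<inter> B n"] exI[of _ N0]) auto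
  qed
  have event: "asymptotic_probability_one P E"
    if \<delta>: "\<delta> > 0" and E: "\<And>n \<omega>. \<omega> \<in> space (P n) \<Longrightarrow> \<exists>\<theta>. is_mle n (x n) (M n) (\<lambda>i. Y n i \<omega>) \<theta> \<Longrightarrow>
      (\<integral>t. \<bar>exp_of (\<psi>_hat n \<omega>) t - exp_of (psi (Qn n)) t\<bar> \<partial>lborel) \<le> \<delta> \<Longrightarrow>
      mean_abs n (\<lambda>i. \<mu>_hat n \<omega> (x n i) - \<mu> n (x n i)) \<le> \<delta> \<Longrightarrow> \<omega> \<in> E n" for \<delta> E
  proof -
    obtain A N0 where A: "\<And>n. A n \<in> sets (P n)" "(\<lambda>n. measure (P n) (A n)) \<longlonglongrightarrow> 1"
      and g: "\<forall>n\<ge>N0. \<forall>\<omega>\<in>A n. \<omega> \<in> space (P n) \<and> (\<exists>\<theta>. is_mle n (x n) (M n) (\<lambda>i. Y n i \<omega>) \<theta>) \<and>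
        (\<integral>t. \<bar>exp_of (\<psi>_hat n \<omega>) t - exp_of (psi (Qn n)) t\<bar> \<partial>lborel) \<le> \<delta> \<and>
        mean_abs n (\<lambda>i. \<mu>_hat n \<omega> (x n i) - \<mu> n (x n i)) \<le> \<delta>"
      using good[OF \<delta>] by blast
    show ?thesis by (rule asymptotic_probability_oneI[OF prob A, of N0]) (use g E in blast)
  qed
  show ?thesis
    unfolding tends_in_probability_0_def
  proof (intro conjI allI impI)
    show "asymptotic_probability_one P (\<lambda>n. {\<omega> \<in> space (P n). \<exists>\<theta>. is_mle n (x n) (M n) (\<lambda>i. Y n i \<omega>) \<theta>})"
      by (rule event[of 1]) auto
    fix \<delta> :: real assume \<delta>: "\<delta> > 0"
    show "asymptotic_probability_one P (\<lambda>n. {\<omega> \<in> space (P n).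
      \<bar>\<integral>t. \<bar>exp_of (\<psi>_hat n \<omega>) t - exp_of (psi (Qn n)) t\<bar> \<partial>lborel\<bar> \<le> \<delta>})"
      by (rule event[OF \<delta>]) auto
    have "0 \<le> mean_abs n v" for n v by (simp add: mean_abs_def sum_nonneg)
    then show "asymptotic_probability_one P (\<lambda>n. {\<omega> \<in> space (P n).
      \<bar>mean_abs n (\<lambda>i. \<mu>_hat n \<omega> (x n i) - \<mu> n (x n i))\<bar> \<le> \<delta>})"
      by (intro event[OF \<delta>]) auto
  qed
qed

end
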